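(* Let $\Gamma$ be a group acting by automorphisms on a simplicial tree $\mathcal{T}$ via $\rho:\Gamma\to\mathrm{Aut}(\mathcal{T})$. Suppose that $\Gamma$ acts minimally on $\mathcal{T}$ and that every vertex of $\mathcal{T}$ has valence greater than $2$. Then exactly one of the following holds. (i) There exists $l\in\{1,2\}$ so that for each $n$, $\Gamma$ acts transitively on $$\{[x,y]\in\mathcal{E}^{(n)} : d(x,v)\equiv 0 \pmod l\},$$ where $v$ is any vertex of $\mathcal{T}$. (ii) $\Gamma$ fixes a point $a$ in the boundary $\partial\mathcal{T}$ of $\mathcal{T}$. (iii) There exists an infinite family $\{[\delta^1 f_{\rho(\Gamma)s_n}]\}_{n\in\mathbb{N}}$ of linearly independent classes in $\mathrm{H}^2_{\mathrm b}(\Gamma,\mathbb{R})$, where each $s_n$ is an oriented geodesic segment of $\mathcal{T}$ and $f_{\rho(\Gamma)s_n}$ is the associated median quasimorphism. In particular, there exists an injective $\mathbb{R}$-linear map $\ell^1\to \mathrm{H}^2_{\mathrm b}(\Gamma,\mathbb{R})$.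
   Context: Minimal action: there is no proper non-empty $\Gamma$-invariant subtree. All geodesic segments have vertices of $\mathcal{T}$ as endpoints; $d$ is the combinatorial distance. For $n\in\mathbb{N}$, $\mathcal{E}^{(n)}$ is the set of oriented geodesic segments $[x,y]$ of length $n$ in $\mathcal{T}$ (oriented from $x$ to $y$). Median quasimorphisms: fix a base vertex $v\in\mathcal{T}$. For an oriented geodesic segment $s$ of length $n$, let $\rho(\Gamma)s\subset\mathcal{E}^{(n)}$ be its $\Gamma$-orbit. For vertices $x,y$ let $\llbracket x,y\rrbracket\subset\mathcal{E}^{(n)}$ be the set of geodesic segments of length $n$ contained in the geodesic $[x,y]$ and oriented as $[x,y]$. The median quasimorphism $f_{\rho(\Gamma)s}:\Gamma\to\mathbb{Z}$ is $$f_{\rho(\Gamma)s}(g)=\sum_{\gamma\in\rho(\Gamma)s}\bigl(\chi_{\llbracket v,gv\rrbracket}(\gamma)-\chi_{\llbracket gv,v\rrbracket}(\gamma)\bigr).$$ It is a quasimorphism, so $\delta^1 f(g,h)=f(h)-f(gh)+f(g)$ is a bounded $2$-cocycle and defines a class $[\delta^1 f]$ in the second bounded cohomology $\mathrm{H}^2_{\mathrm b}(\Gamma,\mathbb{R})$ (trivial coefficients). $\ell^1$ is the space of absolutely summable real sequences. *)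

theory Defs
  imports Complex_Main "HOL-Library.Sublist" "HOL-Algebra.Group_Action"
    "HOL-Algebra.AbelCoset" "HOL-Algebra.Module"
begin

record 'v sgraph =
  verts :: "'v set"
  adj :: "'v \<Rightarrow> 'v \<Rightarrow> bool"

definition simple_graph :: "'v sgraph \<Rightarrow> bool" where
  "simple_graph T \<longleftrightarrow>
     (\<forall>x y. adj T x y \<longrightarrow> x \<in> verts T \<and> y \<in> verts T \<and> x \<noteq> y \<and> adj T y x)"

text \<open>Paths are recorded as the lists of the vertices they visit.\<close>

definition walk :: "'v sgraph \<Rightarrow> 'v list \<Rightarrow> bool" where
  "walk T p \<longleftrightarrow> p \<noteq> [] \<and> set p \<subseteq> verts T \<and> successively (adj T) p"

definition connected_graph :: "'v sgraph \<Rightarrow> bool" where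
  "connected_graph T \<longleftrightarrow>
     (\<forall>x\<in>verts T. \<forall>y\<in>verts T. \<exists>p. walk T p \<and> hd p = x \<and> last p = y)"

definition acyclic_graph :: "'v sgraph \<Rightarrow> bool" where
  "acyclic_graph T \<longleftrightarrow>
     \<not> (\<exists>p. walk T p \<and> distinct p \<and> length p \<ge> 3 \<and> adj T (last p) (hd p))"

definition is_tree :: "'v sgraph \<Rightarrow> bool" where
  "is_tree T \<longleftrightarrow>
     simple_graph T \<and> verts T \<noteq> {} \<and> connected_graph T \<and> acyclic_graph T"

definition subtree :: "'v sgraph \<Rightarrow> 'v sgraph \<Rightarrow> bool" where
  "subtree S T \<longleftrightarrow>
     is_tree S \<and> verts S \<subseteq> verts T \<and> (\<forall>x y. adj S x y \<longrightarrow> adj T x y)"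

text \<open>The valence of a vertex may be infinite, where \<^const>\<open>card\<close> returns 0.\<close>

definition valence_gt :: "'v sgraph \<Rightarrow> 'v \<Rightarrow> nat \<Rightarrow> bool" where
  "valence_gt T x k \<longleftrightarrow> infinite {y. adj T x y} \<or> card {y. adj T x y} > k"

definition gdist :: "'v sgraph \<Rightarrow> 'v \<Rightarrow> 'v \<Rightarrow> nat" where
  "gdist T x y = (LEAST n. \<exists>p. walk T p \<and> hd p = x \<and> last p = y \<and> length p = Suc n)"

text \<open>An oriented geodesic segment is the list of its vertices, in the order given by the
  orientation; a segment of length \<open>n\<close> has \<open>n + 1\<close> vertices.\<close>

definition geodesic :: "'v sgraph \<Rightarrow> 'v list \<Rightarrow> bool" where
  "geodesic T s \<longleftrightarrow> walk T s \<and> length s = Suc (gdist T (hd s) (last s))"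

definition seg_length :: "'v list \<Rightarrow> nat" where
  "seg_length s = length s - 1"

definition segments :: "'v sgraph \<Rightarrow> nat \<Rightarrow> 'v list set" where
  "segments T n = {s. geodesic T s \<and> seg_length s = n}"

definition geod :: "'v sgraph \<Rightarrow> 'v \<Rightarrow> 'v \<Rightarrow> 'v list" where
  "geod T x y = (THE s. geodesic T s \<and> hd s = x \<and> last s = y)"

text \<open>\<^const>\<open>sublist\<close> is the contiguous sublist relation, so it also compares orientations.\<close>

definition segments_in :: "'v sgraph \<Rightarrow> nat \<Rightarrow> 'v \<Rightarrow> 'v \<Rightarrow> 'v list set" where
  "segments_in T n x y = {s \<in> segments T n. sublist s (geod T x y)}"

text \<open>The boundary consists of the geodesic rays, two rays being identified if they eventually
  coincide up to a shift of the parameter.\<close>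

definition rays :: "'v sgraph \<Rightarrow> (nat \<Rightarrow> 'v) set" where
  "rays T = {r. range r \<subseteq> verts T \<and> (\<forall>i j. i \<le> j \<longrightarrow> gdist T (r i) (r j) = j - i)}"

definition ray_equiv :: "'v sgraph \<Rightarrow> ((nat \<Rightarrow> 'v) \<times> (nat \<Rightarrow> 'v)) set" where
  "ray_equiv T =
     {(r, r'). r \<in> rays T \<and> r' \<in> rays T \<and> (\<exists>m n. \<forall>i. r (m + i) = r' (n + i))}"

definition tree_boundary :: "'v sgraph \<Rightarrow> (nat \<Rightarrow> 'v) set set" where
  "tree_boundary T = rays T // ray_equiv T"

text \<open>Automorphisms may invert edges.\<close>

definition Aut_tree :: "'v sgraph \<Rightarrow> ('v \<Rightarrow> 'v) monoid" where
  "Aut_tree T = BijGroup (verts T)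
     \<lparr>carrier := {f \<in> Bij (verts T).
        \<forall>x\<in>verts T. \<forall>y\<in>verts T. adj T (f x) (f y) \<longleftrightarrow> adj T x y}\<rparr>"

definition invariant_subtree ::
    "('g, 'm) monoid_scheme \<Rightarrow> 'v sgraph \<Rightarrow> ('g \<Rightarrow> 'v \<Rightarrow> 'v) \<Rightarrow> 'v sgraph \<Rightarrow> bool" where
  "invariant_subtree G T \<rho> S \<longleftrightarrow> subtree S T \<and>
     (\<forall>g\<in>carrier G. \<rho> g ` verts S = verts S \<and>
        (\<forall>x y. adj S x y \<longrightarrow> adj S (\<rho> g x) (\<rho> g y)))"

text \<open>Trees are non-empty by definition.\<close>

definition minimal_action ::
    "('g, 'm) monoid_scheme \<Rightarrow> 'v sgraph \<Rightarrow> ('g \<Rightarrow> 'v \<Rightarrow> 'v) \<Rightarrow> bool" where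
  "minimal_action G T \<rho> \<longleftrightarrow> (\<forall>S. invariant_subtree G T \<rho> S \<longrightarrow> S = T)"

text \<open>Transitivity of the induced action on a set of segments; \<^const>\<open>transitive_action\<close>
  includes that this set is invariant.\<close>

definition transitive_on_segments ::
    "('g, 'm) monoid_scheme \<Rightarrow> ('g \<Rightarrow> 'v \<Rightarrow> 'v) \<Rightarrow> 'v list set \<Rightarrow> bool" where
  "transitive_on_segments G \<rho> X \<longleftrightarrow>
     transitive_action G X (\<lambda>g. \<lambda>s\<in>X. map (\<rho> g) s)"

definition fixes_boundary_point ::
    "('g, 'm) monoid_scheme \<Rightarrow> ('g \<Rightarrow> 'v \<Rightarrow> 'v) \<Rightarrow> (nat \<Rightarrow> 'v) set \<Rightarrow> bool" where
  "fixes_boundary_point G \<rho> a \<longleftrightarrow> (\<forall>g\<in>carrier G. (\<lambda>r. \<rho> g \<circ> r) ` a = a)"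

definition seg_orbit ::
    "('g, 'm) monoid_scheme \<Rightarrow> ('g \<Rightarrow> 'v \<Rightarrow> 'v) \<Rightarrow> 'v list \<Rightarrow> 'v list set" where
  "seg_orbit G \<rho> s = orbit G (\<lambda>g. map (\<rho> g)) s"

text \<open>The orbit of \<open>s\<close> may be infinite. The sum runs over the members of the orbit that lie in one of
  the two finite sets of segments; all the other summands are zero.\<close>

definition median_qm ::
    "('g, 'm) monoid_scheme \<Rightarrow> 'v sgraph \<Rightarrow> ('g \<Rightarrow> 'v \<Rightarrow> 'v) \<Rightarrow> 'v \<Rightarrow> 'v list \<Rightarrow> 'g \<Rightarrow> int" where
  "median_qm G T \<rho> v s g =
     (let A = segments_in T (seg_length s) v (\<rho> g v);
          B = segments_in T (seg_length s) (\<rho> g v) v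
      in \<Sum>\<gamma>\<in>seg_orbit G \<rho> s \<inter> (A \<union> B). of_bool (\<gamma> \<in> A) - of_bool (\<gamma> \<in> B))"

text \<open>The inhomogeneous bar complex with trivial real coefficients; cochains are extensional.\<close>

definition delta1 :: "('g, 'm) monoid_scheme \<Rightarrow> ('g \<Rightarrow> real) \<Rightarrow> 'g \<times> 'g \<Rightarrow> real" where
  "delta1 G f = (\<lambda>(g, h)\<in>carrier G \<times> carrier G. f h - f (g \<otimes>\<^bsub>G\<^esub> h) + f g)"

text \<open>Real vector spaces are encoded as \<^locale>\<open>module\<close> records with scalars of type \<^typ>\<open>real\<close>.
  The fields \<^const>\<open>mult\<close> and \<^const>\<open>one\<close> play no role for modules.\<close>

definition bounded_cocycles2 ::
    "('g, 'm) monoid_scheme \<Rightarrow> (real, 'g \<times> 'g \<Rightarrow> real) module" where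
  "bounded_cocycles2 G =
     \<lparr>carrier = {c \<in> extensional (carrier G \<times> carrier G).
        (\<exists>K. \<forall>x\<in>carrier G \<times> carrier G. \<bar>c x\<bar> \<le> K) \<and>
        (\<forall>g\<in>carrier G. \<forall>h\<in>carrier G. \<forall>k\<in>carrier G.
           c (h, k) - c (g \<otimes>\<^bsub>G\<^esub> h, k) + c (g, h \<otimes>\<^bsub>G\<^esub> k) - c (g, h) = 0)},
      mult = undefined, one = undefined,
      zero = (\<lambda>x\<in>carrier G \<times> carrier G. 0),
      add = (\<lambda>a b. \<lambda>x\<in>carrier G \<times> carrier G. a x + b x),
      smult = (\<lambda>r a. \<lambda>x\<in>carrier G \<times> carrier G. r * a x)\<rparr>"

definition bounded_coboundaries2 :: "('g, 'm) monoid_scheme \<Rightarrow> ('g \<times> 'g \<Rightarrow> real) set" where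
  "bounded_coboundaries2 G =
     delta1 G ` {b \<in> extensional (carrier G). \<exists>K. \<forall>g\<in>carrier G. \<bar>b g\<bar> \<le> K}"

definition H2b :: "('g, 'm) monoid_scheme \<Rightarrow> (real, ('g \<times> 'g \<Rightarrow> real) set) module" where
  "H2b G =
     (let Z = bounded_cocycles2 G; B = bounded_coboundaries2 G in
      \<lparr>carrier = a_rcosets\<^bsub>Z\<^esub> B,
       mult = undefined, one = undefined,
       zero = B,
       add = set_add Z,
       smult = (\<lambda>r X. \<Union>x\<in>X. B +>\<^bsub>Z\<^esub> (r \<odot>\<^bsub>Z\<^esub> x))\<rparr>)"

definition H2b_class ::
    "('g, 'm) monoid_scheme \<Rightarrow> ('g \<times> 'g \<Rightarrow> real) \<Rightarrow> ('g \<times> 'g \<Rightarrow> real) set" where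
  "H2b_class G c = bounded_coboundaries2 G +>\<^bsub>bounded_cocycles2 G\<^esub> c"

definition median_class ::
    "('g, 'm) monoid_scheme \<Rightarrow> 'v sgraph \<Rightarrow> ('g \<Rightarrow> 'v \<Rightarrow> 'v) \<Rightarrow> 'v \<Rightarrow> 'v list
      \<Rightarrow> ('g \<times> 'g \<Rightarrow> real) set" where
  "median_class G T \<rho> v s = H2b_class G (delta1 G (\<lambda>g. real_of_int (median_qm G T \<rho> v s g)))"

definition lin_indep_family :: "(real, 'b, 'm) module_scheme \<Rightarrow> ('i \<Rightarrow> 'b) \<Rightarrow> bool" where
  "lin_indep_family M c \<longleftrightarrow> (\<forall>i. c i \<in> carrier M) \<and>
     (\<forall>F u. finite F \<longrightarrow> (\<Oplus>\<^bsub>M\<^esub>i\<in>F. u i \<odot>\<^bsub>M\<^esub> c i) = \<zero>\<^bsub>M\<^esub> \<longrightarrow> (\<forall>i\<in>F. u i = 0))"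

definition linear_map ::
    "(real, 'a, 'm) module_scheme \<Rightarrow> (real, 'b, 'n) module_scheme \<Rightarrow> ('a \<Rightarrow> 'b) \<Rightarrow> bool" where
  "linear_map M N \<phi> \<longleftrightarrow> \<phi> \<in> carrier M \<rightarrow> carrier N \<and>
     (\<forall>x\<in>carrier M. \<forall>y\<in>carrier M. \<phi> (x \<oplus>\<^bsub>M\<^esub> y) = \<phi> x \<oplus>\<^bsub>N\<^esub> \<phi> y) \<and>
     (\<forall>r. \<forall>x\<in>carrier M. \<phi> (r \<odot>\<^bsub>M\<^esub> x) = r \<odot>\<^bsub>N\<^esub> \<phi> x)"

definition ell1 :: "(real, nat \<Rightarrow> real) module" where
  "ell1 =
     \<lparr>carrier = {a. summable (\<lambda>n. \<bar>a n\<bar>)},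
      mult = undefined, one = undefined,
      zero = (\<lambda>n. 0),
      add = (\<lambda>a b n. a n + b n),
      smult = (\<lambda>r a n. r * a n)\<rparr>"

end

theory Submission
  imports Defs
begin

text \<open>
  A segment of length \<open>n\<close> is determined by its endpoints, so the argument is about pairs of vertices
  up to the group. If there is no fixed end, any oriented segment can be followed on a geodesic by a
  translate of any other one; fix a translation \<open>a\<close> along an axis. If every segment lay on a
  translate of this axis, up to orientation, then the number of orbits of segments of length \<open>n\<close>
  would be bounded, hence long segments would have a unique extension up to their stabilisers; then
  all segments of even length are reversible, which gives local transitivity. Otherwise, take a
  translation \<open>b\<close> whose axis contains a segment that is off the axis of \<open>a\<close>. In a word such as
  \<open>b a\<^sup>L b a\<^sup>M b a\<^sup>N\<close> the occurrences of off-axis segments reveal the exponents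
    and their cyclic order.
  Hence the median quasimorphism of a segment spelled
    by \<open>b a\<^sup>L b a\<^sup>M b\<close> is positive on the powers of
  this word and non-positive on those of \<open>b a\<^sup>L b a\<^sup>N b a\<^sup>M\<close>, although every homomorphism to the reals takes
  the same value on the two words; disjoint sets of exponents yield a diagonal family. Conversely, a
  fixed end turns every median quasimorphism into a homomorphism up to a bounded error, and local
  transitivity makes it vanish.
\<close>

section \<open>The metric of a tree\<close>

text \<open>Valences may be infinite and segments of one length may fall into infinitely many
  orbits, so orbits are only ever counted through finite sets of inequivalent segments. Each word
  has three blocks because two are too few: xy and yx are conjugate, and on powers of conjugate
  elements a quasimorphism differs boundedly. The cyclic orders xyz and xzy are different, and each
  is the other read backwards. Hence reversed copies of the spelled segment, which a median
  quasimorphism subtracts, are absent from its own word and can only lower the value on the other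
  one. Inside the fixed part of a block the marks are not under control, so the exponents are taken
  at least as large as the length of that part: a longer gap between marks must come from a run of
  \<open>a\<close>. The defect bounds of the chosen quasimorphisms grow with the segments, so the
  map on sequences divides by these bounds. The infinite sums converge because at a fixed group
  element all these quasimorphisms are bounded by twice the displacement of the base vertex.\<close>

lemma walk_Cons:
  "walk T (x # xs) \<longleftrightarrow> x \<in> verts T \<and> (xs = [] \<or> adj T x (hd xs) \<and> walk T xs)"
  by (auto simp: walk_def successively_Cons)

lemma walk_append:
  assumes "p \<noteq> []" "q \<noteq> []"
  shows "walk T (p @ q) \<longleftrightarrow> walk T p \<and> walk T q \<and> adj T (last p) (hd q)"
  using assms by (auto simp: walk_def successively_append_iff)

text \<open>Loop erasure: if the new head already lies on the erased tail, the tail is cut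
  there.\<close>

lemma walk_to_distinct:
  assumes "walk T p"
  shows "\<exists>q. walk T q \<and> distinct q \<and> hd q = hd p \<and> last q = last p \<and> set q \<subseteq> set p"
  using assms
proof (induction p)
  case Nil
  then show ?case by (simp add: walk_def)
next
  case (Cons x xs)
  show ?case
  proof (cases "xs = []")
    case True
    with Cons.prems show ?thesis by (intro exI[of _ "[x]"]) simp
  next
    case False
    with Cons.prems have w: "x \<in> verts T" "adj T x (hd xs)" "walk T xs"
      by (auto simp: walk_Cons)
    from Cons.IH[OF w(3)] obtain q
      where q: "walk T q" "distinct q" "hd q = hd xs" "last q = last xs" "set q \<subseteq> set xs"
      by blast
    have qne: "q \<noteq> []" using q(1) by (auto simp: walk_def)
    show ?thesis
    proof (cases "x \<in> set q")
      case True
      then obtain ys zs where s: "q = ys @ x # zs" by (meson split_list)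
      have "walk T (x # zs)" using q(1) unfolding s by (auto simp: walk_def successively_append_iff)
      moreover have "last (x # zs) = last (x # xs)" using q(4) False unfolding s by simp
      ultimately show ?thesis using q unfolding s by (intro exI[of _ "x # zs"]) auto
    next
      case False
      then show ?thesis using q w qne \<open>xs \<noteq> []\<close>
        by (intro exI[of _ "x # q"]) (auto simp: walk_Cons)
    qed
  qed
qed

locale tree_graph =
  fixes T :: "'v sgraph"
  assumes tree: "is_tree T"
begin

abbreviation V where "V \<equiv> verts T"
abbreviation d where "d \<equiv> gdist T"

lemma adjD: "adj T x y \<Longrightarrow> x \<in> V" "adj T x y \<Longrightarrow> y \<in> V" "adj T x y \<Longrightarrow> x \<noteq> y"
    "adj T x y \<Longrightarrow> adj T y x"
  using tree by (auto simp: is_tree_def simple_graph_def)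

lemma walk_rev: "walk T p \<Longrightarrow> walk T (rev p)"
  unfolding walk_def using adjD(4) by (auto intro: successively_mono)

lemma no_cycle:
  assumes "walk T p" "distinct p" "length p \<ge> 3" "adj T (last p) (hd p)"
  shows False
  using tree assms by (auto simp: is_tree_def acyclic_graph_def)

text \<open>Where the two paths part at \<open>x\<close>, the rest of one followed by the reversed
  rest of the other avoids \<open>x\<close>; its loop erasure closes up with \<open>x\<close> to a
  cycle.\<close>

lemma simple_path_unique:
  assumes "walk T p" "distinct p" "walk T q" "distinct q" "hd p = hd q" "last p = last q"
  shows "p = q"
  using assms
proof (induction p arbitrary: q)
  case Nil
  then show ?case by (simp add: walk_def)
next
  case (Cons x p)
  from Cons.prems(3,5) obtain q' where q: "q = x # q'"
    by (metis hd_Cons_tl list.sel(1) walk_def)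
  show ?case
  proof (cases "p = [] \<or> q' = []")
    case True
    with Cons.prems show ?thesis unfolding q
      by (auto split: if_splits)
  next
    case False
    note ne = this
    from Cons.prems ne have wp: "walk T p" "distinct p" "adj T x (hd p)" "x \<notin> set p"
      and wq: "walk T q'" "distinct q'" "adj T x (hd q')" "x \<notin> set q'"
      and l: "last p = last q'" unfolding q by (auto simp: walk_Cons)
    show ?thesis
    proof (cases "hd p = hd q'")
      case True
      then show ?thesis using Cons.IH[OF wp(1,2) wq(1,2) _ l] q by simp
    next
      case False
      \<comment> \<open>\<open>tl\<close> drops the common end point, which would otherwise occur
        twice in a row.\<close>
      define r where "r = p @ tl (rev q')"
      have wr: "walk T (rev q')" using wq(1) by (rule walk_rev)
      have "walk T r \<and> hd r = hd p \<and> last r = hd q'"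
      proof (cases "tl (rev q') = []")
        case True
        then have "length (rev q') = 1" using ne
          by (metis One_nat_def length_0_conv length_Suc_conv list.collapse rev_is_Nil_conv)
        then have "last q' = hd q'" by (cases q') auto
        then show ?thesis using True wp l ne by (simp add: r_def)
      next
        case F: False
        then obtain z zs where z: "rev q' = z # zs" "zs \<noteq> []" by (cases "rev q'") auto
        have "z = last q'" using z ne by (metis hd_rev list.sel(1))
        have "last zs = hd q'" using z by (metis last_ConsR last_rev)
        moreover have "walk T (p @ zs)" using wr z(2) l wp(1) ne \<open>z = last q'\<close>
          unfolding z(1) by (simp add: walk_append walk_Cons)
        ultimately show ?thesis using z(2) ne unfolding r_def z(1) by simp
      qed
      then have r: "walk T r" "hd r = hd p" "last r = hd q'" by auto
      have "set (tl (rev q')) \<subseteq> set q'" by (cases "rev q'") (auto simp flip: set_rev[of q'])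
      then have sr: "x \<notin> set r" using wp wq unfolding r_def by auto
      from walk_to_distinct[OF r(1)] obtain t where
        t: "walk T t" "distinct t" "hd t = hd p" "last t = hd q'" "set t \<subseteq> set r"
        using r by auto
      have tne: "t \<noteq> []" using t(1) by (auto simp: walk_def)
      have "length t \<noteq> 1" using t(3,4) False by (auto simp: length_Suc_conv)
      with tne have "length t \<ge> 2" by (cases t) (auto simp: Suc_le_eq)
      moreover have "walk T (x # t)" using t wp tne adjD(1) by (auto simp: walk_Cons)
      moreover have "distinct (x # t)" using t sr by auto
      ultimately have False using no_cycle[of "x # t"] t(4) wq(3) tne adjD(4) by auto
      then show ?thesis ..
    qed
  qed
qed

lemma dist_le_walk: "walk T p \<Longrightarrow> d (hd p) (last p) \<le> length p - 1"
  unfolding gdist_def by (rule Least_le) (auto simp: walk_def intro!: exI[of _ p])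

lemma dist_walk:
  assumes "x \<in> V" "y \<in> V"
  shows "\<exists>p. walk T p \<and> hd p = x \<and> last p = y \<and> length p = Suc (d x y)"
proof -
  obtain p where p: "walk T p" "hd p = x" "last p = y"
    using tree assms unfolding is_tree_def connected_graph_def by blast
  then have "walk T p \<and> hd p = x \<and> last p = y \<and> length p = Suc (length p - 1)"
    by (auto simp: walk_def)
  then have "\<exists>n. \<exists>p. walk T p \<and> hd p = x \<and> last p = y \<and> length p = Suc n" by blast
  then show ?thesis unfolding gdist_def by (rule LeastI_ex)
qed

lemma geodesic_distinct:
  assumes "geodesic T p"
  shows "distinct p"
proof -
  have w: "walk T p" and l: "length p = Suc (d (hd p) (last p))"
    using assms by (auto simp: geodesic_def)
  obtain q where q: "walk T q" "distinct q" "hd q = hd p" "last q = last p" "set q \<subseteq> set p"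
    using walk_to_distinct[OF w] by blast
  have "length p \<le> length q"
    using dist_le_walk[OF q(1)] l q by (cases q) (auto simp: walk_def)
  also have "\<dots> = card (set q)" using q(2) by (simp add: distinct_card)
  also have "\<dots> \<le> card (set p)" using q(5) by (simp add: card_mono)
  finally show ?thesis by (metis card_distinct card_length le_antisym)
qed

lemma geodesic_unique:
  "geodesic T p \<Longrightarrow> geodesic T q \<Longrightarrow> hd p = hd q \<Longrightarrow> last p = last q \<Longrightarrow> p = q"
  by (intro simple_path_unique geodesic_distinct) (auto simp: geodesic_def)

lemma ex_geodesic: "x \<in> V \<Longrightarrow> y \<in> V \<Longrightarrow> \<exists>p. geodesic T p \<and> hd p = x \<and> last p = y"
  using dist_walk[of x y] by (auto simp: geodesic_def)

lemma simple_path_geodesic: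
  assumes "walk T p" "distinct p"
  shows "geodesic T p"
proof -
  have "hd p \<in> V" "last p \<in> V" using assms(1) by (auto simp: walk_def)
  then obtain q where "geodesic T q" "hd q = hd p" "last q = last p" using ex_geodesic by blast
  moreover from this have "p = q"
    using geodesic_distinct[of q] by (intro simple_path_unique[OF assms]) (auto simp: geodesic_def)
  ultimately show ?thesis by simp
qed

lemma geod_props:
  assumes "x \<in> V" "y \<in> V"
  shows "geodesic T (geod T x y)" "hd (geod T x y) = x" "last (geod T x y) = y"
    "length (geod T x y) = Suc (d x y)" "walk T (geod T x y)" "set (geod T x y) \<subseteq> V"
proof -
  obtain p where p: "geodesic T p \<and> hd p = x \<and> last p = y" using ex_geodesic[OF assms] by blast
  then have *: "geodesic T (geod T x y) \<and> hd (geod T x y) = x \<and> last (geod T x y) = y"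
    unfolding geod_def by (rule theI) (use p geodesic_unique in auto)
  then show "geodesic T (geod T x y)" "hd (geod T x y) = x" "last (geod T x y) = y" by auto
  then show "length (geod T x y) = Suc (d x y)" "walk T (geod T x y)" by (auto simp: geodesic_def)
  then show "set (geod T x y) \<subseteq> V" by (simp add: walk_def)
qed

lemma geod_eq: "geodesic T s \<Longrightarrow> geod T (hd s) (last s) = s"
  by (intro geodesic_unique geod_props) (auto simp: geodesic_def walk_def)

lemma dist_self [simp]: "x \<in> V \<Longrightarrow> d x x = 0"
  using dist_le_walk[of "[x]"] by (simp add: walk_Cons)

lemma dist_eq_0: "x \<in> V \<Longrightarrow> y \<in> V \<Longrightarrow> d x y = 0 \<longleftrightarrow> x = y"
  using dist_walk[of x y] by (auto simp: length_Suc_conv)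

lemma dist_sym_le: assumes "x \<in> V" "y \<in> V" shows "d y x \<le> d x y"
proof -
  obtain p where p: "walk T p" "hd p = x" "last p = y" "length p = Suc (d x y)"
    using dist_walk[OF assms] by blast
  have "p \<noteq> []" using p(1) by (auto simp: walk_def)
  then show ?thesis using dist_le_walk[OF walk_rev[OF p(1)]] p by (simp add: hd_rev last_rev)
qed

lemma dist_sym: "x \<in> V \<Longrightarrow> y \<in> V \<Longrightarrow> d x y = d y x"
  by (simp add: dist_sym_le le_antisym)

lemma dist_triangle:
  assumes "x \<in> V" "y \<in> V" "z \<in> V" shows "d x z \<le> d x y + d y z"
proof -
  obtain p where p: "walk T p" "hd p = x" "last p = y" "length p = Suc (d x y)"
    using dist_walk[OF assms(1,2)] by blast
  obtain q where q: "walk T q" "hd q = y" "last q = z" "length q = Suc (d y z)"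
    using dist_walk[OF assms(2,3)] by blast
  have ne: "p \<noteq> []" "q \<noteq> []" using p q by (auto simp: walk_def)
  show ?thesis
  proof (cases "tl q = []")
    case True
    then have "q = [y]" using q ne by (cases q) auto
    then show ?thesis using q by auto
  next
    case False
    then obtain r where r: "q = y # r" "r \<noteq> []" using q ne by (cases q) auto
    have "walk T (p @ r)" using p q r ne by (auto simp: walk_append walk_Cons)
    from dist_le_walk[OF this] show ?thesis using p q r ne by auto
  qed
qed

lemma dist_adj: assumes "adj T x y" shows "d x y = 1"
proof -
  have "d x y \<le> 1" using dist_le_walk[of "[x,y]"] assms adjD by (auto simp: walk_Cons)
  moreover have "d x y \<noteq> 0" using dist_eq_0 adjD assms by blast
  ultimately show ?thesis by simp
qed

lemma dist_1_adj: "x \<in> V \<Longrightarrow> y \<in> V \<Longrightarrow> d x y = 1 \<Longrightarrow> adj T x y"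
  using dist_walk[of x y] by (auto simp: length_Suc_conv walk_Cons)

text \<open>A vertex of the geodesic from \<open>x\<close> to \<open>z\<close> other than
  \<open>z\<close> is strictly nearer to \<open>x\<close> than \<open>z\<close> is, so
  \<open>y\<close> cannot lie on it. Equal distances are thereby excluded, which makes the tree
  bipartite.\<close>

lemma neighbour_snoc:
  assumes "x \<in> V" "adj T y z" "d x z \<le> d x y"
  shows "geodesic T (geod T x z @ [y])"
proof (rule simple_path_geodesic)
  have V: "y \<in> V" "z \<in> V" using assms adjD by auto
  note g = geod_props[OF assms(1) V(2)]
  have ne: "geod T x z \<noteq> []" using g(4) by auto
  show "walk T (geod T x z @ [y])"
    using g ne assms adjD by (simp add: walk_append walk_Cons)
  have "y \<notin> set (geod T x z)"
  proof
    assume "y \<in> set (geod T x z)"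
    then obtain a b where s: "geod T x z = a @ y # b" by (meson split_list)
    have "b \<noteq> []" using g(3) adjD(3)[OF assms(2)] unfolding s by auto
    then have l: "length (a @ [y]) < Suc (d x z)" using g(4) unfolding s
      by (cases b) auto
    have "walk T (a @ [y])" using g(5) unfolding s
      by (auto simp: walk_def successively_append_iff)
    from dist_le_walk[OF this] l have "d (hd (a @ [y])) y < d x z" by simp
    moreover have "hd (a @ [y]) = x" using g(2) unfolding s by (cases a) auto
    ultimately show False using assms(3) by simp
  qed
  then show "distinct (geod T x z @ [y])" using geodesic_distinct[OF g(1)] by auto
qed

lemma dist_neighbour:
  assumes "x \<in> V" "adj T y z"
  shows "d x z = Suc (d x y) \<or> d x y = Suc (d x z)"
proof -
  have *: "d x y = Suc (d x z)" if "adj T y z" "d x z \<le> d x y" for y z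
  proof -
    have V: "z \<in> V" using that adjD by auto
    note g = geod_props[OF assms(1) V]
    have "geod T x z \<noteq> []" using g(4) by auto
    then show ?thesis using neighbour_snoc[OF assms(1) that] g
      by (auto simp: geodesic_def)
  qed
  show ?thesis using *[of y z] *[of z y] assms adjD(4) by (cases "d x z \<le> d x y") auto
qed

text \<open>By \<open>neighbour_snoc\<close> both candidates are the last but one vertex of the
  geodesic from \<open>x\<close> to \<open>y\<close>. The inductions along paths below end in this
  uniqueness.\<close>

lemma closer_neighbour_unique:
  assumes "x \<in> V" "adj T y z" "adj T y z'" "d x z \<le> d x y" "d x z' \<le> d x y"
  shows "z = z'"
proof -
  have V: "z \<in> V" "z' \<in> V" using assms adjD by auto
  note g = geod_props[OF assms(1) V(1)] geod_props[OF assms(1) V(2)]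
  have ne: "geod T x z \<noteq> []" "geod T x z' \<noteq> []" using g by auto
  have "geod T x z @ [y] = geod T x z' @ [y]"
    by (rule geodesic_unique) (use assms g ne neighbour_snoc in auto)
  then have "geod T x z = geod T x z'" by simp
  then show ?thesis using g(3,9) by metis
qed

text \<open>Betweenness is phrased by distances and not through \<open>geod\<close>, so that its
  invariance under isometries is immediate and its transitivity is linear arithmetic.\<close>

definition btw :: "'v \<Rightarrow> 'v \<Rightarrow> 'v \<Rightarrow> bool" where
  "btw x y z \<longleftrightarrow> d x y + d y z = d x z"

lemma btw_sym: "x \<in> V \<Longrightarrow> y \<in> V \<Longrightarrow> z \<in> V \<Longrightarrow> btw x y z \<Longrightarrow> btw z y x"
  by (simp add: btw_def dist_sym)

definition pt :: "'v \<Rightarrow> 'v \<Rightarrow> nat \<Rightarrow> 'v" where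
  "pt x y i = geod T x y ! i"

lemma pt_dist:
  assumes "x \<in> V" "y \<in> V" "i \<le> d x y"
  shows "pt x y i \<in> V" "d x (pt x y i) = i" "d (pt x y i) y = d x y - i"
proof -
  note g = geod_props[OF assms(1,2)]
  let ?s = "geod T x y"
  have i: "i < length ?s" using g assms by simp
  have e: "take (Suc i) ?s @ drop (Suc i) ?s = ?s" "take i ?s @ drop i ?s = ?s" by auto
  have sne: "?s \<noteq> []" using i by auto
  show V: "pt x y i \<in> V" using i g(6) unfolding pt_def by (meson nth_mem subsetD)
  have w1: "walk T (take (Suc i) ?s)"
    using g(5) e(1) i unfolding walk_def
    by (metis set_take_subset subset_trans successively_append_iff take_eq_Nil nat.distinct(1))
  have w2: "walk T (drop i ?s)"
    using g(5) e(2) i unfolding walk_def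
    by (metis set_drop_subset subset_trans successively_append_iff drop_eq_Nil not_le)
  have "hd (take (Suc i) ?s) = x" using g sne by (simp add: hd_take)
  moreover have "last (take (Suc i) ?s) = pt x y i"
    using i by (simp add: pt_def take_Suc_conv_app_nth)
  ultimately have 1: "d x (pt x y i) \<le> i" using dist_le_walk[OF w1] i by simp
  have "hd (drop i ?s) = pt x y i" using i by (simp add: pt_def hd_drop_conv_nth)
  moreover have "last (drop i ?s) = y" using i g by simp
  ultimately have 2: "d (pt x y i) y \<le> d x y - i" using dist_le_walk[OF w2] i g by simp
  show "d x (pt x y i) = i" "d (pt x y i) y = d x y - i"
    using 1 2 dist_triangle[OF assms(1) V assms(2)] assms(3) by auto
qed

lemma pt_unique:
  assumes "x \<in> V" "y \<in> V" "z \<in> V" "btw x z y"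
  shows "pt x y (d x z) = z"
proof -
  note g = geod_props[OF assms(1,3)] and h = geod_props[OF assms(3,2)]
  have ne: "geod T x z \<noteq> []" "geod T z y \<noteq> []" using g h by auto
  let ?p = "geod T x z @ tl (geod T z y)"
  have p: "walk T ?p \<and> last ?p = y"
  proof (cases "tl (geod T z y) = []")
    case True
    then show ?thesis using g h ne by (metis append_Nil2 last_ConsL list.collapse)
  next
    case False
    then obtain r where "geod T z y = z # r" "r \<noteq> []" using h ne
      by (metis list.collapse)
    then show ?thesis using g h ne by (auto simp: walk_append walk_Cons)
  qed
  moreover have "length ?p = Suc (d x y)" using g h assms(4) by (simp add: btw_def)
  moreover have "hd ?p = x" using g ne by simp
  ultimately have "geodesic T ?p" by (simp add: geodesic_def)
  then have "geod T x y = ?p" using geod_eq[of ?p] p \<open>hd ?p = x\<close> by simp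
  then show ?thesis unfolding pt_def using g ne
    by (simp add: nth_append) (metis diff_Suc_1 last_conv_nth)
qed

lemma pt_eqI:
  "x \<in> V \<Longrightarrow> y \<in> V \<Longrightarrow> z \<in> V \<Longrightarrow> d x z = i \<Longrightarrow> i + d z y = d x y \<Longrightarrow> pt x y i = z"
  using pt_unique[of x y z] by (auto simp: btw_def)

lemma pt_0 [simp]: "x \<in> V \<Longrightarrow> y \<in> V \<Longrightarrow> pt x y 0 = x"
  by (rule pt_eqI) auto

lemma pt_end: "x \<in> V \<Longrightarrow> y \<in> V \<Longrightarrow> pt x y (d x y) = y"
  by (rule pt_eqI) auto

lemma btw_trans:
  assumes "x \<in> V" "y \<in> V" "z \<in> V" "w \<in> V" "btw x y w" "btw y z w"
  shows "btw x z w" "btw x y z"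
  using assms(5,6) dist_triangle[of x y z] dist_triangle[of x z w] assms(1-4)
  unfolding btw_def by auto

lemma btw_trans2:
  assumes "x \<in> V" "y \<in> V" "z \<in> V" "w \<in> V" "btw x z w" "btw x y z"
  shows "btw x y w" "btw y z w"
  using assms(5,6) dist_triangle[of x y w] dist_triangle[of y z w] assms(1-4)
  unfolding btw_def by auto

lemma pt_rev:
  assumes "x \<in> V" "y \<in> V" "i \<le> d x y"
  shows "pt y x (d x y - i) = pt x y i"
  by (rule pt_eqI) (use assms pt_dist[OF assms] dist_sym in auto)

lemma pt_pt_dist:
  assumes "x \<in> V" "y \<in> V" "i \<le> j" "j \<le> d x y"
  shows "d (pt x y i) (pt x y j) = j - i" "btw x (pt x y i) (pt x y j)"
    "btw (pt x y i) (pt x y j) y"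
proof -
  have ij: "i \<le> d x y" using assms by simp
  note a = pt_dist[OF assms(1,2) ij] and b = pt_dist[OF assms(1,2,4)]
  let ?z = "pt x (pt x y j) i"
  have i: "i \<le> d x (pt x y j)" using b assms by simp
  note c = pt_dist[OF assms(1) b(1) i]
  have "?z = pt x y i"
    by (rule pt_eqI[symmetric])
      (use assms b c dist_triangle[OF c(1) b(1) assms(2)] dist_triangle[OF assms(1) c(1) assms(2)] in auto)
  then show "d (pt x y i) (pt x y j) = j - i" using c b by simp
  then show "btw x (pt x y i) (pt x y j)" "btw (pt x y i) (pt x y j) y"
    using a b assms by (auto simp: btw_def)
qed

lemma pt_adj: "x \<in> V \<Longrightarrow> y \<in> V \<Longrightarrow> i < d x y \<Longrightarrow> adj T (pt x y i) (pt x y (Suc i))"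
  using pt_pt_dist(1)[of x y i "Suc i"] pt_dist(1)[of x y] by (intro dist_1_adj) auto

lemma pt_pt:
  assumes "x \<in> V" "y \<in> V" "a \<le> b" "b \<le> d x y" "i \<le> b - a"
  shows "pt (pt x y a) (pt x y b) i = pt x y (a + i)"
  by (rule pt_eqI)
    (use assms pt_dist(1)[of x y] pt_pt_dist(1)[of x y a "a+i"] pt_pt_dist(1)[of x y "a+i" b]
      pt_pt_dist(1)[of x y a b] in auto)

lemma btw_pt:
  assumes "x \<in> V" "y \<in> V" "z \<in> V" "btw x y z" "i \<le> d x y"
  shows "pt x z i = pt x y i"
proof -
  note a = pt_dist[OF assms(1,2,5)]
  show ?thesis
    by (rule pt_eqI) (use assms a dist_triangle[OF a(1) assms(2,3)] dist_triangle[OF assms(1) a(1) assms(3)]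
        in \<open>auto simp: btw_def\<close>)
qed

lemma btw_pt2:
  assumes "x \<in> V" "y \<in> V" "z \<in> V" "btw x y z" "i \<le> d y z"
  shows "pt x z (d x y + i) = pt y z i"
proof -
  note a = pt_dist[OF assms(2,3,5)]
  show ?thesis
    by (rule pt_eqI) (use assms a dist_triangle[OF assms(1,2) a(1)] dist_triangle[OF assms(1) a(1) assms(3)]
        in \<open>auto simp: btw_def\<close>)
qed

text \<open>Local geodesics in a tree are geodesics: two of them that overlap in a nondegenerate
  segment glue. The overlap from \<open>y\<close> to \<open>z\<close> rules out turning back at
  \<open>z\<close>. The induction walks from \<open>z\<close> to \<open>w\<close>.\<close>

lemma btw_concat:
  assumes "x \<in> V" "y \<in> V" "z \<in> V" "w \<in> V" "y \<noteq> z" "btw x y z" "btw y z w"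
  shows "btw x z w" "btw x y w"
proof -
  have "d z w = k \<Longrightarrow> w \<in> V \<Longrightarrow> btw y z w \<Longrightarrow> d x w = d x z + k" for k w
  proof (induction k arbitrary: w)
    case 0
    then show ?case using assms dist_eq_0 by auto
  next
    case (Suc k)
    let ?w = "pt z w k"
    note a = pt_dist[OF assms(3) Suc.prems(2), of k]
    have wV: "?w \<in> V" and dz: "d z ?w = k" and dw: "d ?w w = 1" using a Suc.prems by auto
    have ad: "adj T ?w w" using dist_1_adj wV Suc.prems dw by blast
    have yw: "d y ?w = d y z + k"
      using Suc.prems(3,1) dz dw dist_triangle[OF assms(2,3) wV] dist_triangle[OF assms(2) wV Suc.prems(2)]
      unfolding btw_def by auto
    have IH: "d x ?w = d x z + k"
      by (rule Suc.IH[OF dz wV]) (simp add: btw_def yw dz)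
    have yz: "d y z > 0" using assms(2,3,5) dist_eq_0 by fastforce
    \<comment> \<open>\<open>?u\<close> is the neighbour of \<open>?w\<close> towards
      \<open>y\<close> and not farther from \<open>x\<close>. If \<open>w\<close> were not farther
      either, the two would coincide, but \<open>w\<close> lies beyond \<open>?w\<close> as seen
      from \<open>y\<close>.\<close>
    let ?u = "pt y ?w (d y ?w - 1)"
    have u: "?u \<in> V" "d y ?u = d y ?w - 1" "d ?u ?w = 1"
      using pt_dist[OF assms(2) wV, of "d y ?w - 1"] yz yw by auto
    have au: "adj T ?w ?u" using dist_1_adj u wV adjD(4) by blast
    have xu: "d x ?u \<le> d x ?w"
      using dist_triangle[OF assms(1,2) u(1)] u(2) IH yw assms(6) unfolding btw_def by auto
    show ?case
    proof (rule ccontr)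
      assume "d x w \<noteq> d x z + Suc k"
      then have "d x w \<le> d x ?w" using dist_neighbour[OF assms(1) ad] IH by auto
      then have "w = ?u" using closer_neighbour_unique[OF assms(1) ad au _ xu] by simp
      then show False using Suc.prems u yw by (auto simp: btw_def)
    qed
  qed
  then have *: "d x w = d x z + d z w" using assms by auto
  then show "btw x z w" by (simp add: btw_def)
  show "btw x y w" using * assms(6,7) by (simp add: btw_def)
qed

text \<open>\<open>m\<close> is the last vertex of the geodesic from \<open>x\<close> to
  \<open>y\<close> that still lies on the one from \<open>x\<close> to \<open>z\<close>. The next
  vertex is farther from \<open>z\<close> by maximality, so the geodesics from \<open>z\<close> and
  to \<open>y\<close> glue along the edge after \<open>m\<close>.\<close>

lemma median:
  assumes "x \<in> V" "y \<in> V" "z \<in> V"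
  obtains m where "m \<in> V" "btw x m y" "btw y m z" "btw x m z"
proof -
  define A where "A = {i. i \<le> d x y \<and> btw x (pt x y i) z}"
  have f: "finite A" "0 \<in> A" unfolding A_def using assms by (auto simp: btw_def)
  define i where "i = Max A"
  have iA: "i \<in> A" using f unfolding i_def by (intro Max_in) auto
  have max: "j \<le> i" if "j \<in> A" for j using that f unfolding i_def by auto
  define m where "m = pt x y i"
  have i: "i \<le> d x y" and bz: "btw x m z" using iA unfolding A_def m_def by auto
  note m = pt_dist[OF assms(1,2) i, folded m_def]
  have by': "btw x m y" using m i by (simp add: btw_def)
  have "btw z m y"
  proof (cases "i = d x y")
    case True
    then have "m = y" using pt_end assms m_def by auto
    then show ?thesis using assms m by (auto simp: btw_def)
  next
    case False
    then have i': "Suc i \<le> d x y" using i by simp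
    define m' where "m' = pt x y (Suc i)"
    note m' = pt_dist[OF assms(1,2) i', folded m'_def]
    have ad: "adj T m m'" using pt_adj[OF assms(1,2)] i' unfolding m_def m'_def by simp
    have far: "d z m' = Suc (d z m)"
    proof (rule ccontr)
      assume "d z m' \<noteq> Suc (d z m)"
      then have "d z m = Suc (d z m')" using dist_neighbour[OF assms(3) ad] by auto
      then have "btw x m' z"
        using bz m m' dist_sym assms unfolding btw_def by auto
      then have "Suc i \<in> A" unfolding A_def m'_def using i' by auto
      then show False using max by force
    qed
    have zmm: "btw z m m'" using far dist_adj[OF ad] by (simp add: btw_def)
    have mmy: "btw m m' y" using m m' i' dist_adj[OF ad] by (auto simp: btw_def)
    show ?thesis
      using btw_concat(2)[OF assms(3) m(1) m'(1) assms(2) adjD(3)[OF ad] zmm mmy] .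
  qed
  then have "btw y m z" using btw_sym assms m by blast
  then show ?thesis using that[OF m(1) by'] bz by blast
qed

lemma dist_parity:
  assumes "x \<in> V" "y \<in> V" "z \<in> V"
  shows "even (d x y + d y z + d x z)"
proof -
  obtain m where m: "m \<in> V" "btw x m y" "btw y m z" "btw x m z" using median[OF assms] by blast
  have "d x y + d y z + d x z = 2 * (d x m + d m y + d m z)"
    using m assms dist_sym[of m y] unfolding btw_def by auto
  then show ?thesis by simp
qed

text \<open>The only neighbour that is not farther from the start is the previous vertex, by
  \<open>closer_neighbour_unique\<close>.\<close>

lemma no_backtrack_geodesic:
  assumes adj: "\<And>i. adj T (r i) (r (Suc i))" and nb: "\<And>i. r (Suc (Suc i)) \<noteq> r i"
  shows "d (r i) (r (i + k)) = k"
proof (induction k)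
  case 0
  then show ?case using adjD(1)[OF adj[of i]] by simp
next
  case (Suc k)
  have V: "r i \<in> V" for i using adj adjD(1) by blast
  show ?case
  proof (cases k)
    case 0
    then show ?thesis using dist_adj[OF adj[of i]] by simp
  next
    case (Suc l)
    have a: "adj T (r (i + k)) (r (i + l))" using adjD(4)[OF adj[of "i + l"]] Suc by simp
    have le: "d (r i) (r (i + j)) \<le> j" for j
    proof (induction j)
      case 0
      then show ?case using V by simp
    next
      case (Suc j)
      then show ?case
        using dist_triangle[OF V[of i] V[of "i+j"] V[of "i + Suc j"]] dist_adj[OF adj[of "i+j"]]
        by simp
    qed
    have lt: "d (r i) (r (i + l)) \<le> d (r i) (r (i + k))"
      using le[of l] Suc.IH Suc by simp
    show ?thesis
    proof (rule ccontr)
      assume "d (r i) (r (i + Suc k)) \<noteq> Suc k"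
      then have "d (r i) (r (Suc (i + k))) \<le> d (r i) (r (i + k))"
        using dist_neighbour[OF V adj[of "i+k"], of i] Suc.IH by auto
      from closer_neighbour_unique[OF V adj[of "i+k"] a this lt] show False
        using nb[of "i + l"] Suc by simp
    qed
  qed
qed

text \<open>For \<open>x = y\<close> the list index is out of range, whence the side condition
  \<open>x \<noteq> y\<close> in its lemmas.\<close>

definition nxt :: "'v \<Rightarrow> 'v \<Rightarrow> 'v" where
  "nxt x y = pt x y 1"

lemma nxt_props:
  assumes "x \<in> V" "y \<in> V" "x \<noteq> y"
  shows "adj T x (nxt x y)" "nxt x y \<in> V" "d x y = Suc (d (nxt x y) y)"
proof -
  have "0 < d x y" using dist_eq_0[OF assms(1,2)] assms(3) by simp
  then show "adj T x (nxt x y)" "nxt x y \<in> V" "d x y = Suc (d (nxt x y) y)"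
    using pt_adj[OF assms(1,2), of 0] pt_dist[OF assms(1,2), of 1] pt_0[OF assms(1,2)]
    by (simp_all add: nxt_def)
qed

lemma nxt_eqI:
  assumes "y \<in> V" "adj T x z" "d x y = Suc (d z y)"
  shows "nxt x y = z"
  unfolding nxt_def using assms adjD(1,2)[OF assms(2)] dist_adj[OF assms(2)] by (intro pt_eqI) auto

lemma nxt_btw:
  assumes "x \<in> V" "y \<in> V" "z \<in> V" "x \<noteq> y" "btw x y z"
  shows "nxt x z = nxt x y"
  unfolding nxt_def by (rule btw_pt) (use assms dist_eq_0[of x y] in auto)

end

section \<open>Groups acting on trees\<close>

locale tree_action = tree_graph T + group G
  for T :: "'v sgraph" and G :: "('g, 'm) monoid_scheme" (structure) +
  fixes \<rho> :: "'g \<Rightarrow> 'v \<Rightarrow> 'v"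
  assumes action_hom: "\<rho> \<in> hom G (Aut_tree T)"
begin

lemma act_Bij: "g \<in> carrier G \<Longrightarrow> \<rho> g \<in> Bij V"
  using action_hom by (auto simp: hom_def Aut_tree_def)

lemma act_closed [simp]: "g \<in> carrier G \<Longrightarrow> x \<in> V \<Longrightarrow> \<rho> g x \<in> V"
  using act_Bij by (auto simp: Bij_def bij_betw_def)

lemma act_mult:
  assumes "g \<in> carrier G" "h \<in> carrier G" "x \<in> V"
  shows "\<rho> (g \<otimes> h) x = \<rho> g (\<rho> h x)"
proof -
  have "\<rho> (g \<otimes> h) = \<rho> g \<otimes>\<^bsub>Aut_tree T\<^esub> \<rho> h"
    using action_hom assms by (auto simp: hom_def)
  then show ?thesis using assms act_Bij by (simp add: Aut_tree_def BijGroup_def compose_def)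
qed

lemma act_inj:
  "g \<in> carrier G \<Longrightarrow> x \<in> V \<Longrightarrow> y \<in> V \<Longrightarrow> \<rho> g x = \<rho> g y \<longleftrightarrow> x = y"
  using act_Bij[of g] by (auto simp: Bij_def bij_betw_def inj_on_def)

lemma act_one [simp]:
  assumes "x \<in> V" shows "\<rho> \<one> x = x"
proof -
  have "\<rho> \<one> (\<rho> \<one> x) = \<rho> \<one> x" using act_mult[of \<one> \<one> x] assms by simp
  then show ?thesis using act_inj[of \<one> "\<rho> \<one> x" x] assms by simp
qed

lemma act_inv [simp]:
  assumes "g \<in> carrier G" "x \<in> V"
  shows "\<rho> (inv g) (\<rho> g x) = x" "\<rho> g (\<rho> (inv g) x) = x"
  using act_mult[of "inv g" g x] act_mult[of g "inv g" x] assms by simp_all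

lemma act_adj:
  assumes "g \<in> carrier G" "x \<in> V" "y \<in> V"
  shows "adj T (\<rho> g x) (\<rho> g y) \<longleftrightarrow> adj T x y"
proof -
  have "\<rho> g \<in> carrier (Aut_tree T)" using action_hom assms by (auto simp: hom_def)
  then show ?thesis using assms by (simp add: Aut_tree_def)
qed

lemma act_walk:
  assumes "g \<in> carrier G" "walk T p" shows "walk T (map (\<rho> g) p)"
  using assms(2)
proof (induction p)
  case (Cons x p)
  then have "p \<noteq> [] \<Longrightarrow> hd p \<in> V" by (auto simp: walk_Cons walk_def)
  then show ?case using Cons assms(1) act_adj[OF assms(1), of x "hd p"]
    by (auto simp: walk_Cons hd_map)
qed (simp add: walk_def)

lemma act_dist_le:
  assumes "g \<in> carrier G" "x \<in> V" "y \<in> V"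
  shows "d (\<rho> g x) (\<rho> g y) \<le> d x y"
proof -
  obtain p where p: "walk T p" "hd p = x" "last p = y" "length p = Suc (d x y)"
    using dist_walk assms by blast
  have "p \<noteq> []" using p(1) by (auto simp: walk_def)
  then show ?thesis using dist_le_walk[OF act_walk[OF assms(1) p(1)]] p
    by (simp add: hd_map last_map)
qed

lemma act_dist [simp]:
  assumes "g \<in> carrier G" "x \<in> V" "y \<in> V"
  shows "d (\<rho> g x) (\<rho> g y) = d x y"
  using act_dist_le[OF assms] act_dist_le[of "inv g" "\<rho> g x" "\<rho> g y"] assms by simp

lemma act_btw:
  "g \<in> carrier G \<Longrightarrow> x \<in> V \<Longrightarrow> y \<in> V \<Longrightarrow> z \<in> V \<Longrightarrow>
    btw (\<rho> g x) (\<rho> g y) (\<rho> g z) \<longleftrightarrow> btw x y z"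
  by (simp add: btw_def)

lemma act_pt:
  assumes "g \<in> carrier G" "x \<in> V" "y \<in> V" "i \<le> d x y"
  shows "pt (\<rho> g x) (\<rho> g y) i = \<rho> g (pt x y i)"
  using assms pt_dist[OF assms(2,3,4)] by (intro pt_eqI) auto

lemma act_nxt:
  assumes "g \<in> carrier G" "x \<in> V" "y \<in> V" "x \<noteq> y"
  shows "nxt (\<rho> g x) (\<rho> g y) = \<rho> g (nxt x y)"
  using assms dist_eq_0[of x y] unfolding nxt_def by (intro act_pt) auto

lemma act_geodesic:
  "g \<in> carrier G \<Longrightarrow> geodesic T s \<Longrightarrow> geodesic T (map (\<rho> g) s)"
  unfolding geodesic_def using act_walk by (auto simp: walk_def hd_map last_map subset_iff)

section \<open>Rays and ends\<close>

lemma ray_equiv_sym: "(r, r') \<in> ray_equiv T \<Longrightarrow> (r', r) \<in> ray_equiv T"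
  unfolding ray_equiv_def by (auto, metis)

lemma ray_equiv_trans:
  assumes "(r, r') \<in> ray_equiv T" "(r', r'') \<in> ray_equiv T"
  shows "(r, r'') \<in> ray_equiv T"
proof -
  from assms obtain m n m' n' where
    *: "\<And>i. r (m + i) = r' (n + i)" "\<And>i. r' (m' + i) = r'' (n' + i)"
    unfolding ray_equiv_def by auto
  have "r (m + m' + i) = r'' (n' + n + i)" for i
    using *(1)[of "m' + i"] *(2)[of "n + i"] by (simp add: algebra_simps)
  then show ?thesis using assms unfolding ray_equiv_def by auto
qed

lemma act_ray: "g \<in> carrier G \<Longrightarrow> r \<in> rays T \<Longrightarrow> \<rho> g \<circ> r \<in> rays T"
  unfolding rays_def by (auto simp: image_subset_iff)

lemma act_ray_equiv:
  "g \<in> carrier G \<Longrightarrow> (r, r') \<in> ray_equiv T \<Longrightarrow> (\<rho> g \<circ> r, \<rho> g \<circ> r') \<in> ray_equiv T"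
  using act_ray unfolding ray_equiv_def by (auto, metis)

abbreviation fixes_end :: bool where
  "fixes_end \<equiv> \<exists>a\<in>tree_boundary T. fixes_boundary_point G \<rho> a"

text \<open>An end is the same thing as an orientation of all edges in which every vertex has exactly
  one outgoing edge.\<close>

lemma fixed_end_of_successor:
  assumes adj: "\<And>x. x \<in> V \<Longrightarrow> adj T x (n x)"
    and nb: "\<And>x. x \<in> V \<Longrightarrow> n (n x) \<noteq> x"
    and edge: "\<And>x y. adj T x y \<Longrightarrow> n x = y \<or> n y = x"
    and equiv: "\<And>g x. g \<in> carrier G \<Longrightarrow> x \<in> V \<Longrightarrow> n (\<rho> g x) = \<rho> g (n x)"
  shows fixes_end
proof -
  define r where "r x i = (n ^^ i) x" for x i
  have nV: "n x \<in> V" if "x \<in> V" for x using adj[OF that] adjD(2) by blast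
  have rV: "r x i \<in> V" if "x \<in> V" for x i
    unfolding r_def using that nV by (induction i) auto
  have r_ray: "r x \<in> rays T" if "x \<in> V" for x
  proof -
    have "d (r x i) (r x (i + k)) = k" for i k
      by (rule no_backtrack_geodesic) (use adj nb rV[OF that] in \<open>auto simp: r_def\<close>)
    then have "\<forall>i j. i \<le> j \<longrightarrow> d (r x i) (r x j) = j - i"
      by (metis le_add_diff_inverse)
    then show ?thesis using rV[OF that] unfolding rays_def by auto
  qed
  have step: "(r x, r (n x)) \<in> ray_equiv T" if "x \<in> V" for x
  proof -
    have "\<forall>i. r x (1 + i) = r (n x) (0 + i)" by (simp add: r_def funpow_swap1)
    then show ?thesis using r_ray that nV unfolding ray_equiv_def by blast
  qed
  have all: "(r x, r y) \<in> ray_equiv T" if "x \<in> V" "y \<in> V" for x y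
    using that
  proof (induction "d x y" arbitrary: x)
    case 0
    then have "x = y" using dist_eq_0 by auto
    then show ?case using r_ray[OF \<open>x \<in> V\<close>] unfolding ray_equiv_def by auto
  next
    case (Suc k)
    then have "x \<noteq> y" by auto
    note z = nxt_props[OF Suc.prems this]
    have "(r (nxt x y), r y) \<in> ray_equiv T" using Suc z by simp
    \<comment> \<open>Every edge is directed one way or the other, so the rays of neighbours agree
      up to a shift by one.\<close>
    moreover have "(r x, r (nxt x y)) \<in> ray_equiv T"
      using edge[OF z(1)] step[OF Suc.prems(1)] step[OF z(2)] ray_equiv_sym by metis
    ultimately show ?case using ray_equiv_trans by blast
  qed
  obtain v where v: "v \<in> V" using tree by (auto simp: is_tree_def)
  define a where "a = ray_equiv T `` {r v}"
  have "a \<in> tree_boundary T"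
    unfolding a_def tree_boundary_def by (rule quotientI) (rule r_ray[OF v])
  moreover have sub: "\<rho> g \<circ> s \<in> a" if "g \<in> carrier G" "s \<in> a" for g s
  proof -
    have "\<rho> g (r v i) = r (\<rho> g v) i" for i
      unfolding r_def using that(1) v
    proof (induction i)
      case (Suc i)
      then show ?case using equiv[OF that(1), of "(n ^^ i) v"] rV[OF v, of i] by (simp add: r_def)
    qed simp
    then have "\<rho> g \<circ> r v = r (\<rho> g v)" by auto
    then have "(r v, \<rho> g \<circ> r v) \<in> ray_equiv T" using all[OF v] v that by simp
    moreover have "(\<rho> g \<circ> r v, \<rho> g \<circ> s) \<in> ray_equiv T"
      using act_ray_equiv that unfolding a_def by auto
    ultimately show ?thesis unfolding a_def using ray_equiv_trans by blast
  qed
  have "(\<lambda>s. \<rho> g \<circ> s) ` a = a" if g: "g \<in> carrier G" for g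
  proof
    show "(\<lambda>s. \<rho> g \<circ> s) ` a \<subseteq> a" using sub g by auto
    show "a \<subseteq> (\<lambda>s. \<rho> g \<circ> s) ` a"
    proof
      fix s assume s: "s \<in> a"
      then have "range s \<subseteq> V" unfolding a_def ray_equiv_def rays_def by auto
      then have "s = \<rho> g \<circ> (\<rho> (inv g) \<circ> s)" using g by (auto simp: fun_eq_iff subset_iff)
      moreover have "\<rho> (inv g) \<circ> s \<in> a" using sub[of "inv g"] g s by simp
      ultimately show "s \<in> (\<lambda>s. \<rho> g \<circ> s) ` a" by blast
    qed
  qed
  ultimately show ?thesis unfolding fixes_boundary_point_def by blast
qed

text \<open>From a vertex on the side of \<open>x\<close>, both \<open>u\<close> and
  \<open>w\<close> are reached through the edge. Then \<open>z\<close> between \<open>u\<close> and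
  \<open>w\<close> would make \<open>d u w\<close> exceed the length of the way through
  \<open>y\<close>.\<close>

lemma half_tree_convex:
  assumes "adj T x y" "u \<in> V" "w \<in> V" "z \<in> V" "btw u z w"
    and "d u y < d u x" "d w y < d w x"
  shows "d z y < d z x"
proof (rule ccontr)
  assume "\<not> d z y < d z x"
  have V: "x \<in> V" "y \<in> V" "x \<noteq> y" using adjD[OF assms(1)] by auto
  have xy: "d x y = 1" using dist_adj assms(1) by blast
  have zx: "btw z x y"
    using dist_neighbour[OF assms(4) assms(1)] \<open>\<not> d z y < d z x\<close> xy by (auto simp: btw_def)
  have "d z u' = d z x + 1 + d y u'" if "u' \<in> V" "d u' y < d u' x" for u'
  proof -
    have "btw x y u'"
      using dist_neighbour[OF that(1) assms(1)] that V xy dist_sym by (auto simp: btw_def)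
    from btw_concat(2)[OF assms(4) V(1,2) that(1) V(3) zx this]
    show ?thesis using \<open>btw x y u'\<close> xy unfolding btw_def by simp
  qed
  from this[OF assms(2,6)] this[OF assms(3,7)] assms
  have "d u w = d z x + 1 + d y u + (d z x + 1 + d y w)" by (simp add: btw_def dist_sym)
  then show False using dist_triangle[OF assms(2) V(2) assms(3)] dist_sym V assms by simp
qed

text \<open>Some translate of the oriented segment from \<open>x'\<close> to \<open>y'\<close> follows the one from \<open>x\<close> to \<open>y\<close>
  on a geodesic.\<close>

definition foll :: "'v \<Rightarrow> 'v \<Rightarrow> 'v \<Rightarrow> 'v \<Rightarrow> bool" where
  "foll x y x' y' \<longleftrightarrow>
    (\<exists>g\<in>carrier G. d x y + d y (\<rho> g x') + d x' y' = d x (\<rho> g y'))"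

text \<open>The translates of the two configurations share the nondegenerate segment from
  \<open>c\<close> to \<open>e\<close>, along which they glue; the witness is
  \<open>g \<otimes> h\<close>.\<close>

lemma foll_trans:
  assumes V: "a \<in> V" "b \<in> V" "c \<in> V" "e \<in> V" "x \<in> V" "y \<in> V"
    and "c \<noteq> e" "foll a b c e" "foll c e x y"
  shows "foll a b x y"
proof -
  obtain g h where g: "g \<in> carrier G" "d a b + d b (\<rho> g c) + d c e = d a (\<rho> g e)"
    and h: "h \<in> carrier G" "d c e + d e (\<rho> h x) + d x y = d c (\<rho> h y)"
    using assms unfolding foll_def by blast
  let ?c = "\<rho> g c" and ?e = "\<rho> g e" and ?x = "\<rho> g (\<rho> h x)" and ?y = "\<rho> g (\<rho> h y)"
  have V': "?c \<in> V" "?e \<in> V" "?x \<in> V" "?y \<in> V" using V g h by auto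
  have ce: "d ?c ?e = d c e" "d ?e ?x = d e (\<rho> h x)" "d ?x ?y = d x y" "d ?c ?y = d c (\<rho> h y)"
    using V g h by auto
  have "btw a ?c ?e"
    using g ce dist_triangle[OF V(1) V'(1) V'(2)] dist_triangle[OF V(1,2) V'(1)]
      by (simp add: btw_def)
  moreover have "btw ?c ?e ?y"
    using h(2) ce dist_triangle[OF V'(2,3,4)] dist_triangle[OF V'(1,2,4)] by (simp add: btw_def)
  moreover have "?c \<noteq> ?e" using act_inj V g \<open>c \<noteq> e\<close> by blast
  ultimately have "d a ?y = d a ?c + d ?c ?y"
    using btw_concat(2)[OF V(1) V'(1,2,4)] by (simp add: btw_def)
  moreover have "d a ?c = d a b + d b ?c"
    using g ce dist_triangle[OF V(1) V'(1) V'(2)] dist_triangle[OF V(1,2) V'(1)] by simp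
  moreover have "d b ?x \<le> d b ?c + (d ?c ?e + d ?e ?x)"
    using dist_triangle[OF V(2) V'(1,3)] dist_triangle[OF V'(1,2,3)] by simp
  moreover have "d a ?y \<le> d a b + (d b ?x + d ?x ?y)"
    using dist_triangle[OF V(1,2) V'(4)] dist_triangle[OF V(2) V'(3,4)] by simp
  ultimately have "d a b + d b ?x + d x y = d a ?y" using h(2) ce by linarith
  then show ?thesis unfolding foll_def using g h V act_mult
    by (intro bexI[of _ "g \<otimes> h"]) auto
qed

text \<open>A path is geodesic as soon as it does not turn back at the joints, so only the two edges
  next to the joints matter.\<close>

lemma foll_of_edges:
  assumes V: "x \<in> V" "y \<in> V" "x' \<in> V" "y' \<in> V" "x \<noteq> y" "x' \<noteq> y'"
    and f: "foll (nxt y x) y x' (nxt x' y')"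
  shows "foll x y x' y'"
proof -
  define u where "u = nxt y x"
  define w where "w = nxt x' y'"
  have u: "u \<in> V" "adj T y u" "d y x = Suc (d u x)"
    using nxt_props[OF V(2,1)] V(5) unfolding u_def by auto
  have w: "w \<in> V" "adj T x' w" "d x' y' = Suc (d w y')"
    using nxt_props[OF V(3,4,6)] unfolding w_def by auto
  obtain g where g: "g \<in> carrier G" "d u y + d y (\<rho> g x') + d x' w = d u (\<rho> g w)"
    using f unfolding foll_def u_def w_def by blast
  let ?x = "\<rho> g x'" and ?w = "\<rho> g w" and ?y = "\<rho> g y'"
  have V': "?x \<in> V" "?w \<in> V" "?y \<in> V" using V g w by auto
  have dd: "d ?x ?w = d x' w" "d ?w ?y = d w y'" "d ?x ?y = d x' y'" using V g w by auto
  have 1: "d x' w = 1" "d y u = 1" using dist_adj w u by auto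
  have b1: "btw x u y" using u 1 V dist_sym by (simp add: btw_def)
  have b2: "btw u y ?w"
    using g dd dist_triangle[OF V(2) V'(1,2)] dist_triangle[OF u(1) V(2) V'(2)]
      by (simp add: btw_def)
  have "u \<noteq> y" using adjD(3) u(2) by blast
  note b3 = btw_concat(1)[OF V(1) u(1) V(2) V'(2) this b1 b2]
  have b4: "btw y ?x ?w"
    using g dd b2 dist_triangle[OF V(2) V'(1,2)] dist_triangle[OF u(1) V(2) V'(2)]
    by (simp add: btw_def)
  note b5 = btw_trans[OF V(1,2) V'(1,2) b3 b4]
  have b6: "btw ?x ?w ?y" using dd w 1 by (simp add: btw_def)
  have "?x \<noteq> ?w" using act_inj[OF g(1) V(3) w(1)] adjD(3)[OF w(2)] by simp
  from btw_concat(2)[OF V(1) V'(1,2,3) this b5(1) b6]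
  have "d x y + d y ?x + d x' y' = d x ?y" using b5(2) dd by (simp add: btw_def)
  then show ?thesis unfolding foll_def using g by blast
qed

end

section \<open>Consequences of minimality\<close>

locale minimal_tree_action = tree_action T G \<rho>
  for T :: "'v sgraph" and G :: "('g, 'm) monoid_scheme" (structure) and \<rho> :: "'g \<Rightarrow> 'v \<Rightarrow> 'v" +
  assumes minimal: "minimal_action G T \<rho>"
    and valence: "\<forall>x\<in>verts T. valence_gt T x 2"
begin

lemma ex_third_neighbour:
  assumes "y \<in> V" obtains z where "adj T y z" "z \<noteq> a" "z \<noteq> b"
proof -
  have "\<not> {z. adj T y z} \<subseteq> {a, b}"
  proof
    assume s: "{z. adj T y z} \<subseteq> {a, b}"
    then have "finite {z. adj T y z}" by (rule finite_subset) simp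
    moreover have "card {z. adj T y z} \<le> card {a, b}" using s by (intro card_mono) auto
    moreover have "card {a, b} \<le> 2" by (simp add: card_insert_if)
    ultimately show False using valence assms unfolding valence_gt_def by fastforce
  qed
  then show ?thesis using that by blast
qed

text \<open>The form in which minimality is used: a convex set of vertices spans a subtree with the
  induced edges.\<close>

lemma invariant_convex_full:
  assumes C: "C \<subseteq> V" "C \<noteq> {}"
    and inv: "\<And>g x. g \<in> carrier G \<Longrightarrow> x \<in> C \<Longrightarrow> \<rho> g x \<in> C"
    and conv: "\<And>x y z. x \<in> C \<Longrightarrow> y \<in> C \<Longrightarrow> z \<in> V \<Longrightarrow> btw x z y \<Longrightarrow> z \<in> C"
  shows "C = V"
proof -
  define S where "S = \<lparr>verts = C, adj = (\<lambda>x y. adj T x y \<and> x \<in> C \<and> y \<in> C)\<rparr>"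
  have walkS: "walk T p" if "walk S p" for p
    using that C(1) unfolding walk_def S_def by (auto elim: successively_mono)
  have "simple_graph S" unfolding simple_graph_def S_def using adjD by auto
  moreover have "connected_graph S"
    unfolding connected_graph_def
  proof (intro ballI)
    fix x y assume "x \<in> verts S" "y \<in> verts S"
    then have xy: "x \<in> C" "y \<in> C" by (auto simp: S_def)
    then have "\<exists>p. walk S p \<and> hd p = x \<and> last p = y"
    proof (induction "d x y" arbitrary: x)
      case 0
      then have "x = y" using dist_eq_0 C by auto
      then show ?case using 0 by (intro exI[of _ "[x]"]) (auto simp: walk_Cons S_def)
    next
      case (Suc k)
      then have V: "x \<in> V" "y \<in> V" "x \<noteq> y" using C by auto
      note z = nxt_props[OF V]
      have "btw x (nxt x y) y" using z dist_adj[OF z(1)] by (simp add: btw_def)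
      then have zC: "nxt x y \<in> C" using conv Suc z by blast
      obtain p where p: "walk S p" "hd p = nxt x y" "last p = y"
        using Suc.hyps(1)[OF _ zC] Suc z by auto
      have "p \<noteq> []" using p(1) by (auto simp: walk_def)
      then show ?case using p z zC Suc.prems
        by (intro exI[of _ "x # p"]) (auto simp: walk_Cons S_def)
    qed
    then show "\<exists>p. walk S p \<and> hd p = x \<and> last p = y" .
  qed
  moreover have "acyclic_graph S"
    unfolding acyclic_graph_def
  proof
    assume "\<exists>p. walk S p \<and> distinct p \<and> 3 \<le> length p \<and> adj S (last p) (hd p)"
    then obtain p where "walk S p" "distinct p" "3 \<le> length p" "adj S (last p) (hd p)" by blast
    then show False using no_cycle[of p] walkS by (auto simp: S_def)
  qed
  moreover have "verts S \<noteq> {}" using C by (simp add: S_def)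
  ultimately have "subtree S T" unfolding subtree_def is_tree_def using C by (auto simp: S_def)
  moreover have "\<rho> g ` verts S = verts S" if g: "g \<in> carrier G" for g
  proof
    show "\<rho> g ` verts S \<subseteq> verts S" using inv g by (auto simp: S_def)
    show "verts S \<subseteq> \<rho> g ` verts S"
    proof
      fix x assume "x \<in> verts S"
      then have x: "x \<in> C" by (simp add: S_def)
      then have "x = \<rho> g (\<rho> (inv g) x)" using C g by auto
      moreover have "\<rho> (inv g) x \<in> verts S" using inv[of "inv g"] x g by (simp add: S_def)
      ultimately show "x \<in> \<rho> g ` verts S" by blast
    qed
  qed
  moreover have "adj S (\<rho> g x) (\<rho> g y)" if "g \<in> carrier G" "adj S x y" for g x y
    using that inv act_adj[of g x y] C by (auto simp: S_def)
  ultimately have "invariant_subtree G T \<rho> S" unfolding invariant_subtree_def by blast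
  then have "S = T" using minimal unfolding minimal_action_def by blast
  then have "verts S = V" by simp
  then show ?thesis by (simp add: S_def)
qed

text \<open>If the orbit of \<open>u\<close> stayed on the side of \<open>x\<close>, the vertices
  whose whole orbit stays there would form a nonempty invariant set, convex by
  \<open>half_tree_convex\<close>, that misses \<open>y\<close>.\<close>

lemma ex_translate_beyond:
  assumes "adj T x y" "u \<in> V"
  shows "\<exists>g\<in>carrier G. d (\<rho> g u) y < d (\<rho> g u) x"
proof (rule ccontr)
  assume neg: "\<not> ?thesis"
  have xy: "x \<in> V" "y \<in> V" using adjD assms by auto
  define C where "C = {z \<in> V. \<forall>g\<in>carrier G. d (\<rho> g z) x < d (\<rho> g z) y}"
  have "C = V"
  proof (rule invariant_convex_full)
    show "C \<subseteq> V" by (auto simp: C_def)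
    have "d (\<rho> g u) x < d (\<rho> g u) y" if "g \<in> carrier G" for g
      using neg that dist_neighbour[OF act_closed[OF that assms(2)] assms(1)] by force
    then show "C \<noteq> {}" using assms by (auto simp: C_def)
    show "\<rho> g z \<in> C" if "g \<in> carrier G" "z \<in> C" for g z
      using that unfolding C_def by (auto simp flip: act_mult)
    show "z \<in> C" if "a \<in> C" "b \<in> C" "z \<in> V" "btw a z b" for a b z
    proof -
      have "d (\<rho> g z) x < d (\<rho> g z) y" if g: "g \<in> carrier G" for g
        by (rule half_tree_convex[OF adjD(4)[OF assms(1)], of "\<rho> g a" "\<rho> g b"])
          (use \<open>a \<in> C\<close> \<open>b \<in> C\<close> \<open>z \<in> V\<close> \<open>btw a z b\<close> g act_btw in \<open>auto simp: C_def\<close>)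
      then show ?thesis using that by (simp add: C_def)
    qed
  qed
  then have "y \<in> C" using xy by simp
  then have "d (\<rho> \<one> y) x < d (\<rho> \<one> y) y" unfolding C_def by blast
  then show False using xy by simp
qed

text \<open>Move \<open>x'\<close> into a half-tree behind \<open>y\<close>; the geodesic from
  \<open>x\<close> then meets the translated edge in one direction or the other.\<close>

lemma foll_dichotomy:
  assumes "adj T x y" "adj T x' y'"
  shows "foll x y x' y' \<or> foll x y y' x'"
proof -
  have V: "x \<in> V" "y \<in> V" "x' \<in> V" "y' \<in> V" using adjD assms by auto
  \<comment> \<open>Taking the half-tree one edge past \<open>y\<close> keeps the translate of
    \<open>x'\<close> different from \<open>y\<close>; otherwise the translated edge might lead from
    \<open>y\<close> back to \<open>x\<close>.\<close>
  obtain z where z: "adj T y z" "z \<noteq> x" using ex_third_neighbour[OF V(2)] by blast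
  have zV: "z \<in> V" using adjD z by blast
  obtain g where g: "g \<in> carrier G" "d (\<rho> g x') z < d (\<rho> g x') y"
    using ex_translate_beyond[OF z(1) V(3)] by blast
  let ?X = "\<rho> g x'" and ?Y = "\<rho> g y'"
  have V': "?X \<in> V" "?Y \<in> V" using g V by auto
  have ad: "adj T ?X ?Y" using act_adj g V assms by blast
  have one: "d x y = 1" "d y z = 1" "d ?X ?Y = 1" "d x' y' = 1" "d y x = 1" "d y' x' = 1"
    using dist_adj assms z ad adjD(4) by auto
  have "d x z \<noteq> 0" using dist_eq_0[OF V(1) zV] z by auto
  then have xyz: "btw x y z" using dist_neighbour[OF V(1) z(1)] one by (auto simp: btw_def)
  have "d ?X y = Suc (d ?X z)" using dist_neighbour[OF V'(1) z(1)] g by auto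
  then have yzX: "btw y z ?X" using dist_sym V V' zV one by (simp add: btw_def)
  have "y \<noteq> z" using adjD(3) z by blast
  from btw_concat[OF V(1,2) zV V'(1) this xyz yzX]
  have xX: "btw x y ?X" by simp
  have Xy: "?X \<noteq> y" using g(2) V'(1) by auto
  show ?thesis
  proof (cases "d x ?Y = Suc (d x ?X)")
    case True
    then have "foll x y x' y'" unfolding foll_def using one xX
      by (intro bexI[of _ g]) (auto simp: btw_def g(1) True)
    then show ?thesis ..
  next
    case False
    then have lt: "d x ?X = Suc (d x ?Y)" using dist_neighbour[OF V(1) ad] by auto
    note W = nxt_props[OF V'(1) V(2) Xy]
    have "d x (nxt ?X y) \<le> d x ?X"
      using dist_triangle[OF V(1,2) W(2)] W(3) dist_sym[OF V(2) W(2)] dist_sym[OF V(2) V'(1)] xX one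
      by (simp add: btw_def)
    then have "nxt ?X y = ?Y" using closer_neighbour_unique[OF V(1) W(1) ad] lt by simp
    then have "d y ?X = Suc (d y ?Y)" using W(3) dist_sym V V' by simp
    then have "foll x y y' x'" unfolding foll_def using one xX lt
      by (intro bexI[of _ g]) (auto simp: btw_def g(1))
    then show ?thesis ..
  qed
qed

text \<open>If no translate of the edge from \<open>x0\<close> to \<open>y0\<close> lies back to back with it, then the half-trees
  beyond its translates intersect pairwise, but not all of them share a vertex by minimality. By the
  Helly property they converge to a single end.\<close>

lemma foll_opposite:
  assumes e: "adj T x0 y0" and no_end: "\<not> fixes_end"
  shows "foll y0 x0 x0 y0"
proof (rule ccontr)
  assume neg: "\<not> ?thesis"
  have V: "x0 \<in> V" "y0 \<in> V" using adjD e by auto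
  have one: "d x0 y0 = 1" "d y0 x0 = 1" using dist_adj e adjD(4) by auto
  \<comment> \<open>The dichotomy leaves only \<open>foll y0 x0 y0 x0\<close>, which an inversion of
    the edge would turn into the excluded relation.\<close>
  have no_inv: False if "g \<in> carrier G" "\<rho> g x0 = y0" "\<rho> g y0 = x0" for g
  proof -
    have "foll y0 x0 y0 x0" using foll_dichotomy[OF adjD(4)[OF e] e] neg by auto
    then obtain h where h: "h \<in> carrier G" "d y0 x0 + d x0 (\<rho> h y0) + d y0 x0 = d y0 (\<rho> h x0)"
      unfolding foll_def by blast
    have "\<rho> (h \<otimes> g) x0 = \<rho> h y0" "\<rho> (h \<otimes> g) y0 = \<rho> h x0"
      using that h V by (auto simp: act_mult)
    then have "foll y0 x0 x0 y0" unfolding foll_def using h that one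
      by (intro bexI[of _ "h \<otimes> g"]) auto
    then show False using neg by blast
  qed
  define H where "H g z \<longleftrightarrow> d z (\<rho> g y0) < d z (\<rho> g x0)" for g z
  have adg: "adj T (\<rho> g x0) (\<rho> g y0)" if "g \<in> carrier G" for g using act_adj that V e by blast
  \<comment> \<open>Disjoint half-trees would belong to edges that point away from each other or to
    an inverted edge, and both are excluded.\<close>
  have inter0: "\<exists>z\<in>V. H \<one> z \<and> H g z" if g: "g \<in> carrier G" for g
  proof (rule ccontr)
    assume none: "\<not> ?thesis"
    let ?x = "\<rho> g x0" and ?y = "\<rho> g y0"
    have V': "?x \<in> V" "?y \<in> V" using g V by auto
    have "\<not> H g y0" "\<not> H \<one> ?y" using none V V' one g unfolding H_def by fastforce+
    then have 1: "d y0 ?y = Suc (d y0 ?x)" and 2: "d ?y y0 = Suc (d ?y x0)"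
      using dist_neighbour[OF V(2) adg[OF g]] dist_neighbour[OF V'(2) e] V unfolding H_def by auto
    have 3: "d ?x ?y = 1" using dist_adj[OF adg[OF g]] .
    show False
    proof (cases "?x = y0")
      case True
      then have "d ?y y0 = 1" using 1 V V' dist_sym by simp
      then have "?y = x0" using 2 dist_eq_0 V V' by auto
      then show False using no_inv[OF g True] by blast
    next
      case False
      have "d y0 ?x \<noteq> 0" using dist_eq_0[OF V(2) V'(1)] False by auto
      have b1: "btw y0 ?x ?y" using 1 3 by (simp add: btw_def)
      have b2: "btw y0 x0 ?y" using 2 one dist_sym V V' by (simp add: btw_def)
      have "pt y0 ?x 1 = pt y0 ?y 1"
        using btw_pt[OF V(2) V' b1, of 1] \<open>d y0 ?x \<noteq> 0\<close> by simp
      also have "\<dots> = x0" by (rule pt_eqI) (use V V' one b2 in \<open>auto simp: btw_def\<close>)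
      finally have "d x0 ?x = d y0 ?x - 1" using pt_dist[OF V(2) V'(1), of 1] \<open>d y0 ?x \<noteq> 0\<close> by auto
      then have "d y0 x0 + d x0 ?x + d x0 y0 = d y0 ?y" using 1 one \<open>d y0 ?x \<noteq> 0\<close> by simp
      then show False using neg g unfolding foll_def by blast
    qed
  qed
  have inter: "\<exists>z\<in>V. H g z \<and> H h z" if g: "g \<in> carrier G" "h \<in> carrier G" for g h
  proof -
    obtain z where z: "z \<in> V" "H \<one> z" "H (inv g \<otimes> h) z" using inter0[of "inv g \<otimes> h"] g by auto
    have "d (\<rho> g z) (\<rho> g (\<rho> (inv g) (\<rho> h u))) = d z (\<rho> (inv g) (\<rho> h u))" if "u \<in> V" for u
      using z g that by (intro act_dist) auto
    then have "H g (\<rho> g z)" "H h (\<rho> g z)" using z g V unfolding H_def by (auto simp: act_mult)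
    then show ?thesis using z g by auto
  qed
  \<comment> \<open>A geodesic from outside to any vertex of the half-tree enters it through the
    same edge.\<close>
  have dir: "nxt x z = nxt x (\<rho> g y0)" "x \<noteq> \<rho> g y0"
    if "g \<in> carrier G" "x \<in> V" "\<not> H g x" "z \<in> V" "H g z" for g x z
  proof -
    let ?x = "\<rho> g x0" and ?y = "\<rho> g y0"
    have V': "?x \<in> V" "?y \<in> V" using that V by auto
    have ne: "?x \<noteq> ?y" using adjD(3) adg that by blast
    have o: "d ?x ?y = 1" using dist_adj adg that by blast
    have "btw x ?x ?y" using dist_neighbour[OF that(2) adg[OF that(1)]] that(3) o
      by (auto simp: btw_def H_def)
    moreover have "btw ?x ?y z" using dist_neighbour[OF that(4) adg[OF that(1)]] that o dist_sym V'
      by (auto simp: btw_def H_def)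
    ultimately have b: "btw x ?y z" using btw_concat[OF that(2) V' that(4) ne] by blast
    show xy: "x \<noteq> ?y" using that(3) V' ne o dist_sym unfolding H_def by auto
    show "nxt x z = nxt x ?y" by (rule nxt_btw) (use that V' b xy in auto)
  qed
  \<comment> \<open>Some \<open>h\<close> moves \<open>x\<close> out of the half-tree of the
    original edge; then \<open>x\<close> lies outside the half-tree of \<open>inv h\<close>.\<close>
  have ex: "\<exists>g\<in>carrier G. \<not> H g x" if xV: "x \<in> V" for x
  proof -
    obtain h where h: "h \<in> carrier G" "d (\<rho> h x) x0 < d (\<rho> h x) y0"
      using ex_translate_beyond[OF adjD(4)[OF e] xV] by blast
    have "d x (\<rho> (inv h) u) = d (\<rho> h x) u" if "u \<in> V" for u
      using act_dist[of h x "\<rho> (inv h) u"] h that xV by simp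
    then have "\<not> H (inv h) x" using h V unfolding H_def by auto
    then show ?thesis using h by blast
  qed
  have Hg: "H g (\<rho> g y0)" if "g \<in> carrier G" for g using that V one unfolding H_def by simp
  \<comment> \<open>The step towards the end to be found. The choice of the half-tree is immaterial,
    since any two of them share a vertex that shows the direction of both.\<close>
  define n where "n x = nxt x (\<rho> (SOME g. g \<in> carrier G \<and> \<not> H g x) y0)" for x
  have n: "n x = nxt x z" if gx: "g \<in> carrier G" "x \<in> V" "\<not> H g x" "z \<in> V" "H g z" for g x z
  proof -
    define g' where "g' = (SOME g. g \<in> carrier G \<and> \<not> H g x)"
    have g': "g' \<in> carrier G" "\<not> H g' x"
      using someI_ex[of "\<lambda>g. g \<in> carrier G \<and> \<not> H g x"] ex[OF that(2)] unfolding g'_def by auto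
    obtain z' where z': "z' \<in> V" "H g z'" "H g' z'" using inter[OF gx(1) g'(1)] by blast
    have "n x = nxt x (\<rho> g' y0)" unfolding n_def g'_def ..
    also have "\<dots> = nxt x z'" using dir(1)[OF g'(1) that(2) g'(2) z'(1,3)] ..
    also have "\<dots> = nxt x (\<rho> g y0)" using dir(1)[OF that(1-3) z'(1,2)] .
    also have "\<dots> = nxt x z" using dir(1)[OF that] ..
    finally show ?thesis .
  qed
  \<comment> \<open>Two given vertices head for a common \<open>z\<close>, so the conditions on
    \<open>n\<close> reduce to properties of \<open>nxt\<close> towards one vertex.\<close>
  have common: "\<exists>z\<in>V. z \<noteq> x \<and> z \<noteq> x' \<and> n x = nxt x z \<and> n x' = nxt x' z"
    if xx: "x \<in> V" "x' \<in> V" for x x'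
  proof -
    obtain g g' where g: "g \<in> carrier G" "\<not> H g x" "g' \<in> carrier G" "\<not> H g' x'"
      using ex[OF xx(1)] ex[OF xx(2)] by blast
    obtain z where z: "z \<in> V" "H g z" "H g' z" using inter[OF g(1,3)] by blast
    then have "n x = nxt x z" "n x' = nxt x' z"
      using n[OF g(1) that(1) g(2)] n[OF g(3) that(2) g(4)] by auto
    then show ?thesis using z g by (intro bexI[of _ z]) auto
  qed
  have fixes_end
  proof (rule fixed_end_of_successor)
    show nadj: "adj T x (n x)" if "x \<in> V" for x
      using common[OF that that] nxt_props that by metis
    show "n (n x) \<noteq> x" if xV: "x \<in> V" for x
    proof
      assume nn: "n (n x) = x"
      have nV: "n x \<in> V" using nadj[OF that] adjD(2) by blast
      obtain z where z: "z \<in> V" "z \<noteq> x" "z \<noteq> n x" "n x = nxt x z" "n (n x) = nxt (n x) z"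
        using common[OF xV nV] by blast
      show False using nxt_props(3)[OF that z(1)] nxt_props(3)[OF nV z(1)] z nn by auto
    qed
    show "n x = y \<or> n y = x" if a: "adj T x y" for x y
    proof -
      have V'': "x \<in> V" "y \<in> V" using adjD a by auto
      obtain z where z: "z \<in> V" "z \<noteq> x" "z \<noteq> y" "n x = nxt x z" "n y = nxt y z"
        using common[OF V''] by blast
      show ?thesis
        using dist_neighbour[OF z(1) a] nxt_eqI[OF z(1) a] nxt_eqI[OF z(1) adjD(4)[OF a]] z(4,5)
          dist_sym z(1) V'' by auto
    qed
    show "n (\<rho> h x) = \<rho> h (n x)" if hx: "h \<in> carrier G" "x \<in> V" for h x
    proof -
      obtain g where g: "g \<in> carrier G" "\<not> H g x" using ex[OF hx(2)] by blast
      have "\<not> H (h \<otimes> g) (\<rho> h x)" using g hx V unfolding H_def by (simp add: act_mult)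
      then have "n (\<rho> h x) = nxt (\<rho> h x) (\<rho> (h \<otimes> g) y0)"
        using n[of "h \<otimes> g" "\<rho> h x" "\<rho> (h \<otimes> g) y0"] Hg[of "h \<otimes> g"] g hx V by simp
      also have "\<dots> = nxt (\<rho> h x) (\<rho> h (\<rho> g y0))" using g hx V by (simp add: act_mult)
      also have "\<dots> = \<rho> h (nxt x (\<rho> g y0))"
        using act_nxt[OF hx(1,2)] g V dir(2)[OF g(1) hx(2) g(2), of "\<rho> g y0"] Hg[OF g(1)] by simp
      also have "nxt x (\<rho> g y0) = n x"
        using n[OF g(1) hx(2) g(2), of "\<rho> g y0"] Hg[OF g(1)] g V by simp
      finally show ?thesis .
    qed
  qed
  then show False using no_end by blast
qed

text \<open>If the dichotomy yields the second edge with the wrong orientation,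
  \<open>foll_opposite\<close> supplies a further translate that turns it round.\<close>

lemma foll_all:
  assumes "\<not> fixes_end"
    and V: "x \<in> V" "y \<in> V" "x' \<in> V" "y' \<in> V" "x \<noteq> y" "x' \<noteq> y'"
  shows "foll x y x' y'"
proof (rule foll_of_edges[OF V])
  define u where "u = nxt y x"
  define w where "w = nxt x' y'"
  have u: "u \<in> V" "adj T y u" using nxt_props[OF V(2,1)] V(5) unfolding u_def by auto
  have w: "w \<in> V" "adj T x' w" using nxt_props[OF V(3,4,6)] unfolding w_def by auto
  from foll_dichotomy[OF adjD(4)[OF u(2)] w(2)] show "foll u y x' w"
  proof
    assume a: "foll u y w x'"
    show ?thesis
      by (rule foll_trans[OF u(1) V(2) w(1) V(3) V(3) w(1) _ a foll_opposite[OF w(2) assms(1)]])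
        (use adjD(3) w(2) in blast)
  qed
qed

end

section \<open>Local transitivity\<close>

context tree_action
begin

section \<open>Pairs of vertices up to the group\<close>

definition eqv :: "'v \<Rightarrow> 'v \<Rightarrow> 'v \<Rightarrow> 'v \<Rightarrow> bool" where
  "eqv x y x' y' \<longleftrightarrow> (\<exists>g\<in>carrier G. \<rho> g x = x' \<and> \<rho> g y = y')"

lemma eqv_refl: "x \<in> V \<Longrightarrow> y \<in> V \<Longrightarrow> eqv x y x y"
  unfolding eqv_def by (intro bexI[of _ \<one>]) auto

lemma eqv_sym:
  assumes "x \<in> V" "y \<in> V" "eqv x y x' y'" shows "eqv x' y' x y"
proof -
  obtain g where "g \<in> carrier G" "\<rho> g x = x'" "\<rho> g y = y'"
    using assms(3) unfolding eqv_def by blast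
  then show ?thesis using assms unfolding eqv_def by (intro bexI[of _ "inv g"]) auto
qed

lemma eqv_trans:
  assumes "x \<in> V" "y \<in> V" "eqv x y x' y'" "eqv x' y' x'' y''" shows "eqv x y x'' y''"
proof -
  obtain g h where "g \<in> carrier G" "\<rho> g x = x'" "\<rho> g y = y'"
    "h \<in> carrier G" "\<rho> h x' = x''" "\<rho> h y' = y''"
    using assms(3,4) unfolding eqv_def by blast
  then show ?thesis using assms unfolding eqv_def
    by (intro bexI[of _ "h \<otimes> g"]) (auto simp: act_mult)
qed

lemma eqv_rev: "eqv x y x' y' \<Longrightarrow> eqv y x y' x'"
  unfolding eqv_def by blast

lemma eqv_act: "g \<in> carrier G \<Longrightarrow> eqv x y (\<rho> g x) (\<rho> g y)"
  unfolding eqv_def by blast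

lemma eqv_pt:
  assumes "x \<in> V" "y \<in> V" "eqv x y x' y'" "i \<le> j" "j \<le> d x y"
  shows "eqv (pt x y i) (pt x y j) (pt x' y' i) (pt x' y' j)"
proof -
  obtain g where g: "g \<in> carrier G" "x' = \<rho> g x" "y' = \<rho> g y"
    using assms(3) unfolding eqv_def by blast
  have "i \<le> d x y" using assms by simp
  then show ?thesis using act_pt[OF g(1) assms(1,2)] assms(5) g eqv_act[OF g(1)] by simp
qed

lemma transitive_on_segmentsI:
  assumes geo: "\<And>s. s \<in> X \<Longrightarrow> geodesic T s"
    and inv: "\<And>g s. g \<in> carrier G \<Longrightarrow> s \<in> X \<Longrightarrow> map (\<rho> g) s \<in> X"
    and trans: "\<And>s t. s \<in> X \<Longrightarrow> t \<in> X \<Longrightarrow> \<exists>g\<in>carrier G. map (\<rho> g) s = t"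
  shows "transitive_on_segments G \<rho> X"
proof -
  define \<phi> where "\<phi> = (\<lambda>g. \<lambda>s\<in>X. map (\<rho> g) s)"
  have sV: "set s \<subseteq> V" if "s \<in> X" for s using geo[OF that] by (auto simp: geodesic_def walk_def)
  have inverse: "map (\<rho> (inv g)) (map (\<rho> g) s) = s" "map (\<rho> g) (map (\<rho> (inv g)) s) = s"
    if "g \<in> carrier G" "s \<in> X" for g s
    using that sV[OF that(2)] by (auto intro!: map_idI simp: subset_iff)
  have bij: "\<phi> g \<in> Bij X" if g: "g \<in> carrier G" for g
  proof -
    have "bij_betw (\<phi> g) X X"
      by (rule bij_betwI[where g = "\<lambda>s. map (\<rho> (inv g)) s"])
        (use g inv inverse in \<open>auto simp: \<phi>_def simp del: map_map\<close>)
    then show ?thesis by (auto simp: Bij_def \<phi>_def)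
  qed
  have mult: "\<phi> (g \<otimes> h) = compose X (\<phi> g) (\<phi> h)" if "g \<in> carrier G" "h \<in> carrier G" for g h
    using that inv sV by (auto simp: \<phi>_def compose_def fun_eq_iff act_mult subset_iff)
  have "group_hom G (BijGroup X) \<phi>"
    unfolding group_hom_def group_hom_axioms_def hom_def
    using bij mult group_BijGroup is_group by (auto simp: BijGroup_def)
  then have "group_action G X \<phi>" by (simp add: group_action_def)
  then have "transitive_action G X \<phi>"
    unfolding transitive_action_def transitive_action_axioms_def
    using trans by (auto simp: \<phi>_def)
  then show ?thesis by (simp add: transitive_on_segments_def \<phi>_def)
qed

lemma transitive_on_segmentsD:
  assumes "transitive_on_segments G \<rho> X"
  shows "\<And>g s. g \<in> carrier G \<Longrightarrow> s \<in> X \<Longrightarrow> map (\<rho> g) s \<in> X"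
    and "\<And>s t. s \<in> X \<Longrightarrow> t \<in> X \<Longrightarrow> \<exists>g\<in>carrier G. map (\<rho> g) s = t"
proof -
  define \<phi> where "\<phi> = (\<lambda>g. \<lambda>s\<in>X. map (\<rho> g) s)"
  have "transitive_action G X \<phi>" using assms by (simp add: transitive_on_segments_def \<phi>_def)
  then interpret transitive_action G X \<phi> .
  show "map (\<rho> g) s \<in> X" if "g \<in> carrier G" "s \<in> X" for g s
    using element_image[of g s "\<phi> g s"] that by (simp add: \<phi>_def)
  show "\<exists>g\<in>carrier G. map (\<rho> g) s = t" if "s \<in> X" "t \<in> X" for s t
    using unique_orbit[OF that] that by (auto simp: \<phi>_def)
qed

lemma map_geodesic_eq:
  assumes "g \<in> carrier G" "geodesic T s" "geodesic T t" "\<rho> g (hd s) = hd t" "\<rho> g (last s) = last t"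
  shows "map (\<rho> g) s = t"
proof (rule geodesic_unique[OF act_geodesic[OF assms(1,2)] assms(3)])
  have "s \<noteq> []" using assms(2) by (auto simp: geodesic_def walk_def)
  then show "hd (map (\<rho> g) s) = hd t" "last (map (\<rho> g) s) = last t"
    using assms by (auto simp: hd_map last_map)
qed

lemma segmentsD:
  assumes "s \<in> segments T n"
  shows "hd s \<in> V" "last s \<in> V" "d (hd s) (last s) = n" "geodesic T s"
  using assms by (auto simp: segments_def geodesic_def walk_def seg_length_def)

lemma map_segment: "g \<in> carrier G \<Longrightarrow> s \<in> segments T n \<Longrightarrow> map (\<rho> g) s \<in> segments T n"
  using act_geodesic by (auto simp: segments_def seg_length_def)

lemma hd_map_segment: "s \<in> segments T n \<Longrightarrow> hd (map f s) = f (hd s)"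
  by (rule hd_map) (auto simp: segments_def geodesic_def walk_def)

end

section \<open>From unique extension to reversible segments\<close>

context minimal_tree_action
begin

text \<open>The first vertex avoids the directions of both \<open>a\<close> and \<open>b\<close>,
  which takes a third neighbour; afterwards it is enough not to turn back.\<close>

lemma ex_extension:
  assumes V: "y \<in> V" "a \<in> V" "b \<in> V"
  shows "\<exists>c\<in>V. d y c = k \<and> btw a y c \<and> btw b y c"
proof (induction k)
  case 0
  show ?case using V by (intro bexI[of _ y]) (auto simp: btw_def)
next
  case (Suc k)
  then obtain c where c: "c \<in> V" "d y c = k" "btw a y c" "btw b y c" by blast
  have away: "btw u w z" if "w \<in> V" "adj T w z" "u \<in> V" "z \<noteq> nxt w u" for u w z
  proof (cases "u = w")
    case True
    then show ?thesis using that by (simp add: btw_def)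
  next
    case False
    then have n: "adj T w (nxt w u)" "d u (nxt w u) \<le> d u w"
      using nxt_props[of w u] that dist_sym by auto
    then have "d u z = Suc (d u w)"
      using closer_neighbour_unique[OF that(3,2) n(1) _ n(2)] dist_neighbour[OF that(3,2)] that(4)
        by auto
    then show ?thesis using dist_adj[OF that(2)] by (simp add: btw_def)
  qed
  show ?case
  proof (cases "k = 0")
    case True
    then have "c = y" using c V dist_eq_0 by auto
    obtain z where z: "adj T y z" "z \<noteq> nxt y a" "z \<noteq> nxt y b" using ex_third_neighbour[OF V(1)] .
    then show ?thesis using away[OF V(1) z(1)] V True dist_adj[OF z(1)] adjD(2)
      by (intro bexI[of _ z]) auto
  next
    case False
    then have yc: "y \<noteq> c" using c V by auto
    obtain z where z: "adj T c z" "z \<noteq> nxt c y" using ex_third_neighbour[OF c(1)] by blast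
    have zV: "z \<in> V" using adjD(2) z by blast
    have b: "btw y c z" using away[OF c(1) z(1) V(1) z(2)] .
    then show ?thesis
      using btw_concat(2)[OF _ V(1) c(1) zV yc _ b] V c zV dist_adj[OF z(1)]
      by (intro bexI[of _ z]) (auto simp: btw_def[of y c z])
  qed
qed

text \<open>A segment of length at least \<open>n\<^sub>0\<close> has, up to its stabiliser, only one extension by an edge.\<close>

definition unique_extension :: "nat \<Rightarrow> bool" where
  "unique_extension n\<^sub>0 \<longleftrightarrow> (\<forall>x\<in>V. \<forall>z\<in>V. \<forall>y y'. n\<^sub>0 \<le> d x z \<longrightarrow> adj T z y \<longrightarrow> adj T z y' \<longrightarrow>
     btw x z y \<longrightarrow> btw x z y' \<longrightarrow> eqv x y x y')"

text \<open>The vertices before \<open>y\<close> and \<open>y'\<close> are matched by induction. The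
  image of \<open>y\<close> and the vertex \<open>y'\<close> are then two one-edge extensions of a
  segment that still has length at least \<open>n\<^sub>0\<close>.\<close>

lemma unique_extension_iterate:
  assumes ue: "unique_extension n\<^sub>0"
  shows "x \<in> V \<Longrightarrow> z \<in> V \<Longrightarrow> y \<in> V \<Longrightarrow> y' \<in> V \<Longrightarrow> n\<^sub>0 \<le> d x z \<Longrightarrow> btw x z y \<Longrightarrow> btw x z y' \<Longrightarrow>
    d z y = k \<Longrightarrow> d z y' = k \<Longrightarrow> eqv x y x y'"
proof (induction k arbitrary: y y')
  case 0
  then have "y = z" "y' = z" using dist_eq_0 by auto
  then show ?case using 0 eqv_refl by auto
next
  case (Suc k)
  note V = Suc.prems(1-4)
  have ne: "y \<noteq> z" "y' \<noteq> z" using Suc.prems by auto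
  have step: "nxt w z \<in> V \<and> btw x z (nxt w z) \<and> d z (nxt w z) = k \<and> btw x (nxt w z) w \<and> adj T (nxt w z) w"
    if w: "w \<in> V" "w \<noteq> z" "btw x z w" "d z w = Suc k" for w
  proof -
    note n = nxt_props[OF w(1) V(2) w(2)]
    have k: "d z (nxt w z) = k" using n w V dist_sym by auto
    have "btw z (nxt w z) w" using k w dist_adj[OF adjD(4)[OF n(1)]] by (simp add: btw_def)
    note b = btw_trans[OF V(1,2) n(2) w(1) w(3) this]
    show ?thesis using n(2) b k adjD(4)[OF n(1)] by blast
  qed
  note s = step[OF V(3) ne(1) Suc.prems(6,8)] and s' = step[OF V(4) ne(2) Suc.prems(7,9)]
  have "eqv x (nxt y z) x (nxt y' z)" using Suc.IH[of "nxt y z" "nxt y' z"] s s' Suc.prems by auto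
  then obtain g where g: "g \<in> carrier G" "\<rho> g x = x" "\<rho> g (nxt y z) = nxt y' z"
    unfolding eqv_def by blast
  have 1: "adj T (nxt y' z) (\<rho> g y)" using act_adj[of g "nxt y z" y] s V g by auto
  have 2: "btw x (nxt y' z) (\<rho> g y)" using act_btw[of g x "nxt y z" y] s V g by auto
  have "n\<^sub>0 \<le> d x (nxt y' z)" using s' Suc.prems(5) by (auto simp: btw_def)
  then have "eqv x (\<rho> g y) x y'" using ue 1 2 s' V unfolding unique_extension_def by blast
  moreover have "eqv x y x (\<rho> g y)" using g unfolding eqv_def by blast
  ultimately show ?case using eqv_trans V by blast
qed

text \<open>Swapping two of three arms at \<open>y\<close> by elements that fix the third one, in turn, reverses a
  segment with midpoint \<open>y\<close>.\<close>

lemma long_even_reversible: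
  assumes ue: "unique_extension n\<^sub>0"
    and V: "y \<in> V" "a \<in> V" "b \<in> V" and k: "d y a = k" "d y b = k" "n\<^sub>0 \<le> k" and bt: "btw a y b"
  shows "eqv a b b a"
proof -
  obtain c where c: "c \<in> V" "d y c = k" "btw a y c" "btw b y c" using ex_extension[OF V] by blast
  note iter = unique_extension_iterate[OF ue _ V(1)]
  have s: "d a y = k" "d b y = k" "d c y = k" using k c V dist_sym by auto
  have bs: "btw b y a" "btw c y a" "btw c y b" using btw_sym bt c V by auto
  have "eqv a b a c" using iter[of a b c k] V c k s bt by simp
  moreover have "eqv c a c b" using iter[of c a b k] V c k s bs by simp
  moreover have "eqv b c b a" using iter[of b c a k] V c k s bs by simp
  ultimately show ?thesis using eqv_trans eqv_rev V c by meson
qed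

text \<open>Prolong both ends equally until half the length is at least \<open>n\<^sub>0\<close>.
  Reversing the long segment swaps \<open>a\<close> and \<open>b\<close>, which lie symmetrically to
  its midpoint.\<close>

lemma even_reversible:
  assumes ue: "unique_extension n\<^sub>0" and V: "a \<in> V" "b \<in> V" and ev: "d a b = 2 * j"
  shows "eqv a b b a"
proof (cases "a = b")
  case True
  then show ?thesis using V eqv_refl by auto
next
  case False
  let ?n = "Suc n\<^sub>0"
  obtain a' where a': "a' \<in> V" "d a a' = ?n" "btw b a a'" using ex_extension[OF V(1) V(2) V(2)]
    by blast
  obtain b' where b': "b' \<in> V" "d b b' = ?n" "btw a b b'" using ex_extension[OF V(2) V(1) V(1)]
    by blast
  have "btw a' a b" using btw_sym V a' by auto
  from btw_concat[OF a'(1) V b'(1) False this b'(3)]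
  have *: "btw a' b b'" "btw a' a b'" by auto
  have da: "d a' a = ?n" "d a' b = ?n + 2 * j" "d a' b' = ?n + 2 * j + ?n"
    using a' V dist_sym \<open>btw a' a b\<close> * b' ev by (auto simp: btw_def)
  have db: "d b' b = ?n" "d b' a = ?n + 2 * j" "d b' a' = ?n + 2 * j + ?n"
    using da b' V a' dist_sym * by (auto simp: btw_def)
  define y where "y = pt a' b' (?n + j)"
  have y: "y \<in> V" "d a' y = ?n + j" "d y b' = ?n + j"
    using pt_dist[OF a'(1) b'(1), of "?n + j"] da unfolding y_def by auto
  have "eqv a' b' b' a'"
    by (rule long_even_reversible[OF ue y(1) a'(1) b'(1), where k = "?n + j"])
      (use y a' b' da dist_sym in \<open>auto simp: btw_def\<close>)
  from eqv_pt[OF a'(1) b'(1) this, of ?n "?n + 2 * j"] da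
  have "eqv (pt a' b' ?n) (pt a' b' (?n + 2 * j)) (pt b' a' ?n) (pt b' a' (?n + 2 * j))" by simp
  moreover have "pt a' b' ?n = a" "pt a' b' (?n + 2 * j) = b"
    "pt b' a' ?n = b" "pt b' a' (?n + 2 * j) = a"
    using pt_unique[OF a'(1) b'(1) V(1)] pt_unique[OF a'(1) b'(1) V(2)]
      pt_unique[OF b'(1) a'(1) V(1)] pt_unique[OF b'(1) a'(1) V(2)]
      * btw_sym a' b' V da db by auto
  ultimately show ?thesis by simp
qed

text \<open>Prolong to a common \<open>c\<close> on the far side of \<open>x\<close>. Reversing the
  segment from \<open>y\<close> to \<open>c\<close>, whose midpoint is \<open>x\<close>, fixes
  \<open>x\<close> and carries \<open>y\<close> to \<open>c\<close>; likewise for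
  \<open>z\<close>.\<close>

lemma sphere_transitive:
  assumes ue: "unique_extension n\<^sub>0" and V: "x \<in> V" "y \<in> V" "z \<in> V" and dd: "d x y = d x z"
  shows "eqv x y x z"
proof -
  obtain c where c: "c \<in> V" "d x c = d x y" "btw y x c" "btw z x c" using ex_extension[OF V]
    by blast
  have *: "eqv x y x c" if w: "y \<in> V" "d x c = d x y" "btw y x c" for y
  proof -
    have dy: "d y c = 2 * d x y" "d c y = 2 * d x y" "d y x = d x y" "d c x = d x y"
      using w V c(1) dist_sym by (auto simp: btw_def)
    have "eqv y c c y" by (rule even_reversible[OF ue w(1) c(1) dy(1)])
    from eqv_pt[OF w(1) c(1) this, of 0 "d x y"] dy
    have "eqv (pt y c 0) (pt y c (d x y)) (pt c y 0) (pt c y (d x y))" by simp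
    moreover have "pt y c (d x y) = x" "pt c y (d x y) = x"
      by (rule pt_eqI; use w c V dy in simp)+
    ultimately show ?thesis using w c eqv_rev by simp
  qed
  have "eqv x y x c" "eqv x z x c" using *[OF V(2)] *[OF V(3)] c dd by auto
  then show ?thesis using eqv_trans eqv_sym V by metis
qed

abbreviation locally_transitive :: bool where
  "locally_transitive \<equiv> \<exists>l\<in>{1, 2::nat}. \<forall>n. \<forall>w\<in>verts T.
    transitive_on_segments G \<rho> {s \<in> segments T n. gdist T (hd s) w mod l = 0}"

text \<open>Stabilisers are transitive on spheres, so only the orbits of vertices matter. Reversals
  connect vertices at even distance. Hence there is one orbit if some element moves a vertex by an
  odd distance, and otherwise the orbits are the two parity classes; this decides between the two
  values of \<open>l\<close>.\<close>

lemma locally_transitive_of_unique_extension: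
  assumes ue: "unique_extension n\<^sub>0"
  shows locally_transitive
proof -
  have move: "\<exists>g\<in>carrier G. \<rho> g x = x'" if "x \<in> V" "x' \<in> V" "even (d x x')" for x x'
    using even_reversible[OF ue that(1,2)] that(3) unfolding eqv_def by blast
  have trans: "\<exists>g\<in>carrier G. map (\<rho> g) s = t"
    if st: "s \<in> segments T n" "t \<in> segments T n" and h: "h \<in> carrier G" "\<rho> h (hd s) = hd t" for s t n h
  proof -
    note s = segmentsD[OF st(1)] and t = segmentsD[OF st(2)]
    have "d (hd t) (\<rho> h (last s)) = n" using act_dist[OF h(1) s(1,2)] s h(2) by simp
    then have "eqv (hd t) (\<rho> h (last s)) (hd t) (last t)"
      using sphere_transitive[OF ue t(1)] t s h by simp
    then obtain g where g: "g \<in> carrier G" "\<rho> g (hd t) = hd t" "\<rho> g (\<rho> h (last s)) = last t"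
      unfolding eqv_def by blast
    then show ?thesis using map_geodesic_eq[of "g \<otimes> h" s t] s t h
      by (intro bexI[of _ "g \<otimes> h"]) (auto simp: act_mult)
  qed
  show ?thesis
  proof (cases "\<exists>g\<in>carrier G. \<exists>u\<in>V. odd (d u (\<rho> g u))")
    case True
    then obtain f u where f: "f \<in> carrier G" "u \<in> V" "odd (d u (\<rho> f u))" by blast
    have move1: "\<exists>g\<in>carrier G. \<rho> g x = x'" if xx: "x \<in> V" "x' \<in> V" for x x'
    proof (cases "even (d x x')")
      case True
      then show ?thesis using move xx by blast
    next
      case False
      have V: "\<rho> f x \<in> V" "\<rho> f u \<in> V" using f xx by auto
      have "d (\<rho> f x) (\<rho> f u) = d x u" using f xx by simp
      then have "even (d (\<rho> f x) x')"
        using False f(3) dist_parity[OF xx(1) f(2) V(2)] dist_parity[OF xx(1) V(1,2)]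
          dist_parity[OF V(1) xx(1,2)] dist_sym xx V by auto
      then obtain g where "g \<in> carrier G" "\<rho> g (\<rho> f x) = x'" using move V xx by blast
      then show ?thesis using f xx by (intro bexI[of _ "g \<otimes> f"]) (auto simp: act_mult)
    qed
    have "transitive_on_segments G \<rho> {s \<in> segments T n. d (hd s) w mod 1 = 0}" if "w \<in> V" for n w
    proof (rule transitive_on_segmentsI)
      fix s t assume "s \<in> {s \<in> segments T n. d (hd s) w mod 1 = 0}"
        "t \<in> {s \<in> segments T n. d (hd s) w mod 1 = 0}"
      then show "\<exists>g\<in>carrier G. map (\<rho> g) s = t"
        using trans[of s n t] move1 segmentsD(1) by blast
    qed (use map_segment in \<open>auto simp: segments_def\<close>)
    then show ?thesis by blast
  next
    case False
    have "transitive_on_segments G \<rho> {s \<in> segments T n. d (hd s) w mod 2 = 0}" if w: "w \<in> V" for n w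
    proof (rule transitive_on_segmentsI)
      fix g s assume *: "g \<in> carrier G" "s \<in> {s \<in> segments T n. d (hd s) w mod 2 = 0}"
      then have s: "hd s \<in> V" using segmentsD by blast
      have "even (d (hd s) (\<rho> g (hd s)))" using False s * by blast
      then have "even (d (\<rho> g (hd s)) w)"
        using dist_parity[OF s act_closed[OF *(1) s] w] * by auto
      then show "map (\<rho> g) s \<in> {s \<in> segments T n. d (hd s) w mod 2 = 0}"
        using map_segment[OF *(1), of s n] * hd_map_segment[of s n "\<rho> g"]
          by (simp add: even_iff_mod_2_eq_zero)
    next
      fix s t assume *: "s \<in> {s \<in> segments T n. d (hd s) w mod 2 = 0}"
        "t \<in> {s \<in> segments T n. d (hd s) w mod 2 = 0}"
      then have V: "hd s \<in> V" "hd t \<in> V" using segmentsD by auto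
      then have "even (d (hd s) (hd t))" using dist_parity[OF V w] * by auto
      then show "\<exists>g\<in>carrier G. map (\<rho> g) s = t"
        using trans[of s n t] move[OF V] * by blast
    qed (auto simp: segments_def)
    then show ?thesis by blast
  qed
qed

text \<open>Such sets bound the number of orbits of segments from below, also when that number is
  infinite.\<close>

definition indep :: "nat \<Rightarrow> ('v \<times> 'v) set \<Rightarrow> bool" where
  "indep n S \<longleftrightarrow> finite S \<and> (\<forall>(x, y)\<in>S. x \<in> V \<and> y \<in> V \<and> d x y = n) \<and>
     (\<forall>(x, y)\<in>S. \<forall>(x', y')\<in>S. eqv x y x' y' \<longrightarrow> (x, y) = (x', y'))"

text \<open>Prolonging cannot create equivalences: an element that matches the longer segments
  matches their initial parts.\<close>

lemma indep_extend:
  assumes "indep n S"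
  shows "\<exists>S'. indep (n + k) S' \<and> card S' = card S \<and> (\<forall>(x, y)\<in>S'. (x, pt x y n) \<in> S)"
proof -
  have "\<forall>p\<in>S. \<exists>c\<in>V. d (snd p) c = k \<and> btw (fst p) (snd p) c"
    using assms ex_extension unfolding indep_def by (metis (mono_tags, lifting) case_prodD prod.collapse)
  then obtain c where c: "\<And>p. p \<in> S \<Longrightarrow> c p \<in> V \<and> d (snd p) (c p) = k \<and> btw (fst p) (snd p) (c p)"
    by metis
  define f where "f p = (fst p, c p)" for p
  have SV: "fst p \<in> V \<and> snd p \<in> V \<and> d (fst p) (snd p) = n" if "p \<in> S" for p
    using assms that unfolding indep_def by (cases p) auto
  have dd: "d (fst p) (c p) = n + k" if "p \<in> S" for p
    using c[OF that] SV[OF that] by (simp add: btw_def)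
  have p: "pt (fst p) (c p) n = snd p" if "p \<in> S" for p
    using pt_unique[of "fst p" "c p" "snd p"] c[OF that] SV[OF that] by auto
  have eq: "p = q" if pq: "p \<in> S" "q \<in> S" "eqv (fst p) (c p) (fst q) (c q)" for p q
  proof -
    have "eqv (pt (fst p) (c p) 0) (pt (fst p) (c p) n) (pt (fst q) (c q) 0) (pt (fst q) (c q) n)"
      using eqv_pt[of "fst p" "c p" "fst q" "c q" 0 n] pq SV c dd by simp
    then have "eqv (fst p) (snd p) (fst q) (snd q)" using p pq SV c by simp
    then show ?thesis using assms pq unfolding indep_def by fastforce
  qed
  have inj: "inj_on f S"
    by (rule inj_onI) (use eq eqv_refl c SV in \<open>auto simp: f_def\<close>)
  have "finite (f ` S)" using assms unfolding indep_def by simp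
  moreover have "\<forall>p\<in>f ` S. fst p \<in> V \<and> snd p \<in> V \<and> d (fst p) (snd p) = n + k"
    using c SV dd by (auto simp: f_def)
  moreover have "\<forall>p\<in>f ` S. \<forall>q\<in>f ` S. eqv (fst p) (snd p) (fst q) (snd q) \<longrightarrow> p = q"
  proof (intro ballI impI)
    fix p q assume "p \<in> f ` S" "q \<in> f ` S" and e: "eqv (fst p) (snd p) (fst q) (snd q)"
    then obtain p' q' where "p' \<in> S" "p = f p'" "q' \<in> S" "q = f q'" by blast
    then show "p = q" using eq[of p' q'] e by (simp add: f_def)
  qed
  ultimately have "indep (n + k) (f ` S)" unfolding indep_def case_prod_beta prod.collapse by blast
  moreover have "\<forall>(x, y)\<in>f ` S. (x, pt x y n) \<in> S" using p unfolding f_def by auto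
  ultimately show ?thesis using card_image[OF inj] by blast
qed

text \<open>Take \<open>n\<^sub>0\<close> where an independent set of the largest size occurs;
  prolonging keeps it largest. If a longer segment had two inequivalent extensions, its
  representative could be traded for both of them, which gains one element.\<close>

lemma unique_extension_of_bounded:
  assumes bound: "\<And>n S. indep n S \<Longrightarrow> card S \<le> N"
  shows "\<exists>n\<^sub>0. unique_extension n\<^sub>0"
proof -
  define K where "K = {card S |n S. indep n S}"
  have "finite K" unfolding K_def by (rule finite_subset[of _ "{..N}"]) (use bound in auto)
  moreover have "card {} \<in> K" unfolding K_def by (intro CollectI exI[of _ 0] exI[of _ "{}"]) (simp add: indep_def)
  ultimately have "Max K \<in> K" and max: "\<And>k. k \<in> K \<Longrightarrow> k \<le> Max K" using Max_in[of K] Max_ge[of K]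
    by blast+
  then obtain n\<^sub>0 S\<^sub>0 where S0: "indep n\<^sub>0 S\<^sub>0" "card S\<^sub>0 = Max K" unfolding K_def by auto
  have bd: "card S \<le> Max K" if "indep n S" for n S using that max unfolding K_def by blast
  have "unique_extension n\<^sub>0"
    unfolding unique_extension_def
  proof (intro ballI allI impI, rule ccontr)
    fix x z y y'
    assume x: "x \<in> V" "z \<in> V" "n\<^sub>0 \<le> d x z" "adj T z y" "adj T z y'" "btw x z y" "btw x z y'"
      and neg: "\<not> eqv x y x y'"
    define n where "n = d x z"
    have yV: "y \<in> V" "y' \<in> V" using adjD x by auto
    have dy: "d x y = Suc n" "d x y' = Suc n" using x dist_adj by (auto simp: btw_def n_def)
    obtain S where S: "indep n S" "card S = Max K"
      using indep_extend[OF S0(1), of "n - n\<^sub>0"] S0 x(3) unfolding n_def by auto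
    have SV: "a \<in> V \<and> b \<in> V \<and> d a b = n" if "(a, b) \<in> S" for a b
      using S that unfolding indep_def by auto
    \<comment> \<open>By maximality of \<open>S\<close>: otherwise \<open>(x, z)\<close> could be
      added.\<close>
    have "\<exists>(a, b)\<in>S. eqv a b x z"
    proof (rule ccontr)
      assume none: "\<not> ?thesis"
      then have no: "\<not> eqv a b x z \<and> \<not> eqv x z a b" if "(a, b) \<in> S" for a b
        using that SV eqv_sym x by blast
      have "indep n (insert (x, z) S)"
        using S(1) no x unfolding indep_def n_def by auto
      moreover have "(x, z) \<notin> S" using no eqv_refl x by blast
      ultimately show False using bd[of n "insert (x, z) S"] S unfolding indep_def by simp
    qed
    then obtain a b where ab: "(a, b) \<in> S" "eqv a b x z" by blast
    have "indep n (S - {(a, b)})" using S(1) unfolding indep_def by auto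
    from indep_extend[OF this, of 1] obtain S' where S': "indep (Suc n) S'"
      "card S' = card (S - {(a, b)})" "\<forall>(x, y)\<in>S'. (x, pt x y n) \<in> S - {(a, b)}" by auto
    have S'V: "u \<in> V \<and> w \<in> V \<and> d u w = Suc n" if "(u, w) \<in> S'" for u w
      using S'(1) that unfolding indep_def by auto
    have no: "\<not> eqv u w x t \<and> \<not> eqv x t u w"
      if t: "t = y \<or> t = y'" and u: "(u, w) \<in> S'" for u w t
    proof -
      have uw: "u \<in> V" "w \<in> V" "d u w = Suc n" using S'V u by auto
      have "\<not> eqv u w x t"
      proof
        assume *: "eqv u w x t"
        have "pt x t n = z" using pt_unique[OF x(1) _ x(2), of t] t yV x by (auto simp: n_def)
        then have "eqv u (pt u w n) x z"
          using eqv_pt[OF uw(1,2) *, of 0 n] uw x t yV by auto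
        then have "eqv u (pt u w n) a b"
          using eqv_trans[OF _ _ _ eqv_sym[OF _ _ ab(2)]] SV[OF ab(1)] uw pt_dist(1)[OF uw(1,2), of n] by auto
        moreover have "(u, pt u w n) \<in> S" "(u, pt u w n) \<noteq> (a, b)" using S'(3) u by auto
        ultimately show False using S(1) ab(1) unfolding indep_def by fastforce
      qed
      then show ?thesis using eqv_sym x yV t by blast
    qed
    have "indep (Suc n) (insert (x, y) (insert (x, y') S'))"
      using S'(1) no[of y] no[of y'] x yV dy neg eqv_sym[OF x(1) yV(2), of x y]
      unfolding indep_def by auto
    moreover have "(x, y) \<notin> insert (x, y') S'" "(x, y') \<notin> S'"
      using no[of y x y] no[of y' x y'] eqv_refl[OF x(1)] yV neg eqv_refl[OF x(1) yV(1)] by auto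
    moreover have "finite S" "finite S'" using S(1) S'(1) unfolding indep_def by auto
    moreover have "0 < card S" using \<open>finite S\<close> ab(1) card_gt_0_iff by blast
    ultimately show False
      using bd[of "Suc n" "insert (x, y) (insert (x, y') S')"] S(2) S'(2) ab(1) by simp
  qed
  then show ?thesis ..
qed

text \<open>Up to powers of \<open>a\<close> there are \<alpha> starting points on \<open>l\<close>
  and two directions, so each length has at most 2 * \<alpha> orbits of segments.\<close>

lemma locally_transitive_of_periodic:
  assumes a: "a \<in> carrier G" and l: "\<And>i. l i \<in> V" "\<And>i. l (i + \<alpha>) = \<rho> a (l i)" and "\<alpha> > 0"
    and all: "\<And>x y. x \<in> V \<Longrightarrow> y \<in> V \<Longrightarrow>
      \<exists>i. eqv x y (l i) (l (i + d x y)) \<or> eqv x y (l (i + d x y)) (l i)"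
  shows locally_transitive
proof -
  have mult: "eqv (l (i + k * \<alpha>)) (l (j + k * \<alpha>)) (l i) (l j)" for i j k
  proof (induction k)
    case 0
    then show ?case using eqv_refl l by simp
  next
    case (Suc k)
    have "l (i + Suc k * \<alpha>) = \<rho> a (l (i + k * \<alpha>))" "l (j + Suc k * \<alpha>) = \<rho> a (l (j + k * \<alpha>))"
      using l(2)[of "i + k * \<alpha>"] l(2)[of "j + k * \<alpha>"] by (simp_all add: algebra_simps)
    then show ?case using eqv_sym[OF l(1) l(1) eqv_act[OF a]] eqv_trans[OF _ _ _ Suc.IH] l by metis
  qed
  have "\<exists>i b. i < \<alpha> \<and> (if b then eqv x y (l i) (l (i + d x y)) else eqv x y (l (i + d x y)) (l i))"
    if xy: "x \<in> V" "y \<in> V" for x y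
  proof -
    obtain i where i: "eqv x y (l i) (l (i + d x y)) \<or> eqv x y (l (i + d x y)) (l i)"
      using all xy by blast
    define j where "j = i mod \<alpha>"
    have e: "i = j + (i div \<alpha>) * \<alpha>" by (simp add: j_def)
    have "eqv (l i) (l (i + d x y)) (l j) (l (j + d x y))"
      using mult[of j "i div \<alpha>" "j + d x y"] e by (metis add.commute add.left_commute)
    then have "eqv x y (l j) (l (j + d x y)) \<or> eqv x y (l (j + d x y)) (l j)"
      using i eqv_trans xy eqv_rev by metis
    moreover have "j < \<alpha>" using \<open>\<alpha> > 0\<close> by (simp add: j_def)
    ultimately show ?thesis by (metis (full_types))
  qed
  then obtain f b where fb: "\<And>x y. x \<in> V \<Longrightarrow> y \<in> V \<Longrightarrow> f x y < \<alpha> \<and>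
      (if b x y then eqv x y (l (f x y)) (l (f x y + d x y)) else eqv x y (l (f x y + d x y)) (l (f x y)))"
    by metis
  have "card S \<le> card ({..<\<alpha>} \<times> (UNIV :: bool set))" if S: "indep n S" for n S
  proof (rule card_inj_on_le[where f = "\<lambda>(x, y). (f x y, b x y)"])
    have SV: "x \<in> V \<and> y \<in> V \<and> d x y = n" if "(x, y) \<in> S" for x y
      using S that unfolding indep_def by auto
    show "inj_on (\<lambda>(x, y). (f x y, b x y)) S"
    proof (rule inj_onI, clarify)
      fix x y x' y' assume S2: "(x, y) \<in> S" "(x', y') \<in> S"
        and e: "f x y = f x' y'" "b x y = b x' y'"
      have "\<exists>u w. eqv x y u w \<and> eqv x' y' u w"
        using fb[of x y] fb[of x' y'] SV[OF S2(1)] SV[OF S2(2)] e by metis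
      then have "eqv x y x' y'" using eqv_trans eqv_sym SV S2 by metis
      then show "x = x' \<and> y = y'" using S S2 unfolding indep_def by fastforce
    qed
    show "(\<lambda>(x, y). (f x y, b x y)) ` S \<subseteq> {..<\<alpha>} \<times> UNIV" using fb SV by auto
  qed simp
  then show ?thesis using unique_extension_of_bounded locally_transitive_of_unique_extension
    by blast
qed

end

section \<open>A free semigroup of translations\<close>

context tree_action
begin

text \<open>The elements that translate the edge from \<open>p\<close> to \<open>q\<close> forward along an axis through it.\<close>

definition pos :: "'v \<Rightarrow> 'v \<Rightarrow> 'g \<Rightarrow> bool" where
  "pos p q g \<longleftrightarrow> g \<in> carrier G \<and> btw p q (\<rho> g p) \<and> btw p (\<rho> g p) (\<rho> g q)"

text \<open>Letters are appended on the right, so that for suitable letters the vertices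
  \<open>\<rho> (prd h j) p\<close> are met in order along one ray.\<close>

fun prd :: "(nat \<Rightarrow> 'g) \<Rightarrow> nat \<Rightarrow> 'g" where
  "prd h 0 = \<one>"
| "prd h (Suc j) = prd h j \<otimes> h j"

lemma prd_closed: "(\<And>i. h i \<in> carrier G) \<Longrightarrow> prd h j \<in> carrier G"
  by (induction j) auto

lemma prd_add:
  assumes "\<And>i. h i \<in> carrier G"
  shows "prd h (j + k) = prd h j \<otimes> prd (\<lambda>i. h (j + i)) k"
  by (induction k) (use assms prd_closed m_assoc in auto)

lemma prd_const: "prd (\<lambda>_. a) j = a [^] j"
  by (induction j) auto

lemma prd_periodic:
  assumes h: "\<And>i. h i \<in> carrier G" and per: "\<And>i. h (i + r) = h i"
  shows "prd h (r * m) = prd h r [^] m"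
proof (induction m)
  case 0
  then show ?case by simp
next
  case (Suc m)
  have "h (r * m + i) = h i" for i
  proof (induction m)
    case (Suc m)
    then show ?case using per[of "r * m + i"] by (simp add: ac_simps)
  qed simp
  then have "prd h (r * m + r) = prd h (r * m) \<otimes> prd h r"
    using prd_add[where h = h, OF h, of "r * m" r] by simp
  then show ?case using Suc by (simp add: add.commute)
qed

end

locale based_tree_action = tree_action T G \<rho>
  for T :: "'v sgraph" and G :: "('g, 'm) monoid_scheme" (structure) and \<rho> :: "'g \<Rightarrow> 'v \<Rightarrow> 'v" +
  fixes p q :: 'v
  assumes pq: "adj T p q"
begin

lemma pqV [simp]: "p \<in> V" "q \<in> V"
  using adjD pq by auto

lemma pos_carrier [simp]: "pos p q g \<Longrightarrow> g \<in> carrier G"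
  by (simp add: pos_def)

abbreviation len :: "'g \<Rightarrow> nat" where "len g \<equiv> d p (\<rho> g p)"

lemma pos_len: "pos p q g \<Longrightarrow> 1 \<le> len g"
  using dist_adj[OF pq] unfolding pos_def btw_def by auto

text \<open>The geodesic from \<open>p\<close> to \<open>\<rho> g q\<close> and the translate by
  \<open>g\<close> of the one from \<open>p\<close> to \<open>\<rho> h q\<close> share the
  translated edge, so they glue. Hence these elements form a semigroup on which \<open>len\<close>
  is additive.\<close>

lemma pos_mult:
  assumes "pos p q g" "pos p q h"
  shows "pos p q (g \<otimes> h)" "len (g \<otimes> h) = len g + len h" "btw p (\<rho> g p) (\<rho> (g \<otimes> h) p)"
proof -
  have c: "g \<in> carrier G" "h \<in> carrier G" using assms by auto
  have m: "\<rho> (g \<otimes> h) u = \<rho> g (\<rho> h u)" if "u \<in> V" for u using act_mult c that by simp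
  let ?gp = "\<rho> g p" and ?gq = "\<rho> g q" and ?hp = "\<rho> g (\<rho> h p)" and ?hq = "\<rho> g (\<rho> h q)"
  have V: "?gp \<in> V" "?gq \<in> V" "?hp \<in> V" "?hq \<in> V" using c by auto
  have g: "btw p q ?gp" "btw p ?gp ?gq" using assms by (auto simp: pos_def)
  have h: "btw ?gp ?gq ?hp" "btw ?gp ?hp ?hq" using assms c act_btw by (auto simp: pos_def)
  have ne: "?gp \<noteq> ?gq" using act_inj[OF c(1), of p q] adjD(3)[OF pq] by simp
  from btw_concat[OF pqV(1) V(1,2,3) ne g(2) h(1)] have 1: "btw p ?gp ?hp" by simp
  then show "btw p ?gp (\<rho> (g \<otimes> h) p)" using m by simp
  have dh: "d ?gp ?hp = len h" using c by simp
  show "len (g \<otimes> h) = len g + len h" using 1 m dh by (simp add: btw_def)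
  have "?gp \<noteq> ?hp" using pos_len[OF assms(2)] dh V by auto
  from btw_concat[OF pqV(1) V(1,3,4) this 1 h(2)] have 2: "btw p ?hp ?hq" by simp
  have "btw p q ?hp" using btw_trans2[OF pqV V(1,3) 1 g(1)] by simp
  then show "pos p q (g \<otimes> h)" using 2 m c by (simp add: pos_def)
qed

section \<open>Rays spelled by sequences of translations\<close>

definition pos_seq :: "(nat \<Rightarrow> 'g) \<Rightarrow> bool" where
  "pos_seq h \<longleftrightarrow> (\<forall>i. pos p q (h i))"

lemma pos_seq_carrier: "pos_seq h \<Longrightarrow> h i \<in> carrier G"
  by (simp add: pos_seq_def)

lemma pos_seq_shift: "pos_seq h \<Longrightarrow> pos_seq (\<lambda>i. h (j + i))"
  by (simp add: pos_seq_def)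

lemma prd_carrier [simp]: "pos_seq h \<Longrightarrow> prd h j \<in> carrier G"
  using prd_closed pos_seq_carrier by blast

lemma pos_prd: "pos_seq h \<Longrightarrow> pos p q (prd h (Suc j))"
proof (induction j)
  case 0
  then show ?case using pos_seq_carrier by (simp add: pos_seq_def)
next
  case (Suc j)
  then show ?case using pos_mult(1)[of "prd h (Suc j)" "h (Suc j)"] by (simp add: pos_seq_def)
qed

definition off :: "(nat \<Rightarrow> 'g) \<Rightarrow> nat \<Rightarrow> nat" where
  "off h j = (\<Sum>i<j. len (h i))"

lemma off_Suc: "off h (Suc j) = off h j + len (h j)"
  by (simp add: off_def)

lemma off_0 [simp]: "off h 0 = 0"
  by (simp add: off_def)

lemma len_prd: "pos_seq h \<Longrightarrow> len (prd h j) = off h j"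
proof (induction j)
  case (Suc j)
  show ?case
  proof (cases j)
    case 0
    then show ?thesis using Suc pos_seq_carrier by (simp add: off_def)
  next
    case (Suc i)
    then show ?thesis
      using pos_mult(2)[of "prd h (Suc i)" "h (Suc i)"] pos_prd[of h i] Suc.IH Suc.prems
      by (simp add: off_Suc pos_seq_def)
  qed
qed simp

lemma off_ge: "pos_seq h \<Longrightarrow> j \<le> off h j"
proof (induction j)
  case (Suc j)
  then show ?case using pos_len[of "h j"] by (simp add: off_Suc pos_seq_def)
qed simp

lemma off_strict_mono: "pos_seq h \<Longrightarrow> strict_mono (off h)"
  using pos_len unfolding strict_mono_Suc_iff off_Suc pos_seq_def
  by (metis less_add_same_cancel1 less_le_trans zero_less_one)

lemma off_add: "off h (j + k) = off h j + off (\<lambda>i. h (j + i)) k"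
  by (induction k) (simp_all add: off_Suc)

lemma prd_btw:
  assumes "pos_seq h" "j \<le> k"
  shows "btw p (\<rho> (prd h j) p) (\<rho> (prd h k) p)"
proof -
  obtain i where k: "k = j + i" using assms(2) le_Suc_ex by blast
  have "prd h k = prd h j \<otimes> prd (\<lambda>i. h (j + i)) i"
    unfolding k by (rule prd_add) (use assms pos_seq_carrier in blast)
  then have "d (\<rho> (prd h j) p) (\<rho> (prd h k) p) = off (\<lambda>i. h (j + i)) i"
    using assms pos_seq_shift[OF assms(1)] by (simp add: act_mult len_prd)
  then show ?thesis using len_prd[OF assms(1)] off_add[of h j i] k by (simp add: btw_def)
qed

text \<open>Every letter moves \<open>p\<close> by at least 1, so \<open>i\<close> letters reach far
  enough to contain vertex \<open>i\<close>; longer products give the same vertex by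
  \<open>ray_eq\<close>.\<close>

definition ray :: "(nat \<Rightarrow> 'g) \<Rightarrow> nat \<Rightarrow> 'v" where
  "ray h i = pt p (\<rho> (prd h i) p) i"

lemma ray_eq:
  assumes "pos_seq h" "i \<le> off h j"
  shows "ray h i = pt p (\<rho> (prd h j) p) i"
proof (cases "i \<le> j")
  case True
  then show ?thesis unfolding ray_def
    using btw_pt[OF pqV(1) _ _ prd_btw[OF assms(1) True], of i] off_ge[OF assms(1), of i] assms(1)
    by (simp add: len_prd)
next
  case False
  then have "j \<le> i" by simp
  then show ?thesis unfolding ray_def
    using btw_pt[OF pqV(1) _ _ prd_btw[OF assms(1) \<open>j \<le> i\<close>], of i] assms
    by (simp add: len_prd)
qed

lemma ray_V [simp]: "pos_seq h \<Longrightarrow> ray h i \<in> V"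
  unfolding ray_def using off_ge[of h i] by (intro pt_dist) (auto simp: len_prd)

lemma ray_pt:
  assumes "pos_seq h" "i \<le> j" "t \<le> j - i"
  shows "pt (ray h i) (ray h j) t = ray h (i + t)" "d (ray h i) (ray h j) = j - i"
proof -
  have e: "ray h u = pt p (\<rho> (prd h j) p) u" if "u \<le> j" for u
    by (rule ray_eq) (use assms off_ge[of h j] that in auto)
  have le: "j \<le> d p (\<rho> (prd h j) p)" using off_ge[of h j] assms by (simp add: len_prd)
  show "pt (ray h i) (ray h j) t = ray h (i + t)" "d (ray h i) (ray h j) = j - i"
    using e assms pt_pt[OF pqV(1) _ assms(2) le assms(3)] pt_pt_dist(1)[OF pqV(1) _ assms(2) le]
      by auto
qed

lemma ray_0 [simp]: "pos_seq h \<Longrightarrow> ray h 0 = p"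
  by (simp add: ray_def)

lemma ray_off: "pos_seq h \<Longrightarrow> ray h (off h j) = \<rho> (prd h j) p"
  using ray_eq[of h "off h j" j] pt_end[OF pqV(1), of "\<rho> (prd h j) p"] by (simp add: len_prd)

text \<open>Self-similarity of the ray, which reduces questions about block \<open>j\<close> to
  block 0.\<close>

lemma ray_shift:
  assumes "pos_seq h"
  shows "ray h (off h j + t) = \<rho> (prd h j) (ray (\<lambda>i. h (j + i)) t)"
proof -
  let ?h = "\<lambda>i. h (j + i)"
  note ps = pos_seq_shift[OF assms]
  have t: "t \<le> off ?h t" using off_ge[OF ps] .
  have m: "prd h (j + t) = prd h j \<otimes> prd ?h t"
    by (rule prd_add) (use assms pos_seq_carrier in blast)
  have "ray h (off h j + t) = pt p (\<rho> (prd h (j + t)) p) (off h j + t)"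
    using ray_eq[OF assms, of "off h j + t" "j + t"] t by (simp add: off_add)
  also have "\<dots> = pt (\<rho> (prd h j) p) (\<rho> (prd h (j + t)) p) t"
    using btw_pt2[OF pqV(1) _ _ prd_btw[OF assms, of j "j + t"], of t] t assms ps m
    by (simp add: len_prd act_mult)
  also have "\<dots> = \<rho> (prd h j) (ray ?h t)"
    using act_pt[of "prd h j" p "\<rho> (prd ?h t) p" t] t assms ps m
      by (simp add: act_mult len_prd ray_def)
  finally show ?thesis .
qed

lemma pos_seq_const: "pos p q a \<Longrightarrow> pos_seq (\<lambda>_. a)"
  by (simp add: pos_seq_def)

lemma pos_pow:
  assumes "pos p q a" "0 < k" shows "pos p q (a [^] k)" "len (a [^] k) = k * len a"
proof -
  obtain j where k: "k = Suc j" using assms(2) gr0_implies_Suc by blast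
  show "pos p q (a [^] k)"
    using pos_prd[OF pos_seq_const[OF assms(1)], of j] unfolding prd_const k .
  show "len (a [^] k) = k * len a"
    using len_prd[OF pos_seq_const[OF assms(1)], of k] unfolding prd_const by (simp add: off_def)
qed

lemma axis_shift: "pos p q a \<Longrightarrow> ray (\<lambda>_. a) (i + len a) = \<rho> a (ray (\<lambda>_. a) i)"
  using ray_shift[OF pos_seq_const, of a 1 i] by (simp add: off_def add.commute)

end

section \<open>Recovering a word from the gaps on its axis\<close>

definition gap :: "(nat \<Rightarrow> bool) \<Rightarrow> nat \<Rightarrow> nat \<Rightarrow> bool" where
  "gap M i k \<longleftrightarrow> M i \<and> M (i + k) \<and> (\<forall>j. i < j \<longrightarrow> j < i + k \<longrightarrow> \<not> M j)"

text \<open>The marks \<open>M\<close> on a line consisting of blocks that start at \<open>D 0, D 1, \<dots>\<close>: all blocks carry the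
  same marks \<open>C\<close> within their first \<open>\<beta>\<close> positions, and block \<open>j\<close> has length \<open>\<beta> + \<alpha> \<cdot> \<nu> j\<close>.\<close>

locale block_line =
  fixes C :: "nat \<Rightarrow> bool" and \<alpha> \<beta> :: nat and M :: "nat \<Rightarrow> bool" and D :: "nat \<Rightarrow> nat"
    and \<nu> :: "nat \<Rightarrow> nat"
  assumes D0: "D 0 = 0" and D_Suc: "D (Suc j) = D j + (\<beta> + \<alpha> * \<nu> j)"
    and marks: "t < \<beta> + \<alpha> * \<nu> j \<Longrightarrow> M (D j + t) \<longleftrightarrow> C t"
    and C_less: "C t \<Longrightarrow> t < \<beta>" and C_ex: "\<exists>t. C t"
    and \<alpha>: "0 < \<alpha>" and \<nu>: "\<beta> \<le> \<nu> j"
begin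

definition "t0 = (LEAST t. C t)"
definition "t1 = (GREATEST t. C t)"

lemma t0: "C t0" "C t \<Longrightarrow> t0 \<le> t" "t0 < \<beta>"
  unfolding t0_def using C_ex C_less by (auto intro: LeastI_ex Least_le)

lemma t1: "C t1" "C t \<Longrightarrow> t \<le> t1" "t1 < \<beta>"
proof -
  obtain t where "C t" using C_ex by blast
  then show "C t1" unfolding t1_def by (rule GreatestI_nat) (use C_less in \<open>auto intro: less_imp_le\<close>)
  show "C t \<Longrightarrow> t \<le> t1" for t
    unfolding t1_def by (rule Greatest_le_nat) (use C_less in \<open>auto intro: less_imp_le\<close>)
  show "t1 < \<beta>" using C_less \<open>C t1\<close> by blast
qed

lemma long: "\<beta> \<le> \<alpha> * \<nu> j"
  using \<alpha> \<nu>[of j] by (cases \<alpha>) (auto intro: trans_le_add1)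

lemma D_pos: "0 < \<beta>" using t0(3) by simp

lemma D_mono: "strict_mono D"
  unfolding strict_mono_Suc_iff D_Suc using D_pos by simp

lemma in_block: "\<exists>j t. i = D j + t \<and> t < \<beta> + \<alpha> * \<nu> j"
proof (induction i)
  case 0
  show ?case using D0 D_pos by (intro exI[of _ 0]) simp
next
  case (Suc i)
  then obtain j t where jt: "i = D j + t" "t < \<beta> + \<alpha> * \<nu> j" by blast
  show ?case
  proof (cases "Suc t < \<beta> + \<alpha> * \<nu> j")
    case True
    then show ?thesis using jt by (intro exI[of _ j] exI[of _ "Suc t"]) simp
  next
    case False
    then show ?thesis using jt D_pos by (intro exI[of _ "Suc j"] exI[of _ 0]) (simp add: D_Suc)
  qed
qed

lemma mark_cases:
  assumes "M i" obtains j t where "i = D j + t" "C t"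
  using in_block[of i] marks assms by blast

lemma mark: "C t \<Longrightarrow> M (D j + t)"
  using marks C_less by (simp add: trans_less_add1)

lemma gap_block: "gap M (D j + t1) (D (Suc j) + t0 - (D j + t1))" "D j + t1 \<le> D (Suc j) + t0"
  "\<beta> < D (Suc j) + t0 - (D j + t1)"
proof -
  show le: "D j + t1 \<le> D (Suc j) + t0" using t1(3) by (simp add: D_Suc)
  have no: "\<not> M i" if "D j + t1 < i" "i < D (Suc j) + t0" for i
  proof (cases "i < D (Suc j)")
    case True
    define t where "t = i - D j"
    have it: "i = D j + t" "t < \<beta> + \<alpha> * \<nu> j" "t1 < t" using that True by (auto simp: t_def D_Suc)
    have "\<not> C t" using t1(2)[of t] it by auto
    then show ?thesis using marks it by simp
  next
    case False
    define t where "t = i - D (Suc j)"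
    have it: "i = D (Suc j) + t" "t < t0" using that False by (auto simp: t_def)
    then have "\<not> C t" "t < \<beta> + \<alpha> * \<nu> (Suc j)" using t0 by force+
    then show ?thesis using marks it by simp
  qed
  show "gap M (D j + t1) (D (Suc j) + t0 - (D j + t1))"
    unfolding gap_def using no mark t0 t1 le by auto
  show "\<beta> < D (Suc j) + t0 - (D j + t1)" using t1(3) long[of j] by (simp add: D_Suc)
qed

text \<open>Two marks of one block are less than \<beta> apart, so a long gap leaves its block.
  Having no marks inside, it starts at the last mark of that block and ends at the first mark of the
  next one.\<close>

lemma long_gap:
  assumes "gap M i k" "\<beta> < k"
  shows "\<exists>j. i = D j + t1 \<and> i + k = D (Suc j) + t0"
proof -
  have M: "M i" "M (i + k)" and no: "\<And>j. i < j \<Longrightarrow> j < i + k \<Longrightarrow> \<not> M j"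
    using assms unfolding gap_def by auto
  obtain j t where i: "i = D j + t" "C t" using mark_cases[OF M(1)] .
  have lt: "t < \<beta>" "t \<le> t1" using i C_less t1 by auto
  have "i < D (Suc j) + t0" using i lt by (simp add: D_Suc)
  then have "\<not> D (Suc j) + t0 < i + k"
    using no[of "D (Suc j) + t0"] mark[OF t0(1), of "Suc j"] by blast
  moreover have "\<not> i + k < D (Suc j)"
  proof
    assume "i + k < D (Suc j)"
    then have "C (t + k)" using marks[of "t + k" j] M(2) i by (simp add: D_Suc add.assoc)
    then show False using C_less assms(2) by fastforce
  qed
  moreover have "\<not> (D (Suc j) \<le> i + k \<and> i + k < D (Suc j) + t0)"
  proof
    assume *: "D (Suc j) \<le> i + k \<and> i + k < D (Suc j) + t0"
    define u where "u = i + k - D (Suc j)"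
    have u: "i + k = D (Suc j) + u" "u < t0" using * by (auto simp: u_def)
    have "u < \<beta> + \<alpha> * \<nu> (Suc j)" using u(2) t0(3) by simp
    then have "C u" using marks M(2) u by simp
    then show False using t0(2) u by fastforce
  qed
  ultimately have e: "i + k = D (Suc j) + t0" by linarith
  have "D j + t1 < i + k" using e t1(3) by (simp add: D_Suc)
  then have "\<not> t < t1" using no[of "D j + t1"] mark[OF t1(1), of j] i by auto
  then show ?thesis using e i lt by (intro exI[of _ j]) simp
qed

end

locale two_block_lines =
  A: block_line C \<alpha> \<beta> M D \<nu> + B: block_line C \<alpha> \<beta> M' D' \<nu>'
  for C \<alpha> \<beta> M D \<nu> M' D' \<nu>'
begin

lemma same_t: "B.t0 = A.t0" "B.t1 = A.t1"
  by (simp_all add: A.t0_def B.t0_def A.t1_def B.t1_def)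

text \<open>Apart from the exponent, the length of the gap after a block is the same for all
  blocks.\<close>

lemma same_run:
  assumes "D' (Suc j) + A.t0 = e + (D (Suc k) + A.t0)" "D' j + A.t1 = e + (D k + A.t1)"
  shows "\<nu>' j = \<nu> k"
  using assms A.\<alpha> by (simp add: A.D_Suc B.D_Suc)

text \<open>The window ends at the first mark of the third block, so it shows the first two long
  gaps completely. Their copies are again long gaps, hence lie between blocks, and they are
  consecutive because the second one starts in the block in which the first one ends.\<close>

lemma occurs:
  assumes "\<And>j. j \<le> D 2 + A.t0 \<Longrightarrow> M' (i + j) \<longleftrightarrow> M j"
  shows "\<exists>j. \<nu>' j = \<nu> 0 \<and> \<nu>' (Suc j) = \<nu> 1"
proof -
  have tr: "\<exists>j. i + (D k + A.t1) = D' j + A.t1 \<and> i + (D (Suc k) + A.t0) = D' (Suc j) + A.t0"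
    if k: "k \<le> 1" for k
  proof -
    let ?l = "D (Suc k) + A.t0 - (D k + A.t1)"
    have le: "D (Suc k) + A.t0 \<le> D 2 + A.t0"
      using A.D_mono k by (simp add: strict_mono_less_eq)
    have "gap M' (i + (D k + A.t1)) ?l"
      unfolding gap_def
    proof (intro conjI allI impI)
      note g = A.gap_block[of k, unfolded gap_def]
      show "M' (i + (D k + A.t1))" using g assms[of "D k + A.t1"] le by auto
      show "M' (i + (D k + A.t1) + ?l)" using g assms[of "D (Suc k) + A.t0"] le
        by (simp add: add.assoc)
      fix j assume j: "i + (D k + A.t1) < j" "j < i + (D k + A.t1) + ?l"
      then have "M' (i + (j - i)) \<longleftrightarrow> M (j - i)" using assms[of "j - i"] le g(2) by simp
      moreover have "D k + A.t1 < j - i" "j - i < D k + A.t1 + ?l" using j by auto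
      ultimately show "\<not> M' j" using g(1) j by simp
    qed
    from B.long_gap[OF this A.gap_block(3)[of k]] same_t A.gap_block(2)[of k] show ?thesis
      by (auto simp: add.assoc)
  qed
  obtain j where j: "i + (D 0 + A.t1) = D' j + A.t1" "i + (D (Suc 0) + A.t0) = D' (Suc j) + A.t0"
    using tr[of 0] by auto
  obtain j' where j': "i + (D 1 + A.t1) = D' j' + A.t1" "i + (D (Suc 1) + A.t0) = D' (Suc j') + A.t0"
    using tr[of 1] by auto
  have "D' j' = D' (Suc j)" using j j' by simp
  then have "j' = Suc j" using strict_mono_eq[OF B.D_mono] by blast
  then show ?thesis using same_run[of j i 0] same_run[of j' i 1] j j' by (intro exI[of _ j]) auto
qed

text \<open>As in \<open>occurs\<close>, for the reflection that sends \<open>j\<close> to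
  \<open>N - j\<close>. It swaps the two ends of each gap and the order of the two gaps.\<close>

lemma occurs_reversed:
  assumes N: "D 2 + A.t0 \<le> N" and rev: "\<And>j. j \<le> N \<Longrightarrow> M' (i + (N - j)) \<longleftrightarrow> M j"
  shows "\<exists>j. \<nu>' j = \<nu> 1 \<and> \<nu>' (Suc j) = \<nu> 0"
proof -
  have tr: "\<exists>j. i + N = D' j + A.t1 + (D (Suc k) + A.t0) \<and> i + N = D' (Suc j) + A.t0 + (D k + A.t1)"
    if k: "k \<le> 1" for k
  proof -
    let ?l = "D (Suc k) + A.t0 - (D k + A.t1)" and ?s = "i + (N - (D (Suc k) + A.t0))"
    have "D (Suc k) + A.t0 \<le> D 2 + A.t0"
      using A.D_mono k by (simp add: strict_mono_less_eq)
    then have le: "D (Suc k) + A.t0 \<le> N" using N by simp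
    have e: "?s + ?l = i + (N - (D k + A.t1))" using le A.gap_block(2)[of k] by simp
    have "gap M' ?s ?l"
      unfolding gap_def e
    proof (intro conjI allI impI)
      note g = A.gap_block[of k, unfolded gap_def]
      show "M' ?s" using g rev[of "D (Suc k) + A.t0"] le by simp
      show "M' (i + (N - (D k + A.t1)))" using g rev[of "D k + A.t1"] le by simp
      fix j assume j: "?s < j" "j < i + (N - (D k + A.t1))"
      define u where "u = N - (j - i)"
      have u: "u \<le> N" "j = i + (N - u)" "D k + A.t1 < u" "u < D k + A.t1 + ?l"
        using j le g(2) by (auto simp: u_def)
      then show "\<not> M' j" using g(1) rev[of u] by simp
    qed
    from B.long_gap[OF this A.gap_block(3)[of k]] obtain j
      where "?s = D' j + A.t1" "?s + ?l = D' (Suc j) + A.t0" using same_t by auto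
    then show ?thesis using e le A.gap_block(2)[of k] by (intro exI[of _ j]) auto
  qed
  obtain j where j: "i + N = D' j + A.t1 + (D (Suc 0) + A.t0)" "i + N = D' (Suc j) + A.t0 + (D 0 + A.t1)"
    using tr[of 0] by auto
  obtain j' where j': "i + N = D' j' + A.t1 + (D (Suc 1) + A.t0)" "i + N = D' (Suc j') + A.t0 + (D 1 + A.t1)"
    using tr[of 1] by auto
  have "D' (Suc j') = D' j" using j j' by simp
  then have s: "j = Suc j'" using strict_mono_eq[OF B.D_mono] by metis
  have "\<alpha> * \<nu>' j = \<alpha> * \<nu> 0" "\<alpha> * \<nu>' j' = \<alpha> * \<nu> 1"
    using j j' A.D_Suc[of 0] A.D_Suc[of 1] B.D_Suc[of j] B.D_Suc[of j'] by auto
  then show ?thesis using s A.\<alpha> by (intro exI[of _ j']) auto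
qed

end

section \<open>Counting translates of a segment\<close>

context tree_action
begin

definition occ :: "'v \<Rightarrow> 'v \<Rightarrow> 'v \<Rightarrow> 'v \<Rightarrow> nat set" where
  "occ a b x y = {i. i + d a b \<le> d x y \<and> eqv a b (pt x y i) (pt x y (i + d a b))}"

definition cnt :: "'v \<Rightarrow> 'v \<Rightarrow> 'v \<Rightarrow> 'v \<Rightarrow> int" where
  "cnt a b x y = int (card (occ a b x y))"

text \<open>The median quasimorphism as a function of two vertices; its value at \<open>v\<close>
  and \<open>\<rho> g v\<close> is \<open>median_qm\<close>, by
  \<open>median_qm_eq_flow\<close>.\<close>

definition flow :: "'v \<Rightarrow> 'v \<Rightarrow> 'v \<Rightarrow> 'v \<Rightarrow> int" where
  "flow a b x y = cnt a b x y - cnt a b y x"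

lemma finite_occ [simp]: "finite (occ a b x y)"
  by (rule finite_subset[of _ "{..d x y}"]) (auto simp: occ_def)

lemma eqv_act_iff:
  assumes "g \<in> carrier G" "a \<in> V" "b \<in> V" "u \<in> V" "w \<in> V"
  shows "eqv a b (\<rho> g u) (\<rho> g w) \<longleftrightarrow> eqv a b u w"
  using eqv_trans[OF assms(2,3) _ eqv_act[OF assms(1)]]
    eqv_trans[OF assms(2,3) _ eqv_sym[OF assms(4,5) eqv_act[OF assms(1)]]] by blast

lemma cnt_rev:
  assumes V: "a \<in> V" "b \<in> V" "x \<in> V" "y \<in> V"
  shows "cnt a b y x = cnt b a x y"
proof -
  let ?n = "d a b" and ?D = "d x y"
  have n: "d b a = ?n" "d y x = ?D" using V dist_sym by auto
  have iff: "?D - ?n - i \<in> occ b a x y \<longleftrightarrow> i \<in> occ a b y x" if "i + ?n \<le> ?D" for i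
  proof -
    have "pt y x i = pt x y (?D - i)" "pt y x (i + ?n) = pt x y (?D - (i + ?n))"
      using pt_rev[OF V(3,4), of "?D - i"] pt_rev[OF V(3,4), of "?D - (i + ?n)"] that by auto
    moreover have "?D - ?n - i = ?D - (i + ?n)" "?D - ?n - i + ?n = ?D - i" using that by auto
    ultimately show ?thesis using n that eqv_rev unfolding occ_def by auto
  qed
  have "bij_betw (\<lambda>i. ?D - ?n - i) (occ a b y x) (occ b a x y)"
  proof (rule bij_betwI[where g = "\<lambda>i. ?D - ?n - i"])
    show "(\<lambda>i. ?D - ?n - i) \<in> occ a b y x \<rightarrow> occ b a x y"
      using iff n by (auto simp: occ_def)
    show "(\<lambda>i. ?D - ?n - i) \<in> occ b a x y \<rightarrow> occ a b y x"
    proof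
      fix i assume i: "i \<in> occ b a x y"
      then have le: "i + ?n \<le> ?D" using n by (simp add: occ_def)
      then have "?D - ?n - (?D - ?n - i) = i" by simp
      then show "?D - ?n - i \<in> occ a b y x" using iff[of "?D - ?n - i"] i le by simp
    qed
  qed (use n in \<open>auto simp: occ_def\<close>)
  then show ?thesis unfolding cnt_def by (simp add: bij_betw_same_card)
qed

lemma cnt_act:
  assumes "g \<in> carrier G" "a \<in> V" "b \<in> V" "x \<in> V" "y \<in> V"
  shows "cnt a b (\<rho> g x) (\<rho> g y) = cnt a b x y"
proof -
  have "occ a b (\<rho> g x) (\<rho> g y) = occ a b x y"
    unfolding occ_def using assms act_pt[OF assms(1,4,5)] eqv_act_iff[OF assms(1-3)] pt_dist(1)[OF assms(4,5)]
    by auto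
  then show ?thesis by (simp add: cnt_def)
qed

text \<open>The only copy that can be new is the one that ends at \<open>z\<close>.\<close>

lemma cnt_step:
  assumes V: "x \<in> V" "y \<in> V" "a \<in> V" "b \<in> V" and ad: "adj T y z" and bt: "btw x y z"
  shows "cnt a b x z = cnt a b x y +
    of_bool (d a b \<le> d x z \<and> eqv a b (pt x z (d x z - d a b)) z)"
proof -
  have z: "z \<in> V" "d x z = Suc (d x y)" using ad adjD dist_adj bt by (auto simp: btw_def)
  let ?i = "d x z - d a b"
  let ?P = "d a b \<le> d x z \<and> eqv a b (pt x z ?i) z"
  have e: "pt x z i = pt x y i" if "i \<le> d x y" for i
    using btw_pt[OF V(1,2) z(1) bt that] .
  have "occ a b x z = occ a b x y \<union> (if ?P then {?i} else {})"
  proof (intro equalityI subsetI)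
    fix i assume i: "i \<in> occ a b x z"
    show "i \<in> occ a b x y \<union> (if ?P then {?i} else {})"
    proof (cases "i + d a b \<le> d x y")
      case True
      then show ?thesis using i e by (auto simp: occ_def)
    next
      case False
      then have "i + d a b = d x z" using i z by (auto simp: occ_def)
      then have "i = ?i" "i + d a b = d x z" by auto
      moreover have "?P" using i pt_end[OF V(1) z(1)] calculation unfolding occ_def by auto
      ultimately show ?thesis by simp
    qed
  next
    fix i assume "i \<in> occ a b x y \<union> (if ?P then {?i} else {})"
    then show "i \<in> occ a b x z"
      using e z pt_end[OF V(1) z(1)] by (auto simp: occ_def split: if_splits)
  qed
  moreover have "?i \<notin> occ a b x y" using z by (auto simp: occ_def)
  ultimately show ?thesis unfolding cnt_def by simp
qed

lemma cnt_lipschitz: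
  assumes V: "x \<in> V" "y \<in> V" "z \<in> V" "a \<in> V" "b \<in> V"
  shows "\<bar>cnt a b x y - cnt a b x z\<bar> \<le> int (d y z)"
  using V(2)
proof (induction "d y z" arbitrary: y)
  case 0
  then show ?case using V dist_eq_0 by auto
next
  case (Suc k)
  then have "y \<noteq> z" using V by auto
  note w = nxt_props[OF Suc.prems V(3) this]
  let ?w = "nxt y z"
  have one: "d y ?w = 1" "d ?w y = 1" using dist_adj w(1) adjD(4) by auto
  have "\<bar>cnt a b x y - cnt a b x ?w\<bar> \<le> 1"
    using dist_neighbour[OF V(1) w(1)]
  proof
    assume "d x ?w = Suc (d x y)"
    then have "btw x y ?w" using one by (simp add: btw_def)
    from cnt_step[OF V(1) Suc.prems V(4,5) w(1) this] show ?thesis by simp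
  next
    assume "d x y = Suc (d x ?w)"
    then have "btw x ?w y" using one by (simp add: btw_def)
    from cnt_step[OF V(1) w(2) V(4,5) adjD(4)[OF w(1)] this] show ?thesis by simp
  qed
  moreover have "\<bar>cnt a b x ?w - cnt a b x z\<bar> \<le> int (d ?w z)" using Suc w by auto
  ultimately show ?case using w(3) by linarith
qed

lemma cnt_lipschitz1:
  assumes "x \<in> V" "y \<in> V" "z \<in> V" "a \<in> V" "b \<in> V"
  shows "\<bar>cnt a b y x - cnt a b z x\<bar> \<le> int (d y z)"
  using cnt_lipschitz[OF assms(1-3,5,4)] cnt_rev assms by simp

text \<open>A copy lies before \<open>m\<close>, lies after \<open>m\<close>, or straddles
  \<open>m\<close>; in the last case it starts at one of the \<open>d a b\<close> positions before
  \<open>m\<close>.\<close>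

lemma cnt_concat:
  assumes V: "a \<in> V" "b \<in> V" "x \<in> V" "m \<in> V" "y \<in> V" and bt: "btw x m y"
  shows "\<bar>cnt a b x y - cnt a b x m - cnt a b m y\<bar> \<le> int (d a b) + 1"
proof -
  let ?n = "d a b" and ?D = "d x m"
  let ?A = "occ a b x m" and ?B = "(+) ?D ` occ a b m y" and ?C = "occ a b x y"
  have D: "d x y = ?D + d m y" using bt by (simp add: btw_def)
  have A: "i \<in> ?A \<longleftrightarrow> i \<in> ?C \<and> i + ?n \<le> ?D" for i
    using btw_pt[OF V(3-5) bt, of i] btw_pt[OF V(3-5) bt, of "i + ?n"] D by (auto simp: occ_def)
  have B: "?D + i \<in> ?C \<longleftrightarrow> i \<in> occ a b m y" for i
  proof -
    have "pt x y (?D + i) = pt m y i" "pt x y (?D + i + ?n) = pt m y (i + ?n)" if "i + ?n \<le> d m y"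
      using btw_pt2[OF V(3-5) bt, of i] btw_pt2[OF V(3-5) bt, of "i + ?n"] that
        by (auto simp: add.assoc)
    then show ?thesis using D by (auto simp: occ_def)
  qed
  have B': "i \<in> ?B \<longleftrightarrow> i \<in> ?C \<and> ?D \<le> i" for i
    using B[of "i - ?D"] B by (auto simp: image_iff) (metis le_add_diff_inverse)
  have "?C \<subseteq> (?A \<union> ?B) \<union> {?D - ?n..<?D}" using A B' by auto
  then have "card ?C \<le> card ((?A \<union> ?B) \<union> {?D - ?n..<?D})" by (intro card_mono) auto
  also have "\<dots> \<le> card (?A \<union> ?B) + card {?D - ?n..<?D}" by (rule card_Un_le)
  also have "\<dots> \<le> card ?A + card ?B + ?n" using card_Un_le[of ?A ?B] by simp
  finally have 1: "card ?C \<le> card ?A + card ?B + ?n" .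
  have "card ?A + card ?B = card (?A \<union> ?B) + card (?A \<inter> ?B)" by (intro card_Un_Int) auto
  moreover have "card (?A \<union> ?B) \<le> card ?C" using A B' by (intro card_mono) auto
  \<comment> \<open>Only a segment of length 0, at \<open>m\<close> itself, is counted on both
    sides; hence the 1 in the bound.\<close>
  moreover have "card (?A \<inter> ?B) \<le> card {?D}" using A B' by (intro card_mono) auto
  moreover have "card ?B = card (occ a b m y)" by (intro card_image) auto
  ultimately show ?thesis using 1 unfolding cnt_def by simp
qed

section \<open>The flow between two vertices\<close>

lemma flow_antisym: "flow a b y x = - flow a b x y"
  by (simp add: flow_def)

lemma flow_act:
  "g \<in> carrier G \<Longrightarrow> a \<in> V \<Longrightarrow> b \<in> V \<Longrightarrow> x \<in> V \<Longrightarrow> y \<in> V \<Longrightarrow>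
    flow a b (\<rho> g x) (\<rho> g y) = flow a b x y"
  by (simp add: flow_def cnt_act)

lemma flow_lipschitz:
  assumes "a \<in> V" "b \<in> V" "x \<in> V" "y \<in> V" "x' \<in> V" "y' \<in> V"
  shows "\<bar>flow a b x y - flow a b x' y'\<bar> \<le> 2 * int (d x x') + 2 * int (d y y')"
proof -
  have "\<bar>flow a b x y - flow a b x' y\<bar> \<le> 2 * int (d x x')"
    unfolding flow_def using cnt_lipschitz1[OF assms(4,3,5,1,2)] cnt_lipschitz[OF assms(4,3,5,1,2)]
      by linarith
  moreover have "\<bar>flow a b x' y - flow a b x' y'\<bar> \<le> 2 * int (d y y')"
    unfolding flow_def using cnt_lipschitz1[OF assms(5,4,6,1,2)] cnt_lipschitz[OF assms(5,4,6,1,2)]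
      by linarith
  ultimately show ?thesis by linarith
qed

text \<open>Split the three geodesics at their median. Each leg of the tripod is traversed once in
  either direction, so the legs cancel. Six counts are split, each with error at most
  \<open>N\<close>, which gives the factor 6.\<close>

lemma flow_quasi_cocycle:
  assumes V: "a \<in> V" "b \<in> V" "x \<in> V" "y \<in> V" "z \<in> V"
  shows "\<bar>flow a b x y + flow a b y z - flow a b x z\<bar> \<le> 6 * (int (d a b) + 1)"
proof -
  obtain m where m: "m \<in> V" "btw x m y" "btw y m z" "btw x m z" using median[OF V(3-5)] by blast
  note s = btw_sym[OF V(3) m(1) V(4) m(2)] btw_sym[OF V(4) m(1) V(5) m(3)]
    btw_sym[OF V(3) m(1) V(5) m(4)]
  note c = cnt_concat[OF V(1,2) _ m(1)]
  define N where "N = int (d a b) + 1"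
  have "cnt a b x y \<le> cnt a b x m + cnt a b m y + N" "cnt a b x m + cnt a b m y \<le> cnt a b x y + N"
    "cnt a b y z \<le> cnt a b y m + cnt a b m z + N" "cnt a b y m + cnt a b m z \<le> cnt a b y z + N"
    "cnt a b x z \<le> cnt a b x m + cnt a b m z + N" "cnt a b x m + cnt a b m z \<le> cnt a b x z + N"
    "cnt a b y x \<le> cnt a b y m + cnt a b m x + N" "cnt a b y m + cnt a b m x \<le> cnt a b y x + N"
    "cnt a b z y \<le> cnt a b z m + cnt a b m y + N" "cnt a b z m + cnt a b m y \<le> cnt a b z y + N"
    "cnt a b z x \<le> cnt a b z m + cnt a b m x + N" "cnt a b z m + cnt a b m x \<le> cnt a b z x + N"
    using c[OF V(3,4) m(2)] c[OF V(4,5) m(3)] c[OF V(3,5) m(4)]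
      c[OF V(4,3) s(1)] c[OF V(5,4) s(2)] c[OF V(5,3) s(3)] unfolding abs_le_iff N_def by auto
  then show ?thesis unfolding flow_def abs_le_iff N_def[symmetric] by linarith
qed

lemma flow_le: 
  assumes "a \<in> V" "b \<in> V" "x \<in> V" "y \<in> V"
  shows "\<bar>flow a b x y\<bar> \<le> 2 * int (d x y)"
  using flow_lipschitz[OF assms assms(3,3)] flow_antisym[of a b x x] assms dist_sym by simp

lemma geod_slice:
  assumes V: "x \<in> V" "y \<in> V" and le: "i + n \<le> d x y"
  shows "sublist (geod T (pt x y i) (pt x y (i + n))) (geod T x y)"
proof -
  let ?s = "geod T x y" and ?t = "take (Suc n) (drop i (geod T x y))"
  note g = geod_props[OF V]
  have l: "length ?t = Suc n" using g le by simp
  then have ne: "?t \<noteq> []" by auto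
  have "?s = take i ?s @ ?t @ drop (Suc n) (drop i ?s)" by (metis append_take_drop_id)
  then have sl: "sublist ?t ?s" by (metis sublist_appendI)
  have "successively (adj T) ?t"
    using g(5) \<open>?s = _\<close> unfolding walk_def by (metis successively_append_iff)
  moreover have "set ?t \<subseteq> V" using g(6) by (meson set_take_subset set_drop_subset subset_trans)
  ultimately have w: "walk T ?t" using ne by (simp add: walk_def)
  have hd: "hd ?t = pt x y i" "last ?t = pt x y (i + n)"
    using ne l g(4) le unfolding pt_def by (auto simp: hd_conv_nth last_conv_nth)
  then have "geodesic T ?t" using w l pt_pt_dist(1)[OF V, of i "i + n"] le
    by (simp add: geodesic_def)
  then have "geod T (pt x y i) (pt x y (i + n)) = ?t" using geod_eq[of ?t] hd by simp
  then show ?thesis using sl by simp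
qed

text \<open>A translate that lies on the geodesic is determined by its initial position, so there
  are finitely many even if the orbit is infinite.\<close>

lemma card_orbit_segments:
  assumes s: "geodesic T s" and V: "x \<in> V" "y \<in> V"
  shows "int (card (seg_orbit G \<rho> s \<inter> segments_in T (seg_length s) x y)) = cnt (hd s) (last s) x y"
    and "finite (seg_orbit G \<rho> s \<inter> segments_in T (seg_length s) x y)"
proof -
  let ?a = "hd s" and ?b = "last s"
  let ?R = "seg_orbit G \<rho> s \<inter> segments_in T (seg_length s) x y"
  define f where "f i = geod T (pt x y i) (pt x y (i + d ?a ?b))" for i
  have sg: "s \<in> segments T (seg_length s)" using s by (simp add: segments_def)
  note sp = segmentsD[OF sg]
  have ptV: "pt x y i \<in> V" if "i \<le> d x y" for i using pt_dist[OF V that] by simp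
  have f: "geodesic T (f i)" "hd (f i) = pt x y i" "last (f i) = pt x y (i + d ?a ?b)"
    if "i + d ?a ?b \<le> d x y" for i
    using geod_props[OF ptV ptV] that unfolding f_def by auto
  have bij: "bij_betw f (occ ?a ?b x y) ?R"
    unfolding bij_betw_def
  proof
    show "inj_on f (occ ?a ?b x y)"
    proof (rule inj_onI)
      fix i j assume ij: "i \<in> occ ?a ?b x y" "j \<in> occ ?a ?b x y" "f i = f j"
      then have "pt x y i = pt x y j" using f(2)[of i] f(2)[of j] by (auto simp: occ_def)
      moreover have "i \<le> d x y" "j \<le> d x y" using ij by (auto simp: occ_def)
      ultimately show "i = j" using pt_dist(2)[OF V] by metis
    qed
    show "f ` occ ?a ?b x y = ?R"
    proof (intro equalityI subsetI)
      fix t assume "t \<in> f ` occ ?a ?b x y"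
      then obtain i where i: "t = f i" "i + d ?a ?b \<le> d x y" "eqv ?a ?b (pt x y i) (pt x y (i + d ?a ?b))"
        by (auto simp: occ_def)
      then obtain g where g: "g \<in> carrier G" "\<rho> g ?a = pt x y i" "\<rho> g ?b = pt x y (i + d ?a ?b)"
        unfolding eqv_def by blast
      have "map (\<rho> g) s = t" using map_geodesic_eq[OF g(1) s f(1)[OF i(2)]] f[OF i(2)] g i(1)
        by simp
      then have "t \<in> seg_orbit G \<rho> s" "t \<in> segments T (seg_length s)"
        using g map_segment[OF g(1) sg] unfolding seg_orbit_def orbit_def by auto
      then show "t \<in> ?R" using geod_slice[OF V i(2)] i(1) unfolding segments_in_def f_def by simp
    next
      fix t assume t: "t \<in> ?R"
      then obtain g where g: "g \<in> carrier G" "t = map (\<rho> g) s" unfolding seg_orbit_def orbit_def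
        by auto
      have "sublist t (geod T x y)" and tg: "t \<in> segments T (seg_length s)" using t
        by (auto simp: segments_in_def)
      then obtain ps ss where e: "geod T x y = ps @ t @ ss" unfolding sublist_def by blast
      note tp = segmentsD[OF tg]
      have tl: "length t = Suc (d ?a ?b)" using tp sp by (simp add: geodesic_def)
      then have ne: "t \<noteq> []" by auto
      have le: "length ps + d ?a ?b \<le> d x y" using geod_props(4)[OF V] e tl by simp
      have h: "pt x y (length ps) = hd t" "pt x y (length ps + d ?a ?b) = last t"
        unfolding pt_def e using ne tl by (auto simp: nth_append hd_conv_nth last_conv_nth)
      have sne: "s \<noteq> []" using sg by (auto simp: segments_def geodesic_def walk_def)
      then have "eqv ?a ?b (hd t) (last t)" using g eqv_act[OF g(1)] by (simp add: hd_map last_map)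
      then have "length ps \<in> occ ?a ?b x y" using le h by (simp add: occ_def)
      moreover have "f (length ps) = t" unfolding f_def h using geod_eq tp by blast
      ultimately show "t \<in> f ` occ ?a ?b x y" by blast
    qed
  qed
  then show "int (card ?R) = cnt ?a ?b x y" unfolding cnt_def by (simp add: bij_betw_same_card)
  show "finite ?R" using bij bij_betw_finite finite_occ by blast
qed

lemma median_qm_eq_flow:
  assumes s: "geodesic T s" and V: "v \<in> V" "g \<in> carrier G"
  shows "median_qm G T \<rho> v s g = flow (hd s) (last s) v (\<rho> g v)"
proof -
  let ?O = "seg_orbit G \<rho> s"
  let ?A = "segments_in T (seg_length s) v (\<rho> g v)"
    and ?B = "segments_in T (seg_length s) (\<rho> g v) v"
  have gv: "\<rho> g v \<in> V" using V by simp
  have fin: "finite (?O \<inter> ?A)" "finite (?O \<inter> ?B)" using card_orbit_segments(2)[OF s] V gv by auto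
  then have fin': "finite (?O \<inter> (?A \<union> ?B))" by (simp add: Int_Un_distrib)
  have "median_qm G T \<rho> v s g = (\<Sum>\<gamma>\<in>?O \<inter> (?A \<union> ?B). of_bool (\<gamma> \<in> ?A) - of_bool (\<gamma> \<in> ?B))"
    by (simp add: median_qm_def Let_def)
  also have "\<dots> = (\<Sum>\<gamma>\<in>?O \<inter> (?A \<union> ?B). of_bool (\<gamma> \<in> ?A)) - (\<Sum>\<gamma>\<in>?O \<inter> (?A \<union> ?B). of_bool (\<gamma> \<in> ?B))"
    by (rule sum_subtractf)
  also have "(\<Sum>\<gamma>\<in>?O \<inter> (?A \<union> ?B). of_bool (\<gamma> \<in> ?A)) = int (card (?O \<inter> (?A \<union> ?B) \<inter> {\<gamma>. \<gamma> \<in> ?A}))"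
    by (subst sum_of_bool_eq) (use fin' in auto)
  also have "(\<Sum>\<gamma>\<in>?O \<inter> (?A \<union> ?B). of_bool (\<gamma> \<in> ?B)) = int (card (?O \<inter> (?A \<union> ?B) \<inter> {\<gamma>. \<gamma> \<in> ?B}))"
    by (subst sum_of_bool_eq) (use fin' in auto)
  also have "?O \<inter> (?A \<union> ?B) \<inter> {\<gamma>. \<gamma> \<in> ?A} = ?O \<inter> ?A" by blast
  also have "?O \<inter> (?A \<union> ?B) \<inter> {\<gamma>. \<gamma> \<in> ?B} = ?O \<inter> ?B" by blast
  finally show ?thesis using card_orbit_segments(1)[OF s] V gv by (simp add: flow_def)
qed

end

section \<open>Words with prescribed gaps\<close>

text \<open>The piece of length \<open>n\<close> at position \<tau> provides every block with at
  least one mark, while powers of \<open>a\<close> alone carry none.\<close>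

locale word_construction = based_tree_action T G \<rho> p q
  for T :: "'v sgraph" and G :: "('g, 'm) monoid_scheme" (structure) and \<rho> :: "'g \<Rightarrow> 'v \<Rightarrow> 'v"
    and p q :: 'v +
  fixes a b :: 'g and n \<tau> :: nat
  assumes pos_a: "pos p q a" and pos_b: "pos p q b" and n_pos: "0 < n" and \<tau>: "\<tau> + n \<le> d p (\<rho> b p)"
    and b_off_axis: "\<And>i. \<not> eqv (pt p (\<rho> b p) \<tau>) (pt p (\<rho> b p) (\<tau> + n)) (ray (\<lambda>_. a) i) (ray (\<lambda>_. a) (i + n))"
      "\<And>i. \<not> eqv (pt p (\<rho> b p) \<tau>) (pt p (\<rho> b p) (\<tau> + n)) (ray (\<lambda>_. a) (i + n)) (ray (\<lambda>_. a) i)"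
begin

abbreviation axis :: "nat \<Rightarrow> 'v" where "axis \<equiv> ray (\<lambda>_. a)"

lemma pos_axis [simp]: "pos_seq (\<lambda>_. a)"
  using pos_a by (rule pos_seq_const)

definition bad :: "'v \<Rightarrow> 'v \<Rightarrow> bool" where
  "bad u w \<longleftrightarrow> \<not> (\<exists>i. eqv u w (axis i) (axis (i + n)) \<or> eqv u w (axis (i + n)) (axis i))"

lemma bad_sym: "bad u w \<longleftrightarrow> bad w u"
  unfolding bad_def using eqv_rev by blast

lemma bad_act:
  assumes "g \<in> carrier G" "u \<in> V" "w \<in> V"
  shows "bad (\<rho> g u) (\<rho> g w) \<longleftrightarrow> bad u w"
proof -
  have "eqv (\<rho> g u) (\<rho> g w) x y \<longleftrightarrow> eqv u w x y" for x y
    using eqv_trans[OF assms(2,3) eqv_act[OF assms(1)]]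
      eqv_trans[OF _ _ eqv_sym[OF assms(2,3) eqv_act[OF assms(1)]], of x y] assms by auto
  then show ?thesis by (simp add: bad_def)
qed

lemma not_bad_axis: "\<not> bad (axis i) (axis (i + n))"
  unfolding bad_def using eqv_refl ray_V[OF pos_axis] by blast

text \<open>The powers \<open>a [^] n\<close> around \<open>b\<close> are buffers. They move
  \<open>p\<close> by at least \<open>n\<close>, so in a product of blocks a window of length
  \<open>n\<close> that is not inside some \<open>bh\<close> meets no letter \<open>b\<close>. The
  marks of a block therefore do not depend on its neighbours.\<close>

definition e0 where "e0 = a [^] n \<otimes> b"
definition bh where "bh = e0 \<otimes> a [^] n"
definition blk where "blk k = bh \<otimes> a [^] (k :: nat)"

abbreviation \<alpha> where "\<alpha> \<equiv> len a"
abbreviation \<beta> where "\<beta> \<equiv> len bh"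

lemma carr [simp]: "a \<in> carrier G" "b \<in> carrier G" "e0 \<in> carrier G" "bh \<in> carrier G" "blk k \<in> carrier G"
  using pos_a pos_b by (auto simp: e0_def bh_def blk_def)

lemma pos_e0: "pos p q e0" "len e0 = n * \<alpha> + len b"
  unfolding e0_def using pos_mult[OF pos_pow(1)[OF pos_a n_pos] pos_b] pos_pow(2)[OF pos_a n_pos]
    by auto

lemma pos_bh: "pos p q bh" "\<beta> = len e0 + n * \<alpha>" "btw p (\<rho> e0 p) (\<rho> bh p)"
  unfolding bh_def using pos_mult[OF pos_e0(1) pos_pow(1)[OF pos_a n_pos]] pos_pow(2)[OF pos_a n_pos] by auto

lemma pos_blk:
  assumes "0 < k"
  shows "pos p q (blk k)" "len (blk k) = \<beta> + \<alpha> * k" "btw p (\<rho> bh p) (\<rho> (blk k) p)"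
  unfolding blk_def using pos_mult[OF pos_bh(1) pos_pow(1)[OF pos_a assms]] pos_pow(2)[OF pos_a assms]
  by (auto simp: mult.commute)

lemma \<alpha>_pos: "0 < \<alpha>"
  using pos_len[OF pos_a] by simp

definition C :: "nat \<Rightarrow> bool" where
  "C t \<longleftrightarrow> t + n \<le> \<beta> \<and> bad (pt p (\<rho> bh p) t) (pt p (\<rho> bh p) (t + n))"

lemma C_less: "C t \<Longrightarrow> t < \<beta>"
  using n_pos by (simp add: C_def)

lemma C_ex: "C (n * \<alpha> + \<tau>)"
proof -
  let ?g = "a [^] n"
  have g: "?g \<in> carrier G" by simp
  have lg: "d p (\<rho> ?g p) = n * \<alpha>" using pos_pow(2)[OF pos_a n_pos] .
  have e: "\<rho> e0 p = \<rho> ?g (\<rho> b p)" unfolding e0_def by (simp add: act_mult)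
  have bt: "btw p (\<rho> ?g p) (\<rho> e0 p)"
    unfolding e0_def by (rule pos_mult(3)[OF pos_pow(1)[OF pos_a n_pos] pos_b])
  have "pt p (\<rho> bh p) (n * \<alpha> + t) = \<rho> ?g (pt p (\<rho> b p) t)" if "t \<le> len b" for t
  proof -
    have "pt p (\<rho> bh p) (n * \<alpha> + t) = pt p (\<rho> e0 p) (n * \<alpha> + t)"
      by (rule btw_pt) (use pos_bh pos_e0 that in auto)
    also have "\<dots> = pt (\<rho> ?g p) (\<rho> e0 p) t"
      using btw_pt2[OF _ _ _ bt, of t] lg e that by simp
    also have "\<dots> = \<rho> ?g (pt p (\<rho> b p) t)" unfolding e by (rule act_pt) (use that in auto)
    finally show ?thesis .
  qed
  then have "pt p (\<rho> bh p) (n * \<alpha> + \<tau>) = \<rho> ?g (pt p (\<rho> b p) \<tau>)"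
    "pt p (\<rho> bh p) (n * \<alpha> + \<tau> + n) = \<rho> ?g (pt p (\<rho> b p) (\<tau> + n))"
    using \<tau> by (auto simp: add.assoc)
  moreover have "bad (pt p (\<rho> b p) \<tau>) (pt p (\<rho> b p) (\<tau> + n))" using b_off_axis unfolding bad_def
    by blast
  ultimately have "bad (pt p (\<rho> bh p) (n * \<alpha> + \<tau>)) (pt p (\<rho> bh p) (n * \<alpha> + \<tau> + n))"
    using bad_act[OF g] pt_dist(1)[of p "\<rho> b p" \<tau>] pt_dist(1)[of p "\<rho> b p" "\<tau> + n"] \<tau> by simp
  then show ?thesis using pos_bh pos_e0 \<tau> by (simp add: C_def)
qed

lemma \<beta>_pos: "0 < \<beta>"
  using C_less[OF C_ex] by simp

section \<open>The line of a word and its marks\<close>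

abbreviation word :: "(nat \<Rightarrow> nat) \<Rightarrow> nat \<Rightarrow> 'g" where "word \<nu> \<equiv> \<lambda>j. blk (\<nu> j)"
abbreviation line :: "(nat \<Rightarrow> nat) \<Rightarrow> nat \<Rightarrow> 'v" where "line \<nu> \<equiv> ray (word \<nu>)"

definition runs :: "(nat \<Rightarrow> nat) \<Rightarrow> bool" where "runs \<nu> \<longleftrightarrow> (\<forall>j. \<beta> \<le> \<nu> j)"

lemma runs_pos: "runs \<nu> \<Longrightarrow> 0 < \<nu> j"
  using \<beta>_pos unfolding runs_def by (meson less_le_trans)

lemma pos_word [simp]: "runs \<nu> \<Longrightarrow> pos_seq (word \<nu>)"
  unfolding pos_seq_def using pos_blk(1)[OF runs_pos] by blast

lemma line_in_bh:
  assumes "runs \<nu>" "t \<le> \<beta>"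
  shows "line \<nu> t = pt p (\<rho> bh p) t"
proof -
  note b = pos_blk[OF runs_pos[OF assms(1), of 0]]
  have "line \<nu> t = pt p (\<rho> (prd (word \<nu>) 1) p) t"
    by (rule ray_eq) (use assms b in \<open>auto simp: off_def\<close>)
  also have "prd (word \<nu>) 1 = blk (\<nu> 0)" by simp
  also have "pt p (\<rho> (blk (\<nu> 0)) p) t = pt p (\<rho> bh p) t"
    by (rule btw_pt) (use b assms in auto)
  finally show ?thesis .
qed

text \<open>Between two letters \<open>b\<close> the line follows a translate of the axis through a
  buffer, a run, and the first buffer of the next block; this accounts for
  \<open>2 * n + \<nu> 0\<close>.\<close>

lemma line_in_axis:
  assumes "runs \<nu>" "t \<le> (2 * n + \<nu> 0) * \<alpha>"
  shows "line \<nu> (len e0 + t) = \<rho> e0 (axis t)"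
proof -
  define k where "k = n + \<nu> 0 + n"
  have k: "0 < k" using n_pos by (simp add: k_def)
  have t: "t \<le> k * \<alpha>" using assms(2) by (simp add: k_def algebra_simps)
  \<comment> \<open>What remains of the second block once its first buffer is absorbed into the
    power of \<open>a\<close>.\<close>
  define c where "c = b \<otimes> a [^] n \<otimes> a [^] \<nu> 1"
  have p0: "0 < \<nu> 0" "0 < \<nu> 1" using runs_pos assms(1) by auto
  have pc: "pos p q c" unfolding c_def by (intro pos_mult pos_b pos_pow pos_a n_pos p0)
  note pw = pos_mult[OF pos_e0(1) pos_pow(1)[OF pos_a k]]
  have two: "prd (word \<nu>) 2 = (e0 \<otimes> a [^] k) \<otimes> c"
    by (simp add: numeral_2_eq_2 c_def k_def blk_def bh_def e0_def m_assoc flip: nat_pow_mult)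
  note pw2 = pos_mult[OF pw(1) pc, folded two]
  have lk: "len (a [^] k) = k * \<alpha>" using pos_pow(2)[OF pos_a k] .
  have le: "len e0 + t \<le> d p (\<rho> (e0 \<otimes> a [^] k) p)" using pw(2) lk t by simp
  have "line \<nu> (len e0 + t) = pt p (\<rho> (prd (word \<nu>) 2) p) (len e0 + t)"
    by (rule ray_eq) (use assms pw2(2) len_prd[of "word \<nu>" 2] le in auto)
  also have "\<dots> = pt p (\<rho> (e0 \<otimes> a [^] k) p) (len e0 + t)"
    by (rule btw_pt) (use pw2(3) pc le in \<open>auto simp: two\<close>)
  also have "\<dots> = pt (\<rho> e0 p) (\<rho> (e0 \<otimes> a [^] k) p) t"
    by (rule btw_pt2) (use pw(3) lk t in \<open>auto simp: act_mult\<close>)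
  also have "\<dots> = \<rho> e0 (pt p (\<rho> (a [^] k) p) t)"
    using act_pt[of e0 p "\<rho> (a [^] k) p" t] lk t by (simp add: act_mult)
  also have "pt p (\<rho> (a [^] k) p) t = axis t"
    using ray_eq[OF pos_axis, of t k] len_prd[OF pos_axis, of k] lk t by (simp add: prd_const)
  finally show ?thesis .
qed

definition marked :: "(nat \<Rightarrow> nat) \<Rightarrow> nat \<Rightarrow> bool" where
  "marked \<nu> i \<longleftrightarrow> bad (line \<nu> i) (line \<nu> (i + n))"

text \<open>A window inside \<open>bh\<close> is the one that \<open>C\<close> tests. Any other
  starts beyond \<open>e0\<close>, because \<open>n \<le> n * \<alpha>\<close>, and ends before the
  next \<open>b\<close>, so it lies on a translate of the axis.\<close>

lemma marked_first_block:
  assumes "runs \<nu>" "t < \<beta> + \<alpha> * \<nu> 0"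
  shows "marked \<nu> t \<longleftrightarrow> C t"
proof (cases "t + n \<le> \<beta>")
  case True
  then show ?thesis using line_in_bh[OF assms(1)] by (simp add: marked_def C_def)
next
  case False
  have "n \<le> n * \<alpha>" using \<alpha>_pos by simp
  then have le: "len e0 \<le> t" using False pos_bh(2) by linarith
  define u where "u = t - len e0"
  have t: "t = len e0 + u" "t + n = len e0 + (u + n)" using le by (auto simp: u_def)
  have "u + n \<le> n * \<alpha> + \<alpha> * \<nu> 0 + n * \<alpha>" using assms(2) t pos_bh(2) \<open>n \<le> n * \<alpha>\<close> by linarith
  then have u: "u + n \<le> (2 * n + \<nu> 0) * \<alpha>" by (simp add: algebra_simps)
  have "\<not> marked \<nu> t"
    unfolding marked_def t
    using line_in_axis[OF assms(1), of u] line_in_axis[OF assms(1), of "u + n"] u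
      bad_act[of e0 "axis u" "axis (u + n)"] not_bad_axis[of u] by (simp add: add.assoc)
  then show ?thesis using False by (simp add: C_def)
qed

lemma marked_shift:
  assumes "runs \<nu>"
  shows "marked \<nu> (off (word \<nu>) j + t) \<longleftrightarrow> marked (\<lambda>i. \<nu> (j + i)) t"
proof -
  have "runs (\<lambda>i. \<nu> (j + i))" using assms by (simp add: runs_def)
  then show ?thesis
    using ray_shift[OF pos_word[OF assms], of j t] ray_shift[OF pos_word[OF assms], of j "t + n"] assms
      bad_act[of "prd (word \<nu>) j" "line (\<lambda>i. \<nu> (j + i)) t" "line (\<lambda>i. \<nu> (j + i)) (t + n)"]
    by (simp add: marked_def add.assoc)
qed

lemma marked_block:
  assumes "runs \<nu>" "t < \<beta> + \<alpha> * \<nu> j"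
  shows "marked \<nu> (off (word \<nu>) j + t) \<longleftrightarrow> C t"
  using marked_first_block[of "\<lambda>i. \<nu> (j + i)" t] marked_shift[OF assms(1)] assms
  by (simp add: runs_def)

lemma off_word_Suc:
  "runs \<nu> \<Longrightarrow> off (word \<nu>) (Suc j) = off (word \<nu>) j + (\<beta> + \<alpha> * \<nu> j)"
  using pos_blk(2)[OF runs_pos[of \<nu> j]] by (simp add: off_Suc)

lemma block_line:
  assumes "runs \<nu>"
  shows "block_line C \<alpha> \<beta> (marked \<nu>) (off (word \<nu>)) \<nu>"
proof (rule block_line.intro)
  fix j t
  show "off (word \<nu>) 0 = 0" by (rule off_0)
  show "off (word \<nu>) (Suc j) = off (word \<nu>) j + (\<beta> + \<alpha> * \<nu> j)"
    by (rule off_word_Suc[OF assms])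
  show "\<exists>t. C t" using C_ex by blast
  show "0 < \<alpha>" by (rule \<alpha>_pos)
  show "\<beta> \<le> \<nu> j" using assms by (simp add: runs_def)
  show "t < \<beta>" if "C t" using that by (rule C_less)
  show "marked \<nu> (off (word \<nu>) j + t) = C t" if "t < \<beta> + \<alpha> * \<nu> j"
    using marked_block[OF assms that] .
qed

text \<open>The segment spelled by the first two blocks of a word and the initial part of the third.\<close>

definition size :: "(nat \<Rightarrow> nat) \<Rightarrow> nat" where "size \<nu> = off (word \<nu>) 2 + \<beta>"
definition tip :: "(nat \<Rightarrow> nat) \<Rightarrow> 'v" where "tip \<nu> = line \<nu> (size \<nu>)"

lemma tip_V [simp]: "runs \<nu> \<Longrightarrow> tip \<nu> \<in> V"
  by (simp add: tip_def)

lemma dist_tip: "runs \<nu> \<Longrightarrow> d p (tip \<nu>) = size \<nu>"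
  unfolding tip_def using ray_pt(2)[of "word \<nu>" 0 "size \<nu>" 0] by simp

lemma pt_tip: "runs \<nu> \<Longrightarrow> j \<le> size \<nu> \<Longrightarrow> pt p (tip \<nu>) j = line \<nu> j"
  unfolding tip_def using ray_pt(1)[of "word \<nu>" 0 "size \<nu>" j] by simp

text \<open>The third block is included up to \<beta> so that the window at its first mark, where
  the second long gap ends, fits into the segment.\<close>

lemma t0_le:
  assumes "runs \<nu>"
  shows "off (word \<nu>) 2 + block_line.t0 C \<le> size \<nu> - n" "n \<le> size \<nu>"
proof -
  interpret block_line C \<alpha> \<beta> "marked \<nu>" "off (word \<nu>)" \<nu> by (rule block_line[OF assms])
  have "t0 + n \<le> \<beta>" using t0(1) by (simp add: C_def)
  then show "off (word \<nu>) 2 + t0 \<le> size \<nu> - n" "n \<le> size \<nu>" by (auto simp: size_def)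
qed

text \<open>Being \<open>bad\<close> is invariant under the group, so a translate of the spelled
  segment carries its marks along, and the gaps between them reveal the exponents.\<close>

lemma occurrence:
  assumes r: "runs \<nu>" "runs \<nu>'" and e: "eqv p (tip \<nu>) (line \<nu>' u) (line \<nu>' (u + size \<nu>))"
  shows "\<exists>j. \<nu>' j = \<nu> 0 \<and> \<nu>' (Suc j) = \<nu> 1"
proof -
  interpret two_block_lines C \<alpha> \<beta> "marked \<nu>" "off (word \<nu>)" \<nu> "marked \<nu>'" "off (word \<nu>')" \<nu>'
    using block_line[OF r(1)] block_line[OF r(2)] by (rule two_block_lines.intro)
  obtain g where g: "g \<in> carrier G" "\<rho> g p = line \<nu>' u" "\<rho> g (tip \<nu>) = line \<nu>' (u + size \<nu>)"
    using e unfolding eqv_def by blast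
  have eq: "line \<nu>' (u + j) = \<rho> g (line \<nu> j)" if "j \<le> size \<nu>" for j
    using act_pt[OF g(1), of p "tip \<nu>" j] pt_tip[OF r(1) that] g(2,3) dist_tip[OF r(1)] that r
      ray_pt(1)[OF pos_word[OF r(2)], of u "u + size \<nu>" j] by simp
  show ?thesis
  proof (rule occurs[of u])
    fix j assume "j \<le> off (word \<nu>) 2 + A.t0"
    then have "j + n \<le> size \<nu>" using t0_le[OF r(1)] by linarith
    then show "marked \<nu>' (u + j) = marked \<nu> j"
      using eq[of j] eq[of "j + n"] bad_act[OF g(1)] r by (simp add: marked_def add.assoc)
  qed
qed

lemma reversed_occurrence:
  assumes r: "runs \<nu>" "runs \<nu>'" and e: "eqv p (tip \<nu>) (line \<nu>' (u + size \<nu>)) (line \<nu>' u)"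
  shows "\<exists>j. \<nu>' j = \<nu> 1 \<and> \<nu>' (Suc j) = \<nu> 0"
proof -
  interpret two_block_lines C \<alpha> \<beta> "marked \<nu>" "off (word \<nu>)" \<nu> "marked \<nu>'" "off (word \<nu>')" \<nu>'
    using block_line[OF r(1)] block_line[OF r(2)] by (rule two_block_lines.intro)
  obtain g where g: "g \<in> carrier G" "\<rho> g p = line \<nu>' (u + size \<nu>)" "\<rho> g (tip \<nu>) = line \<nu>' u"
    using e unfolding eqv_def by blast
  have eq: "line \<nu>' (u + (size \<nu> - j)) = \<rho> g (line \<nu> j)" if "j \<le> size \<nu>" for j
  proof -
    have dd: "d (line \<nu>' u) (line \<nu>' (u + size \<nu>)) = size \<nu>"
      using ray_pt(2)[OF pos_word[OF r(2)], of u "u + size \<nu>" 0] by simp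
    have "\<rho> g (line \<nu> j) = pt (line \<nu>' (u + size \<nu>)) (line \<nu>' u) j"
      using act_pt[OF g(1), of p "tip \<nu>" j] pt_tip[OF r(1) that] g(2,3) dist_tip[OF r(1)] that r
        by simp
    also have "\<dots> = pt (line \<nu>' u) (line \<nu>' (u + size \<nu>)) (size \<nu> - j)"
      using pt_rev[of "line \<nu>' u" "line \<nu>' (u + size \<nu>)" "size \<nu> - j"] dd that r by simp
    also have "\<dots> = line \<nu>' (u + (size \<nu> - j))"
      using ray_pt(1)[OF pos_word[OF r(2)], of u "u + size \<nu>" "size \<nu> - j"] by simp
    finally show ?thesis ..
  qed
  show ?thesis
  \<comment> \<open>Marks are indexed by the initial vertex of their window. Reversal turns the
    window from \<open>j\<close> to \<open>j + n\<close> into one that starts at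
    \<open>size \<nu> - n - j\<close>, hence the shift by \<open>n\<close>.\<close>
  proof (rule occurs_reversed[of "size \<nu> - n" u])
    show "off (word \<nu>) 2 + A.t0 \<le> size \<nu> - n" by (rule t0_le[OF r(1)])
    fix j assume "j \<le> size \<nu> - n"
    then have j: "j + n \<le> size \<nu>" using t0_le[OF r(1)] by linarith
    then have "u + (size \<nu> - n - j) = u + (size \<nu> - (j + n))"
      "u + (size \<nu> - n - j) + n = u + (size \<nu> - j)" by auto
    then show "marked \<nu>' (u + (size \<nu> - n - j)) = marked \<nu> j"
      using eq[of j] eq[of "j + n"] bad_act[OF g(1)] r j bad_sym by (simp add: marked_def)
  qed
qed

lemma occ_line:
  assumes r: "runs \<nu>" "runs \<nu>'"
  shows "occ p (tip \<nu>) p (line \<nu>' N) =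
      {i. i + size \<nu> \<le> N \<and> eqv p (tip \<nu>) (line \<nu>' i) (line \<nu>' (i + size \<nu>))}"
    "occ (tip \<nu>) p p (line \<nu>' N) =
      {i. i + size \<nu> \<le> N \<and> eqv p (tip \<nu>) (line \<nu>' (i + size \<nu>)) (line \<nu>' i)}"
proof -
  have dN: "d p (line \<nu>' N) = N" using ray_pt(2)[OF pos_word[OF r(2)], of 0 N 0] r by simp
  have pN: "pt p (line \<nu>' N) i = line \<nu>' i" if "i \<le> N" for i
    using ray_pt(1)[OF pos_word[OF r(2)], of 0 N i] that r by simp
  have ds: "d (tip \<nu>) p = size \<nu>" using dist_tip[OF r(1)] dist_sym r(1) by simp
  show "occ p (tip \<nu>) p (line \<nu>' N) =
      {i. i + size \<nu> \<le> N \<and> eqv p (tip \<nu>) (line \<nu>' i) (line \<nu>' (i + size \<nu>))}"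
    unfolding occ_def dist_tip[OF r(1)] dN using pN by auto
  show "occ (tip \<nu>) p p (line \<nu>' N) =
      {i. i + size \<nu> \<le> N \<and> eqv p (tip \<nu>) (line \<nu>' (i + size \<nu>)) (line \<nu>' i)}"
    unfolding occ_def ds dN using pN eqv_rev by auto
qed

lemma flow_line:
  assumes r: "runs \<nu>" "runs \<nu>'"
  shows "flow p (tip \<nu>) p (line \<nu>' N) =
    int (card (occ p (tip \<nu>) p (line \<nu>' N))) - int (card (occ (tip \<nu>) p p (line \<nu>' N)))"
  unfolding flow_def using cnt_rev[of p "tip \<nu>" p "line \<nu>' N"] r by (simp add: cnt_def)

text \<open>The two words have the same letters, but the cyclic order of their runs of \<open>a\<close> differs.\<close>

definition run :: "bool \<Rightarrow> nat \<Rightarrow> nat \<Rightarrow> nat" where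
  "run f k j = \<beta> + 3 * k + (if f then (2 * j) mod 3 else j mod 3)"

definition wd :: "bool \<Rightarrow> nat \<Rightarrow> 'g" where "wd f k = prd (word (run f k)) 3"

lemma runs_run [simp]: "runs (run f k)"
  by (simp add: runs_def run_def)

lemma wd_eq:
  obtains x y z where "x \<in> carrier G" "y \<in> carrier G" "z \<in> carrier G"
    "wd False k = x \<otimes> y \<otimes> z" "wd True k = x \<otimes> z \<otimes> y"
proof -
  have "run False k 0 = \<beta> + 3 * k" "run False k 1 = \<beta> + 3 * k + 1" "run False k 2 = \<beta> + 3 * k + 2"
    "run True k 0 = \<beta> + 3 * k" "run True k 1 = \<beta> + 3 * k + 2" "run True k 2 = \<beta> + 3 * k + 1"
    by (simp_all add: run_def)
  moreover have "prd h 3 = h 0 \<otimes> h 1 \<otimes> h 2" if "h 0 \<in> carrier G" for h :: "nat \<Rightarrow> 'g"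
    using that by (simp add: numeral_3_eq_3 numeral_2_eq_2)
  ultimately have "wd False k = blk (\<beta> + 3 * k) \<otimes> blk (\<beta> + 3 * k + 1) \<otimes> blk (\<beta> + 3 * k + 2)"
    "wd True k = blk (\<beta> + 3 * k) \<otimes> blk (\<beta> + 3 * k + 2) \<otimes> blk (\<beta> + 3 * k + 1)"
    unfolding wd_def by (simp_all only: carr)
  then show ?thesis using that carr by blast
qed

lemma wd_carrier [simp]: "wd f k \<in> carrier G"
  by (simp add: wd_def)

lemma wd_pow: "\<rho> (wd f k [^] (m :: nat)) p = line (run f k) (off (word (run f k)) (3 * m))"
proof -
  have "run f k (i + 3) = run f k i" for i
    by (simp add: run_def) presburger
  then have "prd (word (run f k)) (3 * m) = wd f k [^] m"
    unfolding wd_def by (intro prd_periodic) auto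
  then show ?thesis using ray_off[of "word (run f k)" "3 * m"] by simp
qed

lemma residue_unique:
  fixes i x k y :: nat
  assumes "3 * i + x = 3 * k + y" "x < 3" "y < 3"
  shows "i = k \<and> x = y"
proof -
  have "(3 * i + x) mod 3 = (3 * k + y) mod 3" using assms(1) by (rule arg_cong)
  then have "x = y" using assms(2,3) by simp
  then show ?thesis using assms(1) by simp
qed

text \<open>An exponent determines the index and the residue mod 3. The residues follow each other
  as 0, 1, 2, or as 0, 2, 1 if \<open>f\<close> holds; only in the first cyclic order does 1 come
  after 0.\<close>

lemma run_pair:
  assumes "run f i j = run False k 0" "run f i (Suc j) = run False k 1"
  shows "i = k \<and> \<not> f"
proof -
  define x :: "nat \<Rightarrow> nat" where "x j = (if f then (2 * j) mod 3 else j mod 3)" for j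
  have "3 * i + x j = 3 * k + 0" "3 * i + x (Suc j) = 3 * k + 1"
    using assms by (auto simp: run_def x_def)
  moreover have "x j < 3" for j by (simp add: x_def)
  ultimately have "i = k" "x j = 0" "x (Suc j) = 1"
    using residue_unique[of i "x j" k 0] residue_unique[of i "x (Suc j)" k 1] by auto
  moreover have "\<not> ((2 * j) mod 3 = 0 \<and> (2 * Suc j) mod 3 = 1)" by presburger
  ultimately show ?thesis unfolding x_def by auto
qed

text \<open>Only in the cyclic order 0, 2, 1 does 0 come after 1.\<close>

lemma run_pair_reversed:
  assumes "run f i j = run False k 1" "run f i (Suc j) = run False k 0"
  shows "i = k \<and> f"
proof -
  define x :: "nat \<Rightarrow> nat" where "x j = (if f then (2 * j) mod 3 else j mod 3)" for j
  have "3 * i + x j = 3 * k + 1" "3 * i + x (Suc j) = 3 * k + 0"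
    using assms by (auto simp: run_def x_def)
  moreover have "x j < 3" for j by (simp add: x_def)
  ultimately have "i = k" "x j = 1" "x (Suc j) = 0"
    using residue_unique[of i "x j" k 1] residue_unique[of i "x (Suc j)" k 0] by auto
  moreover have "\<not> (j mod 3 = 1 \<and> Suc j mod 3 = 0)" by presburger
  ultimately show ?thesis unfolding x_def by (auto split: if_splits)
qed

lemma no_occ:
  assumes "\<not> (i = k \<and> \<not> f)"
  shows "occ p (tip (run False k)) p (line (run f i) N) = {}"
proof -
  have "\<not> eqv p (tip (run False k)) (line (run f i) u) (line (run f i) (u + size (run False k)))" for u
    using occurrence[OF runs_run runs_run, of False k f i u] run_pair[of f i _ k] assms by blast
  then show ?thesis unfolding occ_line(1)[OF runs_run runs_run] by simp
qed

lemma no_reversed_occ: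
  assumes "\<not> (i = k \<and> f)"
  shows "occ (tip (run False k)) p p (line (run f i) N) = {}"
proof -
  have "\<not> eqv p (tip (run False k)) (line (run f i) (u + size (run False k))) (line (run f i) u)" for u
    using reversed_occurrence[OF runs_run runs_run, of False k f i u] run_pair_reversed[of f i _ k] assms
    by blast
  then show ?thesis unfolding occ_line(2)[OF runs_run runs_run] by simp
qed

lemma flow_other_word:
  "i \<noteq> k \<Longrightarrow> flow p (tip (run False k)) p (\<rho> (wd f i [^] (m :: nat)) p) = 0"
  unfolding wd_pow flow_line[OF runs_run runs_run] by (simp add: no_occ no_reversed_occ)

lemma flow_swapped_word: "flow p (tip (run False k)) p (\<rho> (wd True k [^] (m :: nat)) p) \<le> 0"
  unfolding wd_pow flow_line[OF runs_run runs_run] by (simp add: no_occ)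

lemma flow_own_word: "int m \<le> flow p (tip (run False k)) p (\<rho> (wd False k [^] m) p)"
proof -
  let ?\<nu> = "run False k"
  let ?D = "off (word ?\<nu>)"
  have inj: "inj_on (\<lambda>u. ?D (3 * u)) {..<m}"
    by (rule inj_onI) (use strict_mono_eq[OF off_strict_mono[OF pos_word[OF runs_run[of False k]]]] in simp)
  have "?D (3 * u) \<in> occ p (tip ?\<nu>) p (line ?\<nu> (?D (3 * m)))" if u: "u < m" for u
  proof -
    have sh: "word (\<lambda>i. ?\<nu> (3 * u + i)) = word ?\<nu>" by (simp add: run_def fun_eq_iff)
    \<comment> \<open>The copy that starts with block \<open>3 * u\<close> ends inside block
      \<open>3 * u + 2\<close>, so each of the \<open>m\<close> periods contains one.\<close>
    have "?D (3 * u + 2) + \<beta> = ?D (3 * u) + size ?\<nu>"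
      using off_add[of "word ?\<nu>" "3 * u" 2] unfolding sh size_def by simp
    moreover have "?D (3 * u + 2) + \<beta> \<le> ?D (Suc (3 * u + 2))"
      using off_word_Suc[OF runs_run, of False k "3 * u + 2"] by simp
    moreover have "?D (Suc (3 * u + 2)) \<le> ?D (3 * m)"
      using strict_mono_less_eq[OF off_strict_mono[OF pos_word[OF runs_run[of False k]]]] u by simp
    ultimately have le: "?D (3 * u) + size ?\<nu> \<le> ?D (3 * m)" by linarith
    have "line ?\<nu> (?D (3 * u) + t) = \<rho> (prd (word ?\<nu>) (3 * u)) (line ?\<nu> t)" for t
      using ray_shift[OF pos_word[OF runs_run], of False k "3 * u" t] unfolding sh .
    from this[of 0] this[of "size ?\<nu>"]
    have "eqv p (tip ?\<nu>) (line ?\<nu> (?D (3 * u))) (line ?\<nu> (?D (3 * u) + size ?\<nu>))"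
      using eqv_act[of "prd (word ?\<nu>) (3 * u)" p "tip ?\<nu>"] by (simp add: tip_def)
    then show ?thesis using le unfolding occ_line(1)[OF runs_run runs_run] by simp
  qed
  then have "card ((\<lambda>u. ?D (3 * u)) ` {..<m}) \<le> card (occ p (tip ?\<nu>) p (line ?\<nu> (?D (3 * m))))"
    by (intro card_mono) auto
  then show ?thesis
    unfolding wd_pow flow_line[OF runs_run runs_run] using card_image[OF inj]
      by (simp add: no_reversed_occ)
qed

end

context minimal_tree_action
begin

text \<open>\<open>a\<close> lets a translate of the edge follow the edge itself. By
  \<open>locally_transitive_of_periodic\<close> some segment is off the axis of \<open>a\<close>.
  The element \<open>b\<close> leads from the edge through a translate of this segment to the
  translated edge; \<open>g\<close> and \<open>h\<close> provide the two transitions.\<close>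

lemma ex_word_construction:
  assumes no_end: "\<not> fixes_end"
    and not_trans: "\<not> locally_transitive"
  shows "\<exists>p q a b n \<tau>. word_construction T G \<rho> p q a b n \<tau>"
proof -
  obtain p where p: "p \<in> V" using tree by (auto simp: is_tree_def)
  obtain q where pq: "adj T p q" using ex_third_neighbour[OF p] by blast
  interpret based_tree_action T G \<rho> p q by unfold_locales (rule pq)
  have one: "d p q = 1" using dist_adj pq by blast
  have ne: "p \<noteq> q" using adjD(3) pq by blast
  obtain a where a: "a \<in> carrier G" "d p q + d q (\<rho> a p) + d p q = d p (\<rho> a q)"
    using foll_all[OF no_end p pqV(2) p pqV(2) ne ne] unfolding foll_def by blast
  have "pos p q a" unfolding pos_def btw_def
    using a dist_triangle[of p "\<rho> a p" "\<rho> a q"] dist_triangle[of p q "\<rho> a p"] by auto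
  note pa = this pos_seq_const[OF this]
  let ?l = "ray (\<lambda>_. a)"
  have "\<exists>x\<in>V. \<exists>y\<in>V. \<forall>i. \<not> eqv x y (?l i) (?l (i + d x y)) \<and> \<not> eqv x y (?l (i + d x y)) (?l i)"
  proof (rule ccontr)
    assume neg: "\<not> ?thesis"
    have "\<exists>i. eqv x y (?l i) (?l (i + d x y)) \<or> eqv x y (?l (i + d x y)) (?l i)"
      if "x \<in> V" "y \<in> V" for x y using neg that by blast
    moreover have "0 < len a" using pos_len[OF pa(1)] by simp
    ultimately have locally_transitive
      using locally_transitive_of_periodic[OF a(1), of ?l "len a"] axis_shift[OF pa(1)] ray_V[OF pa(2)] by blast
    then show False using not_trans by contradiction
  qed
  then obtain x y where xy: "x \<in> V" "y \<in> V"
    and off: "\<And>i. \<not> eqv x y (?l i) (?l (i + d x y)) \<and> \<not> eqv x y (?l (i + d x y)) (?l i)"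
    by blast
  \<comment> \<open>\<open>x = y\<close> is possible; one more edge makes the segment nondegenerate,
    as gluing along it requires.\<close>
  define n where "n = Suc (d x y)"
  obtain z where z: "z \<in> V" "d y z = 1" "btw x y z" using ex_extension[OF xy(2,1,1)] by blast
  have dn: "d x z = n" using z by (simp add: btw_def n_def)
  have xz: "x \<noteq> z" using dn xy unfolding n_def by auto
  \<comment> \<open>A segment on the axis has its initial part on the axis as well. Read backwards
    from \<open>i + n\<close>, that part ends at \<open>i + 1\<close>.\<close>
  have off': "\<not> eqv x z (?l i) (?l (i + n)) \<and> \<not> eqv x z (?l (i + n)) (?l i)" for i
  proof -
    have pz: "pt x z 0 = x" "pt x z (d x y) = y" using pt_unique[OF xy(1) z(1) xy(2) z(3)] xy z
      by auto
    have "eqv x y u (pt u w (d x y))" if "eqv x z u w" "u \<in> V" "w \<in> V" for u w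
      using eqv_pt[OF xy(1) z(1) that(1), of 0 "d x y"] dn that pz by (simp add: n_def)
    moreover have "pt (?l i) (?l (i + n)) (d x y) = ?l (i + d x y)"
      using ray_pt(1)[OF pa(2), of i "i + n" "d x y"] by (simp add: n_def)
    moreover have "pt (?l (i + n)) (?l i) (d x y) = ?l (i + 1)"
      using pt_rev[of "?l i" "?l (i + n)" 1] ray_pt[OF pa(2), of i "i + n" 1] pa(2)
        by (simp add: n_def)
    moreover have "i + n = (i + 1) + d x y" by (simp add: n_def)
    ultimately show ?thesis using off[of i] off[of "i + 1"] pa(2) ray_V by metis
  qed
  obtain g where g: "g \<in> carrier G" "d p q + d q (\<rho> g x) + d x z = d p (\<rho> g z)"
    using foll_all[OF no_end p pqV(2) xy(1) z(1) ne xz] unfolding foll_def by blast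
  obtain h where h: "h \<in> carrier G" "d x z + d z (\<rho> h p) + d p q = d x (\<rho> h q)"
    using foll_all[OF no_end xy(1) z(1) p pqV(2) xz ne] unfolding foll_def by blast
  define b where "b = g \<otimes> h"
  have bc: "b \<in> carrier G" using g h by (simp add: b_def)
  let ?x = "\<rho> g x" and ?z = "\<rho> g z"
  have bp: "\<rho> b p = \<rho> g (\<rho> h p)" "\<rho> b q = \<rho> g (\<rho> h q)" using g h by (auto simp: b_def act_mult)
  have V': "?x \<in> V" "?z \<in> V" "\<rho> b p \<in> V" "\<rho> b q \<in> V" using g bc xy z by auto
  have dd: "d ?x ?z = n" "d ?z (\<rho> b p) = d z (\<rho> h p)" "d (\<rho> b p) (\<rho> b q) = 1" "d ?x (\<rho> b q) = d x (\<rho> h q)"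
    using g h xy z dn bc one by (auto simp: bp)
  have 1: "btw p ?x ?z" "btw p q ?x"
    using g(2) dd dn dist_triangle[OF p V'(1,2)] dist_triangle[OF p pqV(2) V'(1)]
      by (auto simp: btw_def)
  have 2: "btw ?x ?z (\<rho> b q)" "btw ?z (\<rho> b p) (\<rho> b q)" "btw ?x ?z (\<rho> b p)"
    using h(2) dd dn one dist_triangle[OF V'(1,2,3)] dist_triangle[OF V'(1,2,4)]
      dist_triangle[OF V'(2,3,4)] dist_triangle[OF V'(1,3,4)] by (auto simp: btw_def)
  have xz': "?x \<noteq> ?z" using act_inj[OF g(1) xy(1) z(1)] xz by simp
  note 3 = btw_concat[OF p V'(1,2,4) xz' 1(1) 2(1)] btw_concat[OF p V'(1,2,3) xz' 1(1) 2(3)]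
  have "btw p q (\<rho> b p)" using btw_trans2(1)[OF p pqV(2) V'(1,3) 3(4) 1(2)] .
  moreover have "btw p (\<rho> b p) (\<rho> b q)"
    using btw_trans(1)[OF p V'(2) V'(3,4) 3(1) 2(2)] .
  ultimately have pb: "pos p q b" using bc by (simp add: pos_def)
  define \<tau> where "\<tau> = d p ?x"
  have px: "pt p (\<rho> b p) \<tau> = ?x" unfolding \<tau>_def using pt_unique[OF p V'(3,1) 3(4)] .
  have pz: "pt p (\<rho> b p) (\<tau> + n) = ?z" "\<tau> + n \<le> d p (\<rho> b p)"
    using pt_unique[OF p V'(3,2) 3(3)] 1(1) dd 3(3) by (auto simp: \<tau>_def btw_def)
  have tr: "\<not> eqv ?x ?z u w" if "\<not> eqv x z u w" for u w
    using that eqv_trans[OF xy(1) z(1) eqv_act[OF g(1)]] by blast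
  have "word_construction T G \<rho> p q a b n \<tau>"
    by unfold_locales (use pa pb pz off' tr px in \<open>auto simp: n_def\<close>)
  then show ?thesis by blast
qed

end

section \<open>Second bounded cohomology\<close>

context group
begin

abbreviation Z where "Z \<equiv> bounded_cocycles2 G"
abbreviation B where "B \<equiv> bounded_coboundaries2 G"
abbreviation H where "H \<equiv> H2b G"

definition quasi :: "('a \<Rightarrow> real) \<Rightarrow> bool" where
  "quasi f \<longleftrightarrow> (\<exists>K. \<forall>g\<in>carrier G. \<forall>h\<in>carrier G. \<bar>f h - f (g \<otimes> h) + f g\<bar> \<le> K)"

definition trivial_qm :: "('a \<Rightarrow> real) \<Rightarrow> bool" where
  "trivial_qm f \<longleftrightarrow> (\<exists>\<chi> K. (\<forall>g\<in>carrier G. \<forall>h\<in>carrier G. \<chi> (g \<otimes> h) = \<chi> g + \<chi> h) \<and>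
     (\<forall>g\<in>carrier G. \<bar>f g - \<chi> g\<bar> \<le> K))"

definition cls :: "('a \<Rightarrow> real) \<Rightarrow> ('a \<times> 'a \<Rightarrow> real) set" where
  "cls f = H2b_class G (delta1 G f)"

lemma cls_cong:
  assumes "\<And>g. g \<in> carrier G \<Longrightarrow> f g = h g" shows "cls f = cls h"
proof -
  have "delta1 G f = delta1 G h" using assms by (auto simp: delta1_def fun_eq_iff)
  then show ?thesis by (simp add: cls_def)
qed

lemma delta1_eq: "g \<in> carrier G \<Longrightarrow> h \<in> carrier G \<Longrightarrow> delta1 G f (g, h) = f h - f (g \<otimes> h) + f g"
  by (simp add: delta1_def)

lemma delta1_extensional: "delta1 G f \<in> extensional (carrier G \<times> carrier G)"
  by (auto simp: delta1_def)

lemma Z_memI: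
  assumes "c \<in> extensional (carrier G \<times> carrier G)"
    and "\<And>g h. g \<in> carrier G \<Longrightarrow> h \<in> carrier G \<Longrightarrow> \<bar>c (g, h)\<bar> \<le> K"
    and "\<And>g h k. g \<in> carrier G \<Longrightarrow> h \<in> carrier G \<Longrightarrow> k \<in> carrier G \<Longrightarrow>
      c (h, k) - c (g \<otimes> h, k) + c (g, h \<otimes> k) - c (g, h) = 0"
  shows "c \<in> carrier Z"
  using assms unfolding bounded_cocycles2_def by auto

lemma Z_memD:
  assumes "c \<in> carrier Z"
  shows "c \<in> extensional (carrier G \<times> carrier G)"
    and "\<exists>K. \<forall>g\<in>carrier G. \<forall>h\<in>carrier G. \<bar>c (g, h)\<bar> \<le> K"
    and "\<And>g h k. g \<in> carrier G \<Longrightarrow> h \<in> carrier G \<Longrightarrow> k \<in> carrier G \<Longrightarrow>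
      c (h, k) - c (g \<otimes> h, k) + c (g, h \<otimes> k) - c (g, h) = 0"
  using assms unfolding bounded_cocycles2_def by auto

lemma Z_ops:
  "a \<oplus>\<^bsub>Z\<^esub> b = (\<lambda>x\<in>carrier G \<times> carrier G. a x + b x)"
  "r \<odot>\<^bsub>Z\<^esub> a = (\<lambda>x\<in>carrier G \<times> carrier G. r * a x)"
  "\<zero>\<^bsub>Z\<^esub> = (\<lambda>x\<in>carrier G \<times> carrier G. 0)"
  by (simp_all add: bounded_cocycles2_def)

lemma delta1_in_Z:
  assumes "quasi f"
  shows "delta1 G f \<in> carrier Z"
proof -
  obtain K where K: "\<And>g h. g \<in> carrier G \<Longrightarrow> h \<in> carrier G \<Longrightarrow> \<bar>f h - f (g \<otimes> h) + f g\<bar> \<le> K"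
    using assms unfolding quasi_def by blast
  show ?thesis
    by (rule Z_memI[of _ K]) (use K in \<open>auto simp: delta1_eq delta1_extensional m_assoc\<close>)
qed

lemma Z_add_closed:
  assumes "a \<in> carrier Z" "b \<in> carrier Z" shows "a \<oplus>\<^bsub>Z\<^esub> b \<in> carrier Z"
proof -
  note a = Z_memD[OF assms(1)] and b = Z_memD[OF assms(2)]
  obtain K L where K: "\<forall>g\<in>carrier G. \<forall>h\<in>carrier G. \<bar>a (g, h)\<bar> \<le> K"
    and L: "\<forall>g\<in>carrier G. \<forall>h\<in>carrier G. \<bar>b (g, h)\<bar> \<le> L" using a(2) b(2) by blast
  show ?thesis
  proof (rule Z_memI[of _ "K + L"])
    fix g h assume gh: "g \<in> carrier G" "h \<in> carrier G"
    have "\<bar>a (g, h)\<bar> \<le> K" "\<bar>b (g, h)\<bar> \<le> L" using K L gh by auto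
    then show "\<bar>(a \<oplus>\<^bsub>Z\<^esub> b) (g, h)\<bar> \<le> K + L" using gh by (simp add: Z_ops)
  next
    fix g h k assume "g \<in> carrier G" "h \<in> carrier G" "k \<in> carrier G"
    then show "(a \<oplus>\<^bsub>Z\<^esub> b) (h, k) - (a \<oplus>\<^bsub>Z\<^esub> b) (g \<otimes> h, k) + (a \<oplus>\<^bsub>Z\<^esub> b) (g, h \<otimes> k) -
        (a \<oplus>\<^bsub>Z\<^esub> b) (g, h) = 0"
      using a(3)[of g h k] b(3)[of g h k] by (simp add: Z_ops)
  qed (simp add: Z_ops)
qed

lemma Z_smult_closed:
  assumes "a \<in> carrier Z" shows "r \<odot>\<^bsub>Z\<^esub> a \<in> carrier Z"
proof -
  note a = Z_memD[OF assms]
  obtain K where K: "\<forall>g\<in>carrier G. \<forall>h\<in>carrier G. \<bar>a (g, h)\<bar> \<le> K" using a(2) by blast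
  show ?thesis
  proof (rule Z_memI[of _ "\<bar>r\<bar> * K"])
    fix g h assume gh: "g \<in> carrier G" "h \<in> carrier G"
    have "\<bar>a (g, h)\<bar> \<le> K" using K gh by auto
    then show "\<bar>(r \<odot>\<^bsub>Z\<^esub> a) (g, h)\<bar> \<le> \<bar>r\<bar> * K" using gh by (simp add: Z_ops abs_mult mult_left_mono)
  next
    fix g h k assume *: "g \<in> carrier G" "h \<in> carrier G" "k \<in> carrier G"
    have "r * a (h, k) - r * a (g \<otimes> h, k) + r * a (g, h \<otimes> k) - r * a (g, h) =
        r * (a (h, k) - a (g \<otimes> h, k) + a (g, h \<otimes> k) - a (g, h))" by (simp add: algebra_simps)
    then show "(r \<odot>\<^bsub>Z\<^esub> a) (h, k) - (r \<odot>\<^bsub>Z\<^esub> a) (g \<otimes> h, k) + (r \<odot>\<^bsub>Z\<^esub> a) (g, h \<otimes> k) -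
        (r \<odot>\<^bsub>Z\<^esub> a) (g, h) = 0"
      using a(3)[of g h k] * by (simp add: Z_ops)
  qed (simp add: Z_ops)
qed

lemma Z_zero_closed: "\<zero>\<^bsub>Z\<^esub> \<in> carrier Z"
  by (rule Z_memI[of _ 0]) (auto simp: Z_ops)

lemma Z_neg:
  assumes "a \<in> carrier Z" shows "(- 1) \<odot>\<^bsub>Z\<^esub> a \<oplus>\<^bsub>Z\<^esub> a = \<zero>\<^bsub>Z\<^esub>"
  by (auto simp: Z_ops fun_eq_iff)

lemma abelian_group_Z: "abelian_group Z"
proof (rule abelian_groupI)
  show "\<zero>\<^bsub>Z\<^esub> \<oplus>\<^bsub>Z\<^esub> x = x" if "x \<in> carrier Z" for x
    using Z_memD(1)[OF that] by (auto simp: Z_ops fun_eq_iff extensional_def)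
  show "\<exists>y\<in>carrier Z. y \<oplus>\<^bsub>Z\<^esub> x = \<zero>\<^bsub>Z\<^esub>" if "x \<in> carrier Z" for x
    using Z_neg[OF that] Z_smult_closed[OF that] by blast
qed (auto intro: Z_add_closed Z_zero_closed simp: fun_eq_iff, auto simp: Z_ops)

lemma B_mem:
  "c \<in> B \<longleftrightarrow> (\<exists>b K. c = delta1 G b \<and> (\<forall>g\<in>carrier G. \<bar>b g\<bar> \<le> K))"
proof
  assume "\<exists>b K. c = delta1 G b \<and> (\<forall>g\<in>carrier G. \<bar>b g\<bar> \<le> K)"
  then obtain b K where b: "c = delta1 G b" "\<forall>g\<in>carrier G. \<bar>b g\<bar> \<le> K" by blast
  have "c = delta1 G (restrict b (carrier G))" by (auto simp: b(1) delta1_def fun_eq_iff)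
  moreover have "restrict b (carrier G) \<in> {b \<in> extensional (carrier G). \<exists>K. \<forall>g\<in>carrier G. \<bar>b g\<bar> \<le> K}"
    using b(2) by auto
  ultimately show "c \<in> B" unfolding bounded_coboundaries2_def by blast
qed (auto simp: bounded_coboundaries2_def)

lemma delta1_add: "delta1 G (\<lambda>g. f g + h g) = delta1 G f \<oplus>\<^bsub>Z\<^esub> delta1 G h"
  by (auto simp: delta1_def Z_ops fun_eq_iff)

lemma delta1_smult: "delta1 G (\<lambda>g. r * f g) = r \<odot>\<^bsub>Z\<^esub> delta1 G f"
  by (auto simp: delta1_def Z_ops fun_eq_iff algebra_simps)

lemma delta1_zero: "delta1 G (\<lambda>g. 0) = \<zero>\<^bsub>Z\<^esub>"
  by (auto simp: delta1_def Z_ops fun_eq_iff)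

lemma bounded_quasi:
  assumes "\<forall>g\<in>carrier G. \<bar>b g\<bar> \<le> K" shows "quasi b"
  unfolding quasi_def
proof (intro exI[of _ "3 * K"] ballI)
  fix g h assume "g \<in> carrier G" "h \<in> carrier G"
  then have "\<bar>b h\<bar> \<le> K" "\<bar>b g\<bar> \<le> K" "\<bar>b (g \<otimes> h)\<bar> \<le> K" using assms by auto
  then show "\<bar>b h - b (g \<otimes> h) + b g\<bar> \<le> 3 * K" by linarith
qed

lemma B_smult_closed: assumes "c \<in> B" shows "r \<odot>\<^bsub>Z\<^esub> c \<in> B"
proof -
  obtain b K where b: "c = delta1 G b" "\<forall>g\<in>carrier G. \<bar>b g\<bar> \<le> K" using assms B_mem by blast
  then have "\<forall>g\<in>carrier G. \<bar>r * b g\<bar> \<le> \<bar>r\<bar> * K" by (simp add: abs_mult mult_left_mono)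
  then show ?thesis unfolding B_mem b(1) using delta1_smult[of r b] by metis
qed

lemma B_add_closed: assumes "c \<in> B" "c' \<in> B" shows "c \<oplus>\<^bsub>Z\<^esub> c' \<in> B"
proof -
  obtain b K b' K' where b: "c = delta1 G b" "\<forall>g\<in>carrier G. \<bar>b g\<bar> \<le> K"
    "c' = delta1 G b'" "\<forall>g\<in>carrier G. \<bar>b' g\<bar> \<le> K'" using assms B_mem by blast
  then have "\<forall>g\<in>carrier G. \<bar>b g + b' g\<bar> \<le> K + K'" by (metis abs_triangle_ineq add_mono order_trans)
  then show ?thesis unfolding B_mem b(1,3) using delta1_add[of b b'] by metis
qed

lemma B_sub_Z: "B \<subseteq> carrier Z"
  using B_mem bounded_quasi delta1_in_Z by (metis subsetI)

lemma B_zero: "\<zero>\<^bsub>Z\<^esub> \<in> B"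
  unfolding B_mem using delta1_zero by (intro exI[of _ "\<lambda>_. 0"] exI[of _ 0]) simp

lemma abelian_subgroup_B: "abelian_subgroup B Z"
proof (rule abelian_subgroupI3[OF _ abelian_group_Z])
  interpret Z: abelian_group Z by (rule abelian_group_Z)
  show "additive_subgroup B Z"
  proof (rule additive_subgroup.intro, rule subgroup.intro)
    fix x assume x: "x \<in> B"
    then have xZ: "x \<in> carrier Z" using B_sub_Z by blast
    have "\<ominus>\<^bsub>Z\<^esub> x = (- 1) \<odot>\<^bsub>Z\<^esub> x"
      by (rule Z.minus_equality[OF Z_neg[OF xZ] xZ Z_smult_closed[OF xZ]])
    then show "inv\<^bsub>add_monoid Z\<^esub> x \<in> B" using B_smult_closed[OF x] by (simp add: a_inv_def)
  qed (use B_sub_Z B_add_closed B_zero in auto)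
qed

lemma H_ops: "carrier H = a_rcosets\<^bsub>Z\<^esub> B" "\<zero>\<^bsub>H\<^esub> = B" "X \<oplus>\<^bsub>H\<^esub> Y = X <+>\<^bsub>Z\<^esub> Y"
  "r \<odot>\<^bsub>H\<^esub> X = (\<Union>x\<in>X. B +>\<^bsub>Z\<^esub> (r \<odot>\<^bsub>Z\<^esub> x))"
  by (simp_all add: H2b_def Let_def)

lemma cls_carrier: "quasi f \<Longrightarrow> cls f \<in> carrier H"
  unfolding cls_def H2b_class_def H_ops A_RCOSETS_def' using delta1_in_Z by blast

lemma quasi_add:
  assumes "quasi f" "quasi h" shows "quasi (\<lambda>g. f g + h g)"
proof -
  obtain K L where "\<forall>g\<in>carrier G. \<forall>k\<in>carrier G. \<bar>f k - f (g \<otimes> k) + f g\<bar> \<le> K"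
    "\<forall>g\<in>carrier G. \<forall>k\<in>carrier G. \<bar>h k - h (g \<otimes> k) + h g\<bar> \<le> L"
    using assms unfolding quasi_def by blast
  then have "\<bar>f k + h k - (f (g \<otimes> k) + h (g \<otimes> k)) + (f g + h g)\<bar> \<le> K + L"
    if "g \<in> carrier G" "k \<in> carrier G" for g k
  proof -
    have "\<bar>f k - f (g \<otimes> k) + f g\<bar> \<le> K" "\<bar>h k - h (g \<otimes> k) + h g\<bar> \<le> L"
      using that \<open>\<forall>g\<in>carrier G. \<forall>k\<in>carrier G. \<bar>f k - f (g \<otimes> k) + f g\<bar> \<le> K\<close>
        \<open>\<forall>g\<in>carrier G. \<forall>k\<in>carrier G. \<bar>h k - h (g \<otimes> k) + h g\<bar> \<le> L\<close> by auto
    then show ?thesis by linarith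
  qed
  then show ?thesis unfolding quasi_def by blast
qed

lemma quasi_smult:
  assumes "quasi f" shows "quasi (\<lambda>g. r * f g)"
proof -
  obtain K where K: "\<forall>g\<in>carrier G. \<forall>k\<in>carrier G. \<bar>f k - f (g \<otimes> k) + f g\<bar> \<le> K"
    using assms unfolding quasi_def by blast
  have "\<bar>r * f k - r * f (g \<otimes> k) + r * f g\<bar> \<le> \<bar>r\<bar> * K" if "g \<in> carrier G" "k \<in> carrier G" for g k
  proof -
    have "r * f k - r * f (g \<otimes> k) + r * f g = r * (f k - f (g \<otimes> k) + f g)"
      by (simp add: algebra_simps)
    then show ?thesis using K that by (simp add: abs_mult mult_left_mono)
  qed
  then show ?thesis unfolding quasi_def by blast
qed

lemma cls_add:
  assumes "quasi f" "quasi h"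
  shows "cls f \<oplus>\<^bsub>H\<^esub> cls h = cls (\<lambda>g. f g + h g)"
  unfolding cls_def H2b_class_def H_ops delta1_add
  by (rule abelian_subgroup.a_rcos_sum[OF abelian_subgroup_B delta1_in_Z[OF assms(1)] delta1_in_Z[OF assms(2)]])

lemma coset_mem: "c \<in> B +>\<^bsub>Z\<^esub> c' \<longleftrightarrow> (\<exists>b\<in>B. c = b \<oplus>\<^bsub>Z\<^esub> c')"
  by (auto simp: a_r_coset_def')

text \<open>Scalar multiplication in \<open>H2b\<close> is a union over all representatives of a
  class. The cosets in this union coincide because \<open>B\<close> is closed under scalars.\<close>

lemma cls_smult:
  assumes "quasi f"
  shows "r \<odot>\<^bsub>H\<^esub> cls f = cls (\<lambda>g. r * f g)"
proof -
  interpret B: abelian_subgroup B Z by (rule abelian_subgroup_B)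
  let ?c = "delta1 G f"
  have c: "?c \<in> carrier Z" using assms by (rule delta1_in_Z)
  have "B +>\<^bsub>Z\<^esub> (r \<odot>\<^bsub>Z\<^esub> x) = B +>\<^bsub>Z\<^esub> (r \<odot>\<^bsub>Z\<^esub> ?c)" if "x \<in> B +>\<^bsub>Z\<^esub> ?c" for x
  proof -
    obtain b where b: "b \<in> B" "x = b \<oplus>\<^bsub>Z\<^esub> ?c" using \<open>x \<in> B +>\<^bsub>Z\<^esub> ?c\<close> coset_mem by blast
    have "r \<odot>\<^bsub>Z\<^esub> x = r \<odot>\<^bsub>Z\<^esub> b \<oplus>\<^bsub>Z\<^esub> (r \<odot>\<^bsub>Z\<^esub> ?c)"
      unfolding b(2) by (auto simp: Z_ops fun_eq_iff algebra_simps)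
    then have "r \<odot>\<^bsub>Z\<^esub> x \<in> B +>\<^bsub>Z\<^esub> (r \<odot>\<^bsub>Z\<^esub> ?c)" using B_smult_closed[OF b(1)] coset_mem by blast
    from B.a_repr_independence[OF this Z_smult_closed[OF c] B.a_subgroup] show ?thesis by (rule sym)
  qed
  moreover have "?c \<in> B +>\<^bsub>Z\<^esub> ?c" using B.a_rcos_self[OF c] .
  ultimately show ?thesis unfolding cls_def H2b_class_def H_ops delta1_smult by blast
qed

text \<open>For a bounded \<open>b\<close>, the equation \<open>delta1 G f = delta1 G b\<close> says
  exactly that \<open>f\<close> minus \<open>b\<close> is a homomorphism.\<close>

lemma trivial_qm_iff:
  "trivial_qm f \<longleftrightarrow> delta1 G f \<in> B"
proof
  assume "trivial_qm f"
  then obtain \<chi> K where \<chi>: "\<And>g h. g \<in> carrier G \<Longrightarrow> h \<in> carrier G \<Longrightarrow> \<chi> (g \<otimes> h) = \<chi> g + \<chi> h"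
    "\<forall>g\<in>carrier G. \<bar>f g - \<chi> g\<bar> \<le> K" unfolding trivial_qm_def by blast
  have "delta1 G f = delta1 G (\<lambda>g. f g - \<chi> g)" using \<chi>(1) by (auto simp: delta1_def fun_eq_iff)
  then show "delta1 G f \<in> B" using \<chi>(2) B_mem by blast
next
  assume "delta1 G f \<in> B"
  then obtain b K where b: "delta1 G f = delta1 G b" "\<forall>g\<in>carrier G. \<bar>b g\<bar> \<le> K" using B_mem by blast
  have "f (g \<otimes> h) - b (g \<otimes> h) = (f g - b g) + (f h - b h)"
    if "g \<in> carrier G" "h \<in> carrier G" for g h
    using fun_cong[OF b(1), of "(g, h)"] that by (simp add: delta1_eq)
  then show "trivial_qm f" unfolding trivial_qm_def using b(2)
    by (intro exI[of _ "\<lambda>g. f g - b g"] exI[of _ K]) auto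
qed

lemma cls_zero_iff:
  assumes "quasi f"
  shows "cls f = \<zero>\<^bsub>H\<^esub> \<longleftrightarrow> trivial_qm f"
proof -
  interpret B: abelian_subgroup B Z by (rule abelian_subgroup_B)
  note c = delta1_in_Z[OF assms]
  have "cls f = B \<longleftrightarrow> delta1 G f \<in> B"
  proof
    assume "cls f = B"
    then show "delta1 G f \<in> B" using B.a_rcos_self[OF c] by (simp add: cls_def H2b_class_def)
  next
    assume "delta1 G f \<in> B"
    then show "cls f = B" unfolding cls_def H2b_class_def using B.a_coset_join2[OF c] B.a_subgroup
      by blast
  qed
  then show ?thesis by (simp add: trivial_qm_iff H_ops)
qed

lemma cls_zero: "cls (\<lambda>g. 0) = \<zero>\<^bsub>H\<^esub>"
proof -
  have "quasi (\<lambda>g. 0)" by (rule bounded_quasi[of _ 0]) simp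
  moreover have "trivial_qm (\<lambda>g. 0)"
    unfolding trivial_qm_def by (intro exI[of _ "\<lambda>g. 0"] exI[of _ 0]) simp
  ultimately show ?thesis using cls_zero_iff by blast
qed

text \<open>Makes the laws of finite sums available, in which \<open>lin_indep_family\<close> is
  stated.\<close>

lemma abelian_group_H: "abelian_group H"
proof -
  interpret B: abelian_subgroup B Z by (rule abelian_subgroup_B)
  have rep: "\<exists>c\<in>carrier Z. X = B +>\<^bsub>Z\<^esub> c" if "X \<in> carrier H" for X
    using that unfolding H_ops A_RCOSETS_def' by blast
  have cos: "B +>\<^bsub>Z\<^esub> c \<in> carrier H" if "c \<in> carrier Z" for c
    using that unfolding H_ops A_RCOSETS_def' by blast
  have sum: "(B +>\<^bsub>Z\<^esub> c) \<oplus>\<^bsub>H\<^esub> (B +>\<^bsub>Z\<^esub> c') = B +>\<^bsub>Z\<^esub> (c \<oplus>\<^bsub>Z\<^esub> c')"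
    if "c \<in> carrier Z" "c' \<in> carrier Z" for c c'
    unfolding H_ops using B.a_rcos_sum[OF that] .
  have zero: "\<zero>\<^bsub>H\<^esub> = B +>\<^bsub>Z\<^esub> \<zero>\<^bsub>Z\<^esub>"
    unfolding H_ops using B.a_coset_join2[OF Z_zero_closed B.a_subgroup B_zero] by simp
  show ?thesis
  proof (rule abelian_groupI)
    fix X Y W assume "X \<in> carrier H" "Y \<in> carrier H" "W \<in> carrier H"
    then obtain x y w where "x \<in> carrier Z" "X = B +>\<^bsub>Z\<^esub> x" "y \<in> carrier Z" "Y = B +>\<^bsub>Z\<^esub> y"
      "w \<in> carrier Z" "W = B +>\<^bsub>Z\<^esub> w" using rep by metis
    then show "X \<oplus>\<^bsub>H\<^esub> Y \<oplus>\<^bsub>H\<^esub> W = X \<oplus>\<^bsub>H\<^esub> (Y \<oplus>\<^bsub>H\<^esub> W)"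
      by (simp add: sum Z_add_closed B.a_assoc)
  next
    fix X Y assume "X \<in> carrier H" "Y \<in> carrier H"
    then obtain x y where "x \<in> carrier Z" "X = B +>\<^bsub>Z\<^esub> x" "y \<in> carrier Z" "Y = B +>\<^bsub>Z\<^esub> y"
      using rep by metis
    then show "X \<oplus>\<^bsub>H\<^esub> Y \<in> carrier H" "X \<oplus>\<^bsub>H\<^esub> Y = Y \<oplus>\<^bsub>H\<^esub> X"
      by (simp_all add: sum cos Z_add_closed B.a_comm)
  next
    fix X assume "X \<in> carrier H"
    then obtain x where x: "x \<in> carrier Z" "X = B +>\<^bsub>Z\<^esub> x" using rep by blast
    then show "\<zero>\<^bsub>H\<^esub> \<oplus>\<^bsub>H\<^esub> X = X" by (simp add: zero sum Z_zero_closed)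
    have "(B +>\<^bsub>Z\<^esub> ((- 1) \<odot>\<^bsub>Z\<^esub> x)) \<oplus>\<^bsub>H\<^esub> X = \<zero>\<^bsub>H\<^esub>"
      unfolding x(2) zero sum[OF Z_smult_closed[OF x(1)] x(1)] Z_neg[OF x(1)] ..
    then show "\<exists>Y\<in>carrier H. Y \<oplus>\<^bsub>H\<^esub> X = \<zero>\<^bsub>H\<^esub>" using cos[OF Z_smult_closed[OF x(1)]] by blast
  next
    show "\<zero>\<^bsub>H\<^esub> \<in> carrier H" unfolding zero by (rule cos[OF Z_zero_closed])
  qed
qed

lemma finsum_cls:
  assumes "finite F" "\<And>i. i \<in> F \<Longrightarrow> quasi (f i)"
  shows "(\<Oplus>\<^bsub>H\<^esub>i\<in>F. cls (f i)) = cls (\<lambda>g. \<Sum>i\<in>F. f i g)" "quasi (\<lambda>g. \<Sum>i\<in>F. f i g)"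
  using assms
proof (induction F)
  case empty
  interpret H: abelian_group H by (rule abelian_group_H)
  case 1 show ?case by (simp add: cls_zero)
  case 2 show ?case by (auto simp: quasi_def)
next
  case (insert i F)
  interpret H: abelian_group H by (rule abelian_group_H)
  case 1
  then show ?case using insert cls_carrier by (subst H.finsum_insert) (auto simp: cls_add)
  case 2
  then show ?case using insert by (simp add: quasi_add)
qed

lemma lin_indep_nontrivial:
  assumes "lin_indep_family H (\<lambda>i. cls (f i))" "quasi (f i)"
  shows "\<not> trivial_qm (f i)"
proof
  assume "trivial_qm (f i)"
  then have "cls (f i) = \<zero>\<^bsub>H\<^esub>" using cls_zero_iff[OF assms(2)] by simp
  moreover have "(\<Oplus>\<^bsub>H\<^esub>j\<in>{i}. 1 \<odot>\<^bsub>H\<^esub> cls (f j)) = cls (f i)"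
  proof -
    interpret H: abelian_group H by (rule abelian_group_H)
    have "1 \<odot>\<^bsub>H\<^esub> cls (f i) = cls (f i)" using cls_smult[OF assms(2), of 1] by simp
    then show ?thesis using cls_carrier[OF assms(2)] by (subst H.finsum_insert) auto
  qed
  ultimately have "(1 :: real) = 0"
    using assms(1)[unfolded lin_indep_family_def, THEN conjunct2, rule_format, of "{i}" "\<lambda>_. 1" i]
      by simp
  then show False by simp
qed

text \<open>A homomorphism to the reals cannot distinguish \<open>w k\<close> from \<open>w' k\<close>.\<close>

lemma family_nontrivial:
  fixes f h :: "nat \<Rightarrow> 'a \<Rightarrow> real" and w w' :: "nat \<Rightarrow> 'a"
  assumes close: "\<And>k g. g \<in> carrier G \<Longrightarrow> \<bar>f k g - h k g\<bar> \<le> E"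
    and finite_f: "\<And>k g. g \<in> carrier G \<Longrightarrow> \<bar>f k g\<bar> \<le> L g"
    and w: "\<And>k. w k \<in> carrier G" "\<And>k. w' k \<in> carrier G"
    and perm: "\<And>k. \<exists>x\<in>carrier G. \<exists>y\<in>carrier G. \<exists>z\<in>carrier G. w k = x \<otimes> y \<otimes> z \<and> w' k = x \<otimes> z \<otimes> y"
    and own: "\<And>k m. real m \<le> h k (w k [^] m)" "\<And>k m. h k (w' k [^] (m :: nat)) \<le> 0"
    and other: "\<And>k i m. i \<noteq> k \<Longrightarrow> h k (w i [^] (m :: nat)) = 0" "\<And>k i m. i \<noteq> k \<Longrightarrow> h k (w' i [^] (m :: nat)) = 0"
    and a: "summable (\<lambda>k. \<bar>a k\<bar>)" and triv: "trivial_qm (\<lambda>g. \<Sum>k. a k * f k g)"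
  shows "a N = 0"
proof (rule ccontr)
  assume aN: "a N \<noteq> 0"
  define \<Phi> where "\<Phi> g = (\<Sum>k. a k * f k g)" for g
  obtain \<chi> K where \<chi>: "\<And>g h. g \<in> carrier G \<Longrightarrow> h \<in> carrier G \<Longrightarrow> \<chi> (g \<otimes> h) = \<chi> g + \<chi> h"
    and K: "\<And>g. g \<in> carrier G \<Longrightarrow> \<bar>\<Phi> g - \<chi> g\<bar> \<le> K"
    using triv unfolding trivial_qm_def \<Phi>_def by blast
  define S where "S = (\<Sum>k. \<bar>a k\<bar>)"
  have chipow: "\<chi> (g [^] m) = m * \<chi> g" if "g \<in> carrier G" for g and m :: nat
  proof (induction m)
    case 0
    then show ?case using \<chi>[of \<one> \<one>] by simp
  next
    case (Suc m)
    then show ?case using \<chi>[of "g [^] m" g] that by (simp add: algebra_simps)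
  qed
  have chiw: "\<chi> (w N) = \<chi> (w' N)"
    using perm[of N] \<chi> by (auto simp: m_closed)
  have sm: "summable (\<lambda>k. a k * u k)" "\<bar>\<Sum>k. a k * u k\<bar> \<le> S * M"
    if u: "\<And>k. \<bar>u k\<bar> \<le> M" for u M
  proof -
    have s2: "summable (\<lambda>k. \<bar>a k\<bar> * M)" using a by (rule summable_mult2)
    have le: "\<bar>a k * u k\<bar> \<le> \<bar>a k\<bar> * M" for k using u[of k] by (simp add: abs_mult mult_left_mono)
    have ss: "summable (\<lambda>k. \<bar>a k * u k\<bar>)" by (rule summable_comparison_test'[OF s2]) (use le in auto)
    then show "summable (\<lambda>k. a k * u k)" by (rule summable_rabs_cancel)
    have "\<bar>\<Sum>k. a k * u k\<bar> \<le> (\<Sum>k. \<bar>a k * u k\<bar>)" using ss by (rule summable_rabs)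
    also have "\<dots> \<le> (\<Sum>k. \<bar>a k\<bar> * M)" by (rule suminf_le[OF le ss s2])
    also have "\<dots> = S * M" unfolding S_def using a by (rule suminf_mult2[symmetric])
    finally show "\<bar>\<Sum>k. a k * u k\<bar> \<le> S * M" .
  qed
  \<comment> \<open>Replacing \<open>f k\<close> by \<open>h k\<close> costs at most
    \<open>E\<close> for all \<open>k\<close> at once, hence \<open>S * E\<close> after weighting by
    \<open>a\<close>; of the remaining sum only the term \<open>N\<close> survives.\<close>
  have near: "\<bar>\<Phi> g - a N * h N g\<bar> \<le> S * E"
    if g: "g \<in> carrier G" and z: "\<And>k. k \<noteq> N \<Longrightarrow> h k g = 0" for g
  proof -
    let ?r = "\<lambda>k. f k g - h k g"
    have "summable (\<lambda>k. a k * f k g)" using sm(1)[of "\<lambda>k. f k g" "L g"] finite_f[OF g] by blast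
    moreover have "summable (\<lambda>k. a k * ?r k)" using sm(1)[of ?r E] close[OF g] by blast
    ultimately have "\<Phi> g - (\<Sum>k. a k * ?r k) = (\<Sum>k. a k * f k g - a k * ?r k)"
      unfolding \<Phi>_def by (rule suminf_diff)
    also have "\<dots> = (\<Sum>k. a k * h k g)" by (simp add: algebra_simps)
    also have "\<dots> = (\<Sum>k\<in>{N}. a k * h k g)" by (rule suminf_finite) (use z in auto)
    finally have "\<Phi> g - a N * h N g = (\<Sum>k. a k * ?r k)" by simp
    then show ?thesis using sm(2)[of ?r E] close[OF g] by simp
  qed
  \<comment> \<open>\<chi> agrees on the powers of the two words, so \<Phi> differs boundedly on
    them, whereas the term \<open>N\<close> separates them by at least \<open>m\<close> times
    \<open>|a N|\<close>.\<close>
  have bound: "real m * \<bar>a N\<bar> \<le> 2 * K + 2 * (S * E)" for m :: nat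
  proof -
    let ?g = "w N [^] m" and ?g' = "w' N [^] m"
    have c: "?g \<in> carrier G" "?g' \<in> carrier G" using w by auto
    have n: "\<bar>\<Phi> ?g - a N * h N ?g\<bar> \<le> S * E" "\<bar>\<Phi> ?g' - a N * h N ?g'\<bar> \<le> S * E"
      using near[OF c(1)] near[OF c(2)] other by auto
    have "\<chi> ?g = \<chi> ?g'" using chipow w chiw by simp
    then have "\<bar>a N * h N ?g - a N * h N ?g'\<bar> \<le> 2 * K + 2 * (S * E)"
      using n K[OF c(1)] K[OF c(2)] by linarith
    moreover have "a N * h N ?g - a N * h N ?g' = a N * (h N ?g - h N ?g')"
      by (simp add: algebra_simps)
    moreover have "real m \<le> \<bar>h N ?g - h N ?g'\<bar>" using own(1)[of m N] own(2)[of N m] by linarith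
    then have "\<bar>a N\<bar> * real m \<le> \<bar>a N\<bar> * \<bar>h N ?g - h N ?g'\<bar>" by (rule mult_left_mono) simp
    ultimately show ?thesis by (simp add: abs_mult mult.commute)
  qed
  obtain m :: nat where "2 * K + 2 * (S * E) < real m * \<bar>a N\<bar>"
    using reals_Archimedean3[of "\<bar>a N\<bar>"] aN by auto
  then show False using bound[of m] by linarith
qed

text \<open>Dividing by \<open>D k\<close> bounds the defect of the infinite sum by the norm of the
  sequence in l1. The sum converges pointwise because \<open>L\<close> is uniform in
  \<open>k\<close>. As \<open>1 \<le> D k\<close>, the divided coefficients are still summable, so
  \<open>nontriv\<close> applies to them and gives injectivity.\<close>

lemma embedding_of_family:
  fixes f :: "nat \<Rightarrow> 'a \<Rightarrow> real"
  assumes D: "\<And>k. 1 \<le> D k" "\<And>k g h. g \<in> carrier G \<Longrightarrow> h \<in> carrier G \<Longrightarrow> \<bar>f k h - f k (g \<otimes> h) + f k g\<bar> \<le> D k"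
    and finite_f: "\<And>k g. g \<in> carrier G \<Longrightarrow> \<bar>f k g\<bar> \<le> L g"
    and nontriv: "\<And>a N. summable (\<lambda>k. \<bar>a k\<bar>) \<Longrightarrow> trivial_qm (\<lambda>g. \<Sum>k. a k * f k g) \<Longrightarrow> a N = 0"
  shows "lin_indep_family H (\<lambda>k. cls (f k))"
    and "\<exists>\<phi>. linear_map ell1 H \<phi> \<and> inj_on \<phi> (carrier ell1)"
proof -
  have q: "quasi (f k)" for k using D(2) unfolding quasi_def by blast
  show "lin_indep_family H (\<lambda>k. cls (f k))"
    unfolding lin_indep_family_def
  proof (intro conjI allI impI ballI)
    show "cls (f i) \<in> carrier H" for i using q by (rule cls_carrier)
    fix F u i
    assume F: "finite F" and z: "(\<Oplus>\<^bsub>H\<^esub>i\<in>F. u i \<odot>\<^bsub>H\<^esub> cls (f i)) = \<zero>\<^bsub>H\<^esub>" and i: "i \<in> F"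
    \<comment> \<open>A finite linear relation is read as an infinite one with coefficients 0
      outside \<open>F\<close>.\<close>
    let ?a = "\<lambda>i. if i \<in> F then u i else 0"
    have "cls (\<lambda>g. \<Sum>i\<in>F. u i * f i g) = \<zero>\<^bsub>H\<^esub>" "quasi (\<lambda>g. \<Sum>i\<in>F. u i * f i g)"
      using finsum_cls[OF F, of "\<lambda>i g. u i * f i g"] z q by (auto simp: quasi_smult cls_smult)
    then have "trivial_qm (\<lambda>g. \<Sum>i\<in>F. u i * f i g)" using cls_zero_iff by blast
    moreover have "(\<Sum>i\<in>F. u i * f i g) = (\<Sum>k. ?a k * f k g)" for g
      by (subst suminf_finite[OF F]) auto
    ultimately have "trivial_qm (\<lambda>g. \<Sum>k. ?a k * f k g)" by simp
    moreover have "summable (\<lambda>k. \<bar>?a k\<bar>)" by (rule summable_finite[OF F]) auto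
    ultimately show "u i = 0" using nontriv[of ?a i] i by simp
  qed
  define \<Phi> where "\<Phi> a g = (\<Sum>k. a k / D k * f k g)" for a :: "nat \<Rightarrow> real" and g
  define \<phi> where "\<phi> a = cls (\<Phi> a)" for a
  have Dp: "0 < D k" for k using D(1)[of k] by linarith
  have ell: "carrier ell1 = {a. summable (\<lambda>n. \<bar>a n\<bar>)}" by (simp add: ell1_def)
  have wt: "summable (\<lambda>k. \<bar>a k / D k\<bar>)" if "a \<in> carrier ell1" for a
  proof (rule summable_comparison_test')
    show "summable (\<lambda>n. \<bar>a n\<bar>)" using that ell by simp
    show "norm \<bar>a n / D n\<bar> \<le> \<bar>a n\<bar>" if "0 \<le> n" for n
      using mult_left_mono[OF D(1)[of n], of "\<bar>a n\<bar>"] Dp[of n] by (simp add: divide_le_eq)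
  qed
  have sm: "summable (\<lambda>k. a k / D k * f k g)" if "a \<in> carrier ell1" "g \<in> carrier G" for a g
  proof (rule summable_rabs_cancel, rule summable_comparison_test')
    show "summable (\<lambda>k. \<bar>a k / D k\<bar> * L g)" using wt[OF that(1)] by (rule summable_mult2)
    show "norm \<bar>a n / D n * f n g\<bar> \<le> \<bar>a n / D n\<bar> * L g" if "0 \<le> n" for n
      using mult_left_mono[OF finite_f[OF \<open>g \<in> carrier G\<close>, of n], of "\<bar>a n / D n\<bar>"]
      unfolding abs_mult real_norm_def by simp
  qed
  have add: "\<Phi> (\<lambda>n. a n + b n) g = \<Phi> a g + \<Phi> b g" if "a \<in> carrier ell1" "b \<in> carrier ell1" "g \<in> carrier G" for a b g
    unfolding \<Phi>_def using suminf_add[OF sm[OF that(1,3)] sm[OF that(2,3)]]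
    by (simp add: add_divide_distrib distrib_right)
  have smult: "\<Phi> (\<lambda>n. r * a n) g = r * \<Phi> a g" if "a \<in> carrier ell1" "g \<in> carrier G" for r a g
    unfolding \<Phi>_def using suminf_mult[OF sm[OF that], of r] by (simp add: mult.assoc)
  have quasi\<Phi>: "quasi (\<Phi> a)" if a: "a \<in> carrier ell1" for a
    unfolding quasi_def
  proof (intro exI ballI)
    fix g h assume gh: "g \<in> carrier G" "h \<in> carrier G"
    let ?t = "\<lambda>k. a k / D k * f k h - a k / D k * f k (g \<otimes> h) + a k / D k * f k g"
    have s: "summable (\<lambda>n. \<bar>a n\<bar>)" using a ell by simp
    have s1: "summable (\<lambda>k. a k / D k * f k h - a k / D k * f k (g \<otimes> h))"
      using sm[OF a] gh by (intro summable_diff) auto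
    have "\<Phi> a h - \<Phi> a (g \<otimes> h) + \<Phi> a g = (\<Sum>k. ?t k)"
      unfolding \<Phi>_def using sm[OF a] gh s1 by (simp add: suminf_add suminf_diff)
    moreover have le: "\<bar>?t k\<bar> \<le> \<bar>a k\<bar>" for k
    proof -
      have "?t k = a k / D k * (f k h - f k (g \<otimes> h) + f k g)" by (simp add: algebra_simps)
      then have "\<bar>?t k\<bar> = \<bar>a k\<bar> / D k * \<bar>f k h - f k (g \<otimes> h) + f k g\<bar>"
        using Dp[of k] by (simp add: abs_mult)
      also have "\<dots> \<le> \<bar>a k\<bar> / D k * D k" using D(2)[OF gh] Dp[of k] by (intro mult_left_mono) auto
      also have "\<dots> = \<bar>a k\<bar>" using Dp[of k] by simp
      finally show ?thesis .
    qed
    moreover have ss: "summable (\<lambda>k. \<bar>?t k\<bar>)"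
      by (rule summable_comparison_test'[OF s]) (use le in auto)
    ultimately show "\<bar>\<Phi> a h - \<Phi> a (g \<otimes> h) + \<Phi> a g\<bar> \<le> (\<Sum>k. \<bar>a k\<bar>)"
      using order_trans[OF summable_rabs[OF ss] suminf_le[OF le ss s]] by simp
  qed
  have ell_add: "(\<lambda>n. a n + b n) \<in> carrier ell1" if "a \<in> carrier ell1" "b \<in> carrier ell1" for a b
  proof -
    have "summable (\<lambda>n. \<bar>a n\<bar> + \<bar>b n\<bar>)" using that ell by (intro summable_add) auto
    then have "summable (\<lambda>n. \<bar>a n + b n\<bar>)" by (rule summable_comparison_test') (auto intro: abs_triangle_ineq)
    then show ?thesis by (simp add: ell)
  qed
  have ell_smult: "(\<lambda>n. r * a n) \<in> carrier ell1" if "a \<in> carrier ell1" for r a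
    using that summable_mult[of "\<lambda>n. \<bar>a n\<bar>" "\<bar>r\<bar>"] by (simp add: ell abs_mult)
  have \<phi>_add: "\<phi> (\<lambda>n. a n + b n) = \<phi> a \<oplus>\<^bsub>H\<^esub> \<phi> b" if "a \<in> carrier ell1" "b \<in> carrier ell1" for a b
    unfolding \<phi>_def cls_add[OF quasi\<Phi>[OF that(1)] quasi\<Phi>[OF that(2)]]
      by (rule cls_cong) (rule add[OF that])
  have \<phi>_smult: "\<phi> (\<lambda>n. r * a n) = r \<odot>\<^bsub>H\<^esub> \<phi> a" if "a \<in> carrier ell1" for r a
    unfolding \<phi>_def cls_smult[OF quasi\<Phi>[OF that]] by (rule cls_cong) (rule smult[OF that])
  have lin: "linear_map ell1 H \<phi>"
    unfolding linear_map_def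
  proof (intro conjI ballI allI)
    show "\<phi> \<in> carrier ell1 \<rightarrow> carrier H" using quasi\<Phi> cls_carrier by (auto simp: \<phi>_def)
    show "\<phi> (x \<oplus>\<^bsub>ell1\<^esub> y) = \<phi> x \<oplus>\<^bsub>H\<^esub> \<phi> y" if "x \<in> carrier ell1" "y \<in> carrier ell1" for x y
      using \<phi>_add[OF that] by (simp add: ell1_def)
    show "\<phi> (r \<odot>\<^bsub>ell1\<^esub> x) = r \<odot>\<^bsub>H\<^esub> \<phi> x" if "x \<in> carrier ell1" for r x
      using \<phi>_smult[OF that] by (simp add: ell1_def)
  qed
  have "inj_on \<phi> (carrier ell1)"
  proof (rule inj_onI)
    fix a b assume ab: "a \<in> carrier ell1" "b \<in> carrier ell1" and eq: "\<phi> a = \<phi> b"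
    let ?nb = "\<lambda>n. - 1 * b n"
    have "\<phi> (\<lambda>n. a n + ?nb n) = \<phi> (\<lambda>n. b n + ?nb n)"
      unfolding \<phi>_add[OF ab(1) ell_smult[OF ab(2)]] \<phi>_add[OF ab(2) ell_smult[OF ab(2)]] eq ..
    also have "\<Phi> (\<lambda>n. b n + ?nb n) = (\<lambda>g. 0)" by (simp add: \<Phi>_def fun_eq_iff)
    then have "\<phi> (\<lambda>n. b n + ?nb n) = \<zero>\<^bsub>H\<^esub>" using cls_zero by (simp add: \<phi>_def)
    finally have "trivial_qm (\<Phi> (\<lambda>n. a n + ?nb n))"
      unfolding \<phi>_def using cls_zero_iff quasi\<Phi>[OF ell_add[OF ab(1) ell_smult[OF ab(2)]]] by blast
    then have "trivial_qm (\<lambda>g. \<Sum>k. (a k + ?nb k) / D k * f k g)" unfolding \<Phi>_def .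
    from nontriv[OF wt[OF ell_add[OF ab(1) ell_smult[OF ab(2)]]] this]
    have "(a n + ?nb n) / D n = 0" for n .
    then show "a = b" using Dp by (auto simp: fun_eq_iff) (metis less_irrefl)
  qed
  then show "\<exists>\<phi>. linear_map ell1 H \<phi> \<and> inj_on \<phi> (carrier ell1)" using lin by blast
qed

end

section \<open>The trichotomy\<close>

lemma (in tree_graph) rayD:
  assumes "r \<in> rays T"
  shows "r i \<in> V" "i \<le> j \<Longrightarrow> d (r i) (r j) = j - i"
  using assms unfolding rays_def by auto

context tree_action
begin

section \<open>The case of a fixed end\<close>

lemma fixed_end_ray:
  assumes fixes_end
  obtains r where "r \<in> rays T"
    "\<And>g. g \<in> carrier G \<Longrightarrow> \<exists>m n. \<forall>i. r (m + i) = \<rho> g (r (n + i))"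
proof -
  obtain a where a: "a \<in> tree_boundary T" "fixes_boundary_point G \<rho> a" using assms by blast
  then obtain r where r: "r \<in> rays T" "a = ray_equiv T `` {r}"
    unfolding tree_boundary_def by (auto elim: quotientE)
  have ra: "r \<in> a" using r unfolding ray_equiv_def by auto
  have "\<exists>m n. \<forall>i. r (m + i) = \<rho> g (r (n + i))" if g: "g \<in> carrier G" for g
  proof -
    have "\<rho> g \<circ> r \<in> a" using a(2) g ra unfolding fixes_boundary_point_def by blast
    then show ?thesis unfolding r(2) ray_equiv_def by auto
  qed
  then show ?thesis using that r(1) by blast
qed

definition qm :: "'v \<Rightarrow> 'v list \<Rightarrow> 'g \<Rightarrow> real" where
  "qm v s g = real_of_int (flow (hd s) (last s) v (\<rho> g v))"

lemma geodesic_ends: "geodesic T s \<Longrightarrow> hd s \<in> V" "geodesic T s \<Longrightarrow> last s \<in> V"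
  by (auto simp: geodesic_def walk_def)

lemma median_class_eq:
  assumes "geodesic T s" "v \<in> V"
  shows "median_class G T \<rho> v s = cls (qm v s)"
  unfolding median_class_def cls_def[symmetric]
  by (rule cls_cong) (simp add: qm_def median_qm_eq_flow[OF assms])

text \<open>The quasi-cocycle bound for \<open>v\<close>, \<open>\<rho> g v\<close> and
  \<open>\<rho> (g \<otimes> h) v\<close>, with the second leg moved back by the inverse of
  \<open>g\<close>.\<close>

lemma qm_defect:
  assumes "geodesic T s" "v \<in> V" "g \<in> carrier G" "h \<in> carrier G"
  shows "\<bar>qm v s h - qm v s (g \<otimes> h) + qm v s g\<bar> \<le> 6 * (real (d (hd s) (last s)) + 1)"
proof -
  note e = geodesic_ends[OF assms(1)]
  have V: "\<rho> g v \<in> V" "\<rho> h v \<in> V" "\<rho> (g \<otimes> h) v \<in> V" using assms by auto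
  have "flow (hd s) (last s) (\<rho> g v) (\<rho> (g \<otimes> h) v) = flow (hd s) (last s) v (\<rho> h v)"
    using flow_act[OF assms(3) e assms(2) V(2)] assms by (simp add: act_mult)
  then have "\<bar>flow (hd s) (last s) v (\<rho> g v) + flow (hd s) (last s) v (\<rho> h v) -
      flow (hd s) (last s) v (\<rho> (g \<otimes> h) v)\<bar> \<le> 6 * (int (d (hd s) (last s)) + 1)"
    using flow_quasi_cocycle[OF e assms(2) V(1,3)] by simp
  then have "real_of_int \<bar>flow (hd s) (last s) v (\<rho> g v) + flow (hd s) (last s) v (\<rho> h v) -
      flow (hd s) (last s) v (\<rho> (g \<otimes> h) v)\<bar> \<le> real_of_int (6 * (int (d (hd s) (last s)) + 1))"
    by (simp only: of_int_le_iff)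
  then show ?thesis by (simp add: qm_def algebra_simps)
qed

lemma quasi_qm: "geodesic T s \<Longrightarrow> v \<in> V \<Longrightarrow> quasi (qm v s)"
  unfolding quasi_def using qm_defect by blast

text \<open>Far out on a ray, the increments of the flow no longer depend on the starting point.\<close>

lemma flow_along_ray:
  assumes r: "r \<in> rays T" and V: "a \<in> V" "b \<in> V" "x \<in> V"
  shows "\<exists>I. \<forall>i\<ge>I. flow a b x (r (Suc i)) - flow a b x (r i) =
    of_bool (eqv a b (r (Suc i - d a b)) (r (Suc i))) - of_bool (eqv b a (r (Suc i - d a b)) (r (Suc i)))"
proof -
  note R = rayD[OF r]
  have ad: "adj T (r i) (r (Suc i))" for i using dist_1_adj R(1) R(2)[of i "Suc i"] by simp
  \<comment> \<open>Otherwise the distance to \<open>x\<close> would decrease forever along the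
    ray.\<close>
  have ex: "\<exists>i. d x (r (Suc i)) = Suc (d x (r i))"
  proof (rule ccontr)
    assume "\<not> ?thesis"
    then have dec: "d x (r i) = Suc (d x (r (Suc i)))" for i using dist_neighbour[OF V(3) ad[of i]]
      by auto
    have "d x (r i) + i = d x (r 0)" for i
    proof (induction i)
      case (Suc i)
      then show ?case using dec[of i] by simp
    qed simp
    from this[of "Suc (d x (r 0))"] show False by simp
  qed
  then obtain j where j: "d x (r (Suc j)) = Suc (d x (r j))" by blast
  \<comment> \<open>Once the ray moves away from \<open>x\<close>, it could come closer only through
    the vertex it has just left.\<close>
  have inc: "d x (r (Suc (j + k))) = Suc (d x (r (j + k)))" for k
  proof (induction k)
    case 0
    then show ?case using j by simp
  next
    case (Suc k)
    let ?i = "j + k"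
    have "r (Suc (Suc ?i)) \<noteq> r ?i" using R(2)[of ?i "Suc (Suc ?i)"] R(1)[of ?i] by auto
    then have "\<not> d x (r (Suc (Suc ?i))) \<le> d x (r (Suc ?i))"
      using closer_neighbour_unique[OF V(3) ad[of "Suc ?i"] adjD(4)[OF ad[of ?i]]] Suc by auto
    then show ?case using dist_neighbour[OF V(3) ad[of "Suc ?i"]] by auto
  qed
  have dx: "d x (r (j + k)) = d x (r j) + k" for k
  proof (induction k)
    case (Suc k)
    then show ?case using inc[of k] by simp
  qed simp
  \<comment> \<open>From index \<open>j + d a b\<close> on, the last \<open>d a b\<close> edges of
    the geodesic from \<open>x\<close> lie on the ray, so whether a copy ends there no longer
    depends on \<open>x\<close>.\<close>
  have step: "cnt a b x (r (Suc i)) - cnt a b x (r i) = of_bool (eqv a b (r (Suc i - d a b)) (r (Suc i)))"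
    if i: "j + d a b \<le> i" and V': "a \<in> V" "b \<in> V" for a b i
  proof -
    let ?n = "d a b"
    obtain k where k: "i = j + ?n + k" using i le_Suc_ex by blast
    have e: "d x (r i) = d x (r j) + ?n + k" "d x (r (Suc i)) = d x (r j) + ?n + Suc k"
      "d x (r (Suc i - ?n)) = d x (r j) + Suc k"
      using dx[of "?n + k"] dx[of "Suc (?n + k)"] dx[of "Suc k"] by (simp_all add: k add.assoc)
    have dr: "d (r (Suc i - ?n)) (r (Suc i)) = ?n" using R(2)[of "Suc i - ?n" "Suc i"] k by simp
    have bt: "btw x (r i) (r (Suc i))" using e dist_adj[OF ad[of i]] by (simp add: btw_def)
    have "pt x (r (Suc i)) (d x (r (Suc i)) - ?n) = r (Suc i - ?n)"
      by (rule pt_eqI) (use V R(1) e dr in simp_all)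
    then show ?thesis using cnt_step[OF V(3) R(1) V' ad[of i] bt] e by simp
  qed
  have fl: "flow a b x y = cnt a b x y - cnt b a x y" if "y \<in> V" for y
    using cnt_rev[OF V(1-3) that] by (simp add: flow_def)
  have "flow a b x (r (Suc i)) - flow a b x (r i) =
    of_bool (eqv a b (r (Suc i - d a b)) (r (Suc i))) - of_bool (eqv b a (r (Suc i - d a b)) (r (Suc i)))"
    if i: "j + d a b \<le> i" for i
    using step[OF i V(1,2)] step[of b a i] i V dist_sym[OF V(1,2)] fl[OF R(1), of i] fl[OF R(1), of "Suc i"]
    by simp
  then show ?thesis by blast
qed

text \<open>The difference of the flows from \<open>x\<close> and \<open>y\<close> towards the end is an invariant cocycle.\<close>

lemma fixed_end_trivial:
  assumes fixes_end and s: "geodesic T s" and v: "v \<in> V"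
  shows "trivial_qm (qm v s)"
proof -
  obtain r where r: "r \<in> rays T"
    and inv: "\<And>g. g \<in> carrier G \<Longrightarrow> \<exists>m n. \<forall>i. r (m + i) = \<rho> g (r (n + i))"
    using fixed_end_ray[OF assms(1)] by blast
  note R = rayD(1)[OF r]
  let ?a = "hd s" and ?b = "last s"
  note e = geodesic_ends[OF s]
  define u where "u x i = flow ?a ?b x (r i)" for x i
  have "\<exists>c I. \<forall>i\<ge>I. u x i - u y i = c" if xy: "x \<in> V" "y \<in> V" for x y
  proof -
    obtain I J where I: "\<And>i. I \<le> i \<Longrightarrow> u x (Suc i) - u x i =
        of_bool (eqv ?a ?b (r (Suc i - d ?a ?b)) (r (Suc i))) - of_bool (eqv ?b ?a (r (Suc i - d ?a ?b)) (r (Suc i)))"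
      and J: "\<And>i. J \<le> i \<Longrightarrow> u y (Suc i) - u y i =
        of_bool (eqv ?a ?b (r (Suc i - d ?a ?b)) (r (Suc i))) - of_bool (eqv ?b ?a (r (Suc i - d ?a ?b)) (r (Suc i)))"
      using flow_along_ray[OF r e xy(1)] flow_along_ray[OF r e xy(2)] unfolding u_def by blast
    have "u x (max I J + k) - u y (max I J + k) = u x (max I J) - u y (max I J)" for k
    proof (induction k)
      case (Suc k)
      have "I \<le> max I J + k" "J \<le> max I J + k" by auto
      from I[OF this(1)] J[OF this(2)] Suc show ?case unfolding add_Suc_right by linarith
    qed simp
    then have "u x i - u y i = u x (max I J) - u y (max I J)" if "max I J \<le> i" for i
      using le_Suc_ex[OF that] by blast
    then show ?thesis by blast
  qed
  \<comment> \<open>An analogue of the Busemann cocycle, with the flow in place of the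
    distance.\<close>
  then obtain c where c: "\<And>x y. x \<in> V \<Longrightarrow> y \<in> V \<Longrightarrow> \<exists>I. \<forall>i\<ge>I. u x i - u y i = c x y"
    by metis
  have lim: "c x y = k" if V: "x \<in> V" "y \<in> V" and k: "\<And>i. I \<le> i \<Longrightarrow> u x i - u y i = k" for x y k I
  proof -
    obtain J where "\<forall>i\<ge>J. u x i - u y i = c x y" using c[OF V] by blast
    then show ?thesis using k[of "max I J"] by simp
  qed
  have c_add: "c x z = c x y + c y z" if V: "x \<in> V" "y \<in> V" "z \<in> V" for x y z
  proof -
    obtain I J where IJ: "\<forall>i\<ge>I. u x i - u y i = c x y" "\<forall>i\<ge>J. u y i - u z i = c y z"
      using c[OF V(1,2)] c[OF V(2,3)] by blast
    show ?thesis
    proof (rule lim[OF V(1,3), of "max I J"])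
      fix i assume "max I J \<le> i"
      then have "u x i - u y i = c x y" "u y i - u z i = c y z" using IJ by auto
      then show "u x i - u z i = c x y + c y z" by linarith
    qed
  qed
  \<comment> \<open>\<open>g\<close> maps a tail of the ray to a tail, with shifted indices; the
    limit of an eventually constant sequence does not notice the shift.\<close>
  have c_act: "c (\<rho> g x) (\<rho> g y) = c x y" if g: "g \<in> carrier G" and V: "x \<in> V" "y \<in> V" for g x y
  proof -
    obtain m n where mn: "\<And>i. r (m + i) = \<rho> g (r (n + i))" using inv[OF g] by blast
    obtain I where I: "\<forall>i\<ge>I. u x i - u y i = c x y" using c[OF V] by blast
    show ?thesis
    proof (rule lim[of _ _ "m + I"])
      fix i assume "m + I \<le> i"
      then have k: "i = m + (i - m)" "I \<le> i - m" by auto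
      have "r i = \<rho> g (r (n + (i - m)))" using mn[of "i - m"] k(1) by simp
      then have "u (\<rho> g w) i = u w (n + (i - m))" if "w \<in> V" for w
        unfolding u_def using flow_act[OF g e that R] by simp
      then show "u (\<rho> g x) i - u (\<rho> g y) i = c x y" using I k V by simp
    qed (use g V in auto)
  qed
  show ?thesis
    unfolding trivial_qm_def
  proof (intro exI conjI ballI)
    fix g h assume gh: "g \<in> carrier G" "h \<in> carrier G"
    have "c v (\<rho> (g \<otimes> h) v) = c v (\<rho> g v) + c (\<rho> g v) (\<rho> g (\<rho> h v))"
      using c_add[of v "\<rho> g v" "\<rho> g (\<rho> h v)"] gh v by (simp add: act_mult)
    then show "real_of_int (c v (\<rho> (g \<otimes> h) v)) = real_of_int (c v (\<rho> g v)) + real_of_int (c v (\<rho> h v))"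
      using c_act gh v by simp
  next
    fix g assume g: "g \<in> carrier G"
    have gv: "\<rho> g v \<in> V" using g v by simp
    \<comment> \<open>Far out on the ray the flow difference equals \<open>c\<close>; the error is
      that of \<open>flow_quasi_cocycle\<close> for \<open>v\<close>, \<open>\<rho> g v\<close> and
      \<open>r I\<close>.\<close>
    obtain I where "u v I - u (\<rho> g v) I = c v (\<rho> g v)" using c[OF v gv] by blast
    then have "\<bar>flow ?a ?b v (\<rho> g v) - c v (\<rho> g v)\<bar> \<le> 6 * (int (d ?a ?b) + 1)"
      using flow_quasi_cocycle[OF e v gv R[of I]] unfolding u_def by linarith
    then have "real_of_int \<bar>flow ?a ?b v (\<rho> g v) - c v (\<rho> g v)\<bar> \<le> real_of_int (6 * (int (d ?a ?b) + 1))"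
      by (simp only: of_int_le_iff)
    then show "\<bar>qm v s g - real_of_int (c v (\<rho> g v))\<bar> \<le> real_of_int (6 * (int (d ?a ?b) + 1))"
      by (simp add: qm_def)
  qed
qed

end

section \<open>The locally transitive case and the remaining case\<close>

context minimal_tree_action
begin

text \<open>Measured from \<open>r 0\<close> the congruence holds for edges issuing from
  \<open>r 0\<close>, so some \<open>g\<close> fixes \<open>r 0\<close> and moves
  \<open>r 1\<close>. An element that fixes \<open>r 0\<close> and the end fixes a far vertex of the
  ray, hence the geodesic from \<open>r 0\<close> to it, which contains \<open>r 1\<close>.\<close>

lemma locally_transitive_not_fixes_end:
  assumes locally_transitive shows "\<not> fixes_end"
proof
  assume fixes_end
  then obtain r where r: "r \<in> rays T"
    and inv: "\<And>g. g \<in> carrier G \<Longrightarrow> \<exists>m n. \<forall>i. r (m + i) = \<rho> g (r (n + i))"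
    using fixed_end_ray by blast
  note R = rayD[OF r]
  let ?x = "r 0" and ?y = "r 1"
  have xy: "adj T ?x ?y" using dist_1_adj R(1) R(2)[of 0 1] by simp
  obtain z where z: "adj T ?x z" "z \<noteq> ?y" using ex_third_neighbour[OF R(1)] by blast
  have zV: "z \<in> V" using adjD z by blast
  obtain l where l: "transitive_on_segments G \<rho> {s \<in> segments T 1. d (hd s) ?x mod l = 0}"
    using assms R(1) by blast
  have seg: "geod T ?x w \<in> {s \<in> segments T 1. d (hd s) ?x mod l = 0}" if "adj T ?x w" for w
    using geod_props[OF R(1)[of 0] adjD(2)[OF that]] dist_adj[OF that] R(1)[of 0]
    by (simp add: segments_def seg_length_def)
  obtain g where g: "g \<in> carrier G" "map (\<rho> g) (geod T ?x ?y) = geod T ?x z"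
    using transitive_on_segmentsD(2)[OF l seg[OF xy] seg[OF z(1)]] by blast
  note p = geod_props[OF R(1)[of 0] R(1)[of 1]] geod_props[OF R(1)[of 0] zV]
  have ne: "geod T ?x ?y \<noteq> []" using p(4) by auto
  have gx: "\<rho> g ?x = ?x" using arg_cong[OF g(2), of hd] p ne by (simp add: hd_map)
  have gy: "\<rho> g ?y = z" using arg_cong[OF g(2), of last] p ne by (simp add: last_map)
  obtain m n where mn: "\<And>i. r (m + i) = \<rho> g (r (n + i))" using inv[OF g(1)] by blast
  have dn: "d ?x (\<rho> g (r n)) = n" using act_dist[OF g(1) R(1)[of 0] R(1)[of n]] gx R(2)[of 0 n]
    by simp
  have "r m = \<rho> g (r n)" using mn[of 0] by simp
  moreover have "d ?x (r m) = m" using R(2)[of 0 m] by simp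
  ultimately have "m = n" using dn by metis
  let ?w = "r (m + 1)"
  have w: "\<rho> g ?w = ?w" using mn[of 1] \<open>m = n\<close> by simp
  have dw: "d ?x ?w = m + 1" using R(2)[of 0 "m + 1"] by simp
  have "pt ?x ?w 1 = ?y" by (rule pt_eqI) (use R(1) R(2)[of 0 1] R(2)[of 1 "m + 1"] dw in simp_all)
  then have "\<rho> g ?y = ?y" using act_pt[OF g(1) R(1)[of 0] R(1)[of "m + 1"], of 1] gx w dw by simp
  then show False using gy z by simp
qed

text \<open>Whether a translate of \<open>s\<close> starts at a position depends only on the class
  mod \<open>l\<close> of the vertex there. Since \<open>v\<close> and \<open>\<rho> g v\<close> lie
  in the same class, the same positions occur in both directions.\<close>

lemma locally_transitive_qm_zero:
  assumes locally_transitive and s: "geodesic T s" and v: "v \<in> V" and g: "g \<in> carrier G"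
  shows "qm v s g = 0"
proof -
  obtain l :: nat where l12: "l \<in> {1, 2}"
    and tr: "\<And>n w. w \<in> V \<Longrightarrow> transitive_on_segments G \<rho> {s \<in> segments T n. d (hd s) w mod l = 0}"
    using assms(1) by blast
  have l: "l = 1 \<or> l = 2" using l12 by blast
  let ?a = "hd s" and ?b = "last s"
  let ?n = "d ?a ?b"
  note e = geodesic_ends[OF s]
  have sn: "s \<in> segments T ?n" using s by (simp add: segments_def seg_length_def geodesic_def)
  let ?X = "{t \<in> segments T ?n. d (hd t) ?a mod l = 0}"
  note trX = transitive_on_segmentsD[OF tr[OF e(1), of ?n]]
  have sX: "s \<in> ?X" using sn e by simp
  have iff: "eqv ?a ?b x y \<longleftrightarrow> d x ?a mod l = 0" if xy: "x \<in> V" "y \<in> V" "d x y = ?n" for x y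
  proof
    assume "eqv ?a ?b x y"
    then obtain h where h: "h \<in> carrier G" "\<rho> h ?a = x" unfolding eqv_def by blast
    then show "d x ?a mod l = 0" using trX(1)[OF h(1) sX] hd_map_segment[OF sn, of "\<rho> h"] by simp
  next
    assume "d x ?a mod l = 0"
    then have gX: "geod T x y \<in> ?X" using geod_props[OF xy(1,2)] xy(3)
      by (simp add: segments_def seg_length_def)
    obtain h where h: "h \<in> carrier G" "map (\<rho> h) s = geod T x y" using trX(2)[OF sX gX] ..
    have ne: "s \<noteq> []" using s by (auto simp: geodesic_def walk_def)
    then have "\<rho> h ?a = x" "\<rho> h ?b = y"
      using geod_props(2,3)[OF xy(1,2)] hd_map[OF ne, of "\<rho> h"] last_map[OF ne, of "\<rho> h"] h(2)
        by simp_all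
    then show "eqv ?a ?b x y" using h unfolding eqv_def by blast
  qed
  let ?w = "\<rho> g v"
  have w: "?w \<in> V" using g v by simp
  \<comment> \<open>Segments of length 0 are vertices, so their invariance shows that
    \<open>g\<close> preserves the class of \<open>v\<close> mod \<open>l\<close>.\<close>
  have vv: "[v] \<in> {t \<in> segments T 0. d (hd t) v mod l = 0}"
    using v by (simp add: segments_def seg_length_def geodesic_def walk_Cons)
  have wv: "d ?w v mod l = 0" using transitive_on_segmentsD(1)[OF tr[OF v] g vv] by simp
  have par: "d (pt x y i) ?a mod l = (d v ?a + i) mod l"
    if "x \<in> V" "y \<in> V" "i \<le> d x y" "d x v mod l = 0" for x y i
  proof -
    note p = pt_dist[OF that(1-3)]
    have "even (i + d (pt x y i) ?a + d x ?a)" using dist_parity[OF that(1) p(1) e(1)] p(2) by simp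
    moreover have "even (d x v + d v ?a + d x ?a)" using dist_parity[OF that(1) v e(1)] .
    ultimately show ?thesis using l that(4) by (elim disjE) (simp, simp, presburger)
  qed
  have "occ ?a ?b x y = {i. i + ?n \<le> d x y \<and> (d v ?a + i) mod l = 0}"
    if "x \<in> V" "y \<in> V" "d x v mod l = 0" for x y
    unfolding occ_def using iff[OF pt_dist(1)[OF that(1,2)] pt_dist(1)[OF that(1,2)]]
      pt_pt_dist(1)[OF that(1,2)] par[OF that(1,2) _ that(3)] by auto
  from this[OF v w] this[OF w v wv] have "occ ?a ?b v ?w = occ ?a ?b ?w v"
    using v dist_sym[OF v w] by simp
  then show ?thesis by (simp add: qm_def flow_def cnt_def)
qed

text \<open>The words are based at \<open>p\<close> but the quasimorphisms at \<open>v\<close>.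
  Changing the base vertex costs at most \<open>4 * d v p\<close>, uniformly in \<open>k\<close>;
  this is the constant \<open>E\<close> of \<open>family_nontrivial\<close>.\<close>

lemma independent_family:
  assumes no_end: "\<not> fixes_end" and not_trans: "\<not> locally_transitive" and v: "v \<in> V"
  shows "\<exists>s :: nat \<Rightarrow> 'v list. (\<forall>k. geodesic T (s k)) \<and> lin_indep_family H (\<lambda>k. median_class G T \<rho> v (s k))"
    and "\<exists>\<phi>. linear_map ell1 H \<phi> \<and> inj_on \<phi> (carrier ell1)"
proof -
  obtain p q a b n \<tau> where "word_construction T G \<rho> p q a b n \<tau>"
    using ex_word_construction[OF no_end not_trans] by blast
  then interpret W: word_construction T G \<rho> p q a b n \<tau> .
  define t where "t k = W.tip (W.run False k)" for k
  define s where "s k = geod T p (t k)" for k :: nat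
  have tV: "t k \<in> V" for k by (simp add: t_def)
  have sp: "geodesic T (s k)" "hd (s k) = p" "last (s k) = t k" for k
    using geod_props[OF W.pqV(1) tV] by (auto simp: s_def)
  define h where "h k g = real_of_int (flow p (t k) p (\<rho> g p))" for k g
  have qm: "qm v (s k) g = real_of_int (flow p (t k) v (\<rho> g v))" for k g by (simp add: qm_def sp)
  have close: "\<bar>qm v (s k) g - h k g\<bar> \<le> 4 * real (d v p)" if g: "g \<in> carrier G" for k g
  proof -
    have "\<bar>flow p (t k) v (\<rho> g v) - flow p (t k) p (\<rho> g p)\<bar> \<le> 4 * int (d v p)"
      using flow_lipschitz[OF W.pqV(1) tV v _ W.pqV(1), of "\<rho> g v" "\<rho> g p"] g v by simp
    then have "real_of_int \<bar>flow p (t k) v (\<rho> g v) - flow p (t k) p (\<rho> g p)\<bar> \<le> real_of_int (4 * int (d v p))"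
      by (simp only: of_int_le_iff)
    then show ?thesis by (simp add: qm h_def)
  qed
  have fin: "\<bar>qm v (s k) g\<bar> \<le> 2 * real (d v (\<rho> g v))" if g: "g \<in> carrier G" for k g
  proof -
    have "real_of_int \<bar>flow p (t k) v (\<rho> g v)\<bar> \<le> real_of_int (2 * int (d v (\<rho> g v)))"
      unfolding of_int_le_iff using flow_le[OF W.pqV(1) tV v] g v by simp
    then show ?thesis by (simp add: qm)
  qed
  have perm: "\<exists>x\<in>carrier G. \<exists>y\<in>carrier G. \<exists>z\<in>carrier G.
      W.wd False k = x \<otimes> y \<otimes> z \<and> W.wd True k = x \<otimes> z \<otimes> y" for k
    using W.wd_eq[of k] by metis
  have own: "real m \<le> h k (W.wd False k [^] m)" for k m
    using W.flow_own_word[of m k] unfolding h_def t_def by linarith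
  have swapped: "h k (W.wd True k [^] (m :: nat)) \<le> 0" for k m
    using W.flow_swapped_word[of k m] by (simp add: h_def t_def)
  have other: "h k (W.wd f i [^] (m :: nat)) = 0" if "i \<noteq> k" for k i f m
    using W.flow_other_word[OF that] by (simp add: h_def t_def)
  have D: "1 \<le> 6 * (real (d (hd (s k)) (last (s k))) + 1)" for k by simp
  have nontriv: "c N = 0" if "summable (\<lambda>k. \<bar>c k\<bar>)" "trivial_qm (\<lambda>g. \<Sum>k. c k * qm v (s k) g)" for c N
    by (rule family_nontrivial[where f = "\<lambda>k. qm v (s k)" and h = h and w = "W.wd False" and w' = "W.wd True"])
      (use close fin perm own swapped other that in auto)
  note emb = embedding_of_family[where f = "\<lambda>k. qm v (s k)"
      and D = "\<lambda>k. 6 * (real (d (hd (s k)) (last (s k))) + 1)"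
        and L = "\<lambda>g. 2 * real (d v (\<rho> g v))", OF D qm_defect[OF sp(1) v] fin]
  have "lin_indep_family H (\<lambda>k. cls (qm v (s k)))"
    by (rule emb(1)) (assumption | erule (1) nontriv)+
  then have "lin_indep_family H (\<lambda>k. median_class G T \<rho> v (s k))"
    using median_class_eq[OF sp(1) v] by simp
  then show "\<exists>s :: nat \<Rightarrow> 'v list. (\<forall>k. geodesic T (s k)) \<and> lin_indep_family H (\<lambda>k. median_class G T \<rho> v (s k))"
    using sp(1) by (intro exI[of _ s] conjI allI)
  show "\<exists>\<phi>. linear_map ell1 H \<phi> \<and> inj_on \<phi> (carrier ell1)"
    by (rule emb(2)) (assumption | erule (1) nontriv)+
qed

lemma independent_classes_nontrivial:
  assumes v: "v \<in> V" and s: "\<And>k. geodesic T (s k)"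
    and indep: "lin_indep_family H (\<lambda>k::nat. median_class G T \<rho> v (s k))"
  shows "\<not> trivial_qm (qm v (s 0))"
  using lin_indep_nontrivial[of "\<lambda>k. qm v (s k)" 0] indep quasi_qm[OF s v]
  unfolding median_class_eq[OF s v] by blast

end

theorem theorem1:
  fixes G :: "('g, 'm) monoid_scheme"
    and T :: "'v sgraph"
    and \<rho> :: "'g \<Rightarrow> 'v \<Rightarrow> 'v"
    and v :: 'v
  assumes "group G"
    and "is_tree T"
    and "\<rho> \<in> hom G (Aut_tree T)"
    and "minimal_action G T \<rho>"
    and "\<forall>x\<in>verts T. valence_gt T x 2"
    and "v \<in> verts T"
  defines "locally_transitive \<equiv>
      \<exists>l\<in>{1, 2::nat}. \<forall>n. \<forall>w\<in>verts T.
        transitive_on_segments G \<rho> {s \<in> segments T n. gdist T (hd s) w mod l = 0}"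
    and "fixes_end \<equiv> \<exists>a\<in>tree_boundary T. fixes_boundary_point G \<rho> a"
    and "independent_median_classes \<equiv>
      \<exists>s :: nat \<Rightarrow> 'v list. (\<forall>n. geodesic T (s n)) \<and>
        lin_indep_family (H2b G) (\<lambda>n. median_class G T \<rho> v (s n))"
  shows "(locally_transitive \<or> fixes_end \<or> independent_median_classes) \<and>
      \<not> (locally_transitive \<and> fixes_end) \<and>
      \<not> (locally_transitive \<and> independent_median_classes) \<and>
      \<not> (fixes_end \<and> independent_median_classes) \<and>
      (independent_median_classes \<longrightarrow>
        (\<exists>\<phi>. linear_map ell1 (H2b G) \<phi> \<and> inj_on \<phi> (carrier ell1)))"
proof -
  interpret G: group G by (rule assms(1))
  interpret A: minimal_tree_action T G \<rho>
    using assms(2-5) by unfold_locales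
  note v = assms(6)
  have 1: "\<not> (locally_transitive \<and> fixes_end)"
    using A.locally_transitive_not_fixes_end unfolding locally_transitive_def fixes_end_def by blast
  \<comment> \<open>A member of an independent family has a nonzero class, which both a fixed end
    and local transitivity exclude.\<close>
  have nontriv: "\<exists>s. geodesic T s \<and> \<not> G.trivial_qm (A.qm v s)" if independent_median_classes
    using that A.independent_classes_nontrivial[OF v] unfolding independent_median_classes_def
      by blast
  have 2: "\<not> (fixes_end \<and> independent_median_classes)"
    using nontriv A.fixed_end_trivial[OF _ _ v] unfolding fixes_end_def by blast
  have 3: "\<not> (locally_transitive \<and> independent_median_classes)"
  proof
    assume lt: "locally_transitive \<and> independent_median_classes"
    then obtain s where s: "geodesic T s" "\<not> G.trivial_qm (A.qm v s)" using nontriv by blast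
    have "A.qm v s g = 0" if "g \<in> carrier G" for g
      using A.locally_transitive_qm_zero[OF _ s(1) v that] lt unfolding locally_transitive_def
        by blast
    then have "G.trivial_qm (A.qm v s)"
      unfolding G.trivial_qm_def by (intro exI[of _ "\<lambda>_. 0"] exI[of _ 0]) simp
    then show False using s(2) by blast
  qed
  have 4: "independent_median_classes" if "\<not> fixes_end" "\<not> locally_transitive"
    using A.independent_family(1)[OF _ _ v] that
    unfolding independent_median_classes_def fixes_end_def locally_transitive_def by blast
  have 5: "\<exists>\<phi>. linear_map ell1 (H2b G) \<phi> \<and> inj_on \<phi> (carrier ell1)"
    if "\<not> fixes_end" "\<not> locally_transitive"
    using A.independent_family(2)[OF _ _ v] that unfolding fixes_end_def locally_transitive_def
      by blast
  \<comment> \<open>For the last conjunct, independence excludes the other two alternatives by 2 and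
    3, and then 5 provides the embedding.\<close>
  show ?thesis using 1 2 3 4 5 by blast
qed

end
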